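(* Let $m,p\ge 1$, $q=m+p$, and $L\ge 0$ an integer. Let $Q_\Phi$ be a QDF with minimal coefficient matrix $\Phi\in\mathbb{S}^{(\deg(Q_\Phi)+1)q}$ and set $d:=\max\{\deg(Q_\Phi),L\}$. Let $\mathfrak{B}_\ast\in\mathfrak{L}^{\mathrm{cont}}_{m,p,L}$ and let the data $w_{[0,T-1]}\in\mathfrak{B}_\ast|_{[0,T-1]}$ be given with $T\ge d+1$. Put $H:=\mathcal{H}_{d+1}(w_{[0,T-1]})$. Then: (i) If $\operatorname{rank} H = n_{\min}+m(d+1)$ and there exists a positive semidefinite $\Psi\in\mathbb{S}^{qd}$ such that $$H^\top\left(\begin{bmatrix}\Psi&0\\0&0_{q,q}\end{bmatrix}-\begin{bmatrix}0_{q,q}&0\\0&\Psi\end{bmatrix}+\begin{bmatrix}\Phi&0\\0&0\end{bmatrix}\right)H\ge 0 \qquad ( * )$$ (where $\Phi$ is padded with zeros to size $(d+1)q$), then the data $w_{[0,T-1]}$ are informative for dissipativity with respect to $Q_\Phi$, and $Q_\Psi$ is a storage function for $(\mathfrak{B}_\ast,Q_\Phi)$. (ii) Assume in addition that $Q_\Phi$ is static, i.e. $\Phi\in\mathbb{S}^q$, partitioned as $\Phi=\begin{bmatrix}\Phi_{11}&\Phi_{12}\\\Phi_{21}&\Phi_{22}\end{bmatrix}$ with $\Phi_{11}\in\mathbb{S}^m$, $\Phi_{12}=\Phi_{21}^\top\in\mathbb{R}^{m\times p}$, $\Phi_{22}\in\mathbb{S}^p$, that $\Phi$ has inertia $(p,0,m)$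 and $\Phi_{22}\le 0$. Then the data $w_{[0,T-1]}$ are informative for dissipativity with respect to $Q_\Phi$ if and only if $\operatorname{rank}H=n_{\min}+m(L+1)$ and there exists a positive semidefinite $\Psi\in\mathbb{S}^{qL}$ satisfying $( * )$.
   Context: Time axis $\mathbb{Z}_+$. For $A\in\mathbb{R}^{n\times n},B\in\mathbb{R}^{n\times m},C\in\mathbb{R}^{p\times n},D\in\mathbb{R}^{p\times m}$ ($n\ge0$), the (input-output) behavior is $\mathfrak{B}=\{w=(u,y):\mathbb{Z}_+\to\mathbb{R}^{q}\mid \exists x:\mathbb{Z}_+\to\mathbb{R}^n,\ x(t+1)=Ax(t)+Bu(t),\ y(t)=Cx(t)+Du(t)\ \forall t\}$; $(A,B,C,D)$ is a state-space representation of $\mathfrak{B}$. $\mathfrak{L}_{m,p}$ is the set of all such behaviors. $n(\mathfrak{B})$ is the smallest state dimension among its representations. The observability matrix $\mathcal{O}_k$ stacks $C,CA,\dots,CA^{k-1}$ ($\mathcal{O}_0$ void); the lag $\ell(C,A)$ is the smallest $k\ge0$ with $\operatorname{rank}\mathcal{O}_k=\operatorname{rank}\mathcal{O}_{k+1}$, and $\ell(\mathfrak{B}):=\ell(C,A)$ for any representation. $\mathfrak{B}$ is controllable if for all $w_1,w_2\in\mathfrak{B}$ and $t_1\in\mathbb{Z}_+$ there are $w\in\mathfrak{B}$, $t_2\ge t_1$ with $w(t)=w_1(t)$ on $[0,t_1]$ and $w(t)=w_2(t-t_2)$ for $t\ge t_2$. $\mathfrak{L}^{\mathrm{cont}}_{m,p,L}$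 is the set of controllable $\mathfrak{B}\in\mathfrak{L}_{m,p}$ with $\ell(\mathfrak{B})\le L$. Restricted behavior: $\mathfrak{B}|_{[t_0,t_1]}=\{w_{[t_0,t_1]}\mid w\in\mathfrak{B}\}$, where $w_{[i,j]}=\operatorname{col}(w(i),\dots,w(j))$. $\Sigma:=\{\mathfrak{B}\in\mathfrak{L}_{m,p}\mid w_{[0,T-1]}\in\mathfrak{B}|_{[0,T-1]}\}$ and $n_{\min}:=\min\{n(\mathfrak{B})\mid\mathfrak{B}\in\Sigma\}$. $\mathcal{H}_k(w_{[0,T-1]})$ is the depth-$k$ block Hankel matrix whose $(i,j)$ block is $w(i+j)$, $i\in[0,k-1]$, $j\in[0,T-k]$. A QDF with coefficient matrix $\Psi\in\mathbb{S}^{(M+1)q}$ ($M\ge -1$; $M=-1$ means $\Psi$ is the void $0\times0$ matrix and $Q_\Psi=0$) is $Q_\Psi(w)(t)=w_{[t,t+M]}^\top\Psi w_{[t,t+M]}$. Its degree is the smallest $d'\ge-1$ such that all blocks $\Psi_{i,j}$ ($q\times q$) with $i>d'$ vanish; a coefficient matrix of size $(\deg+1)q$ is called minimal; the QDF is static if its degree is $0$. $\nabla\Psi:=\begin{bmatrix}0_{q,q}&0\\0&\Psi\end{bmatrix}-\begin{bmatrix}\Psi&0\\0&0_{q,q}\end{bmatrix}$, so $Q_{\nabla\Psi}(w)(t)=Q_\Psi(w)(t+1)-Q_\Psi(w)(t)$. $Q_{\Psi_1}\le Q_{\Psi_2}$ on $\mathfrak{B}$ means $Q_{\Psi_1}(w)(t)\le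 Q_{\Psi_2}(w)(t)$ for all $w\in\mathfrak{B}$, $t\in\mathbb{Z}_+$. A storage function for $(\mathfrak{B},Q_\Phi)$ is a QDF $Q_\Psi$ with $Q_\Psi\ge0$ on $\mathfrak{B}$ and $Q_{\nabla\Psi}\le Q_\Phi$ on $\mathfrak{B}$. The data are informative for dissipativity with respect to $Q_\Phi$ if there exists a positive semidefinite $\Psi\in\mathbb{S}^{qd}$, $d=\max\{\deg(Q_\Phi),L\}$, with $Q_{\nabla\Psi}\le Q_\Phi$ on $\mathfrak{B}$ for all $\mathfrak{B}\in\Sigma\cap\mathfrak{L}^{\mathrm{cont}}_{m,p,L}$. Inertia $(a,b,c)$ means $a$ negative, $b$ zero, $c$ positive eigenvalues. *)

theory Defs
  imports "Jordan_Normal_Form.DL_Rank" "Jordan_Normal_Form.Char_Poly"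
begin

definition rk :: "real mat \<Rightarrow> nat" where
  "rk A = vec_space.rank (dim_row A) A"

definition sym_mat :: "nat \<Rightarrow> real mat \<Rightarrow> bool" where
  "sym_mat k A \<longleftrightarrow> A \<in> carrier_mat k k \<and> transpose_mat A = A"

definition psd :: "real mat \<Rightarrow> bool" where
  "psd A \<longleftrightarrow> sym_mat (dim_row A) A \<and>
     (\<forall>v \<in> carrier_vec (dim_row A). scalar_prod v (A *\<^sub>v v) \<ge> 0)"

definition is_ss_rep :: "nat \<Rightarrow> nat \<Rightarrow> nat \<Rightarrow> real mat \<Rightarrow> real mat \<Rightarrow> real mat \<Rightarrow> real mat \<Rightarrow> bool" where
  "is_ss_rep m p n A B C D \<longleftrightarrow> A \<in> carrier_mat n n \<and> B \<in> carrier_mat n m \<and>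
      C \<in> carrier_mat p n \<and> D \<in> carrier_mat p m"

definition sig_u :: "nat \<Rightarrow> (nat \<Rightarrow> real vec) \<Rightarrow> nat \<Rightarrow> real vec" where
  "sig_u m w t = vec m (\<lambda>i. w t $ i)"

definition sig_y :: "nat \<Rightarrow> nat \<Rightarrow> (nat \<Rightarrow> real vec) \<Rightarrow> nat \<Rightarrow> real vec" where
  "sig_y m p w t = vec p (\<lambda>i. w t $ (m + i))"

definition ss_behavior :: "nat \<Rightarrow> nat \<Rightarrow> real mat \<Rightarrow> real mat \<Rightarrow> real mat \<Rightarrow> real mat \<Rightarrow> (nat \<Rightarrow> real vec) set" where
  "ss_behavior m p A B C D = {w. (\<forall>t. w t \<in> carrier_vec (m + p)) \<and>
     (\<exists>x. \<forall>t. x t \<in> carrier_vec (dim_row A) \<and>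
        x (Suc t) = A *\<^sub>v x t + B *\<^sub>v sig_u m w t \<and>
        sig_y m p w t = C *\<^sub>v x t + D *\<^sub>v sig_u m w t)}"

definition is_rep_of :: "nat \<Rightarrow> nat \<Rightarrow> (nat \<Rightarrow> real vec) set \<Rightarrow> nat \<Rightarrow> real mat \<Rightarrow> real mat \<Rightarrow> real mat \<Rightarrow> real mat \<Rightarrow> bool" where
  "is_rep_of m p Bh n A B C D \<longleftrightarrow> is_ss_rep m p n A B C D \<and> Bh = ss_behavior m p A B C D"

definition L_class :: "nat \<Rightarrow> nat \<Rightarrow> (nat \<Rightarrow> real vec) set set" where
  "L_class m p = {Bh. \<exists>n A B C D. is_rep_of m p Bh n A B C D}"

definition n_of :: "nat \<Rightarrow> nat \<Rightarrow> (nat \<Rightarrow> real vec) set \<Rightarrow> nat" where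
  "n_of m p Bh = (LEAST n. \<exists>A B C D. is_rep_of m p Bh n A B C D)"

definition obs_mat :: "nat \<Rightarrow> real mat \<Rightarrow> real mat \<Rightarrow> real mat" where
  "obs_mat k C A = mat (k * dim_row C) (dim_col A)
     (\<lambda>(i, j). (C * (A ^\<^sub>m (i div dim_row C))) $$ (i mod dim_row C, j))"

definition lag_CA :: "real mat \<Rightarrow> real mat \<Rightarrow> nat" where
  "lag_CA C A = (LEAST k. rk (obs_mat k C A) = rk (obs_mat (Suc k) C A))"

(* lag of a behavior: lag of (C,A) for any (here: some chosen) representation;
   independent of the representation *)
definition lag_of :: "nat \<Rightarrow> nat \<Rightarrow> (nat \<Rightarrow> real vec) set \<Rightarrow> nat" where
  "lag_of m p Bh = (SOME l. \<exists>n A B C D. is_rep_of m p Bh n A B C D \<and> l = lag_CA C A)"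

definition controllable :: "(nat \<Rightarrow> real vec) set \<Rightarrow> bool" where
  "controllable Bh \<longleftrightarrow> (\<forall>w1 \<in> Bh. \<forall>w2 \<in> Bh. \<forall>t1. \<exists>w \<in> Bh. \<exists>t2 \<ge> t1.
      (\<forall>t \<le> t1. w t = w1 t) \<and> (\<forall>t \<ge> t2. w t = w2 (t - t2)))"

definition L_cont :: "nat \<Rightarrow> nat \<Rightarrow> nat \<Rightarrow> (nat \<Rightarrow> real vec) set set" where
  "L_cont m p L = {Bh \<in> L_class m p. controllable Bh \<and> lag_of m p Bh \<le> L}"

definition restr :: "(nat \<Rightarrow> real vec) set \<Rightarrow> nat \<Rightarrow> nat \<Rightarrow> real vec list set" where
  "restr Bh t0 t1 = {map w [t0..<Suc t1] | w. w \<in> Bh}"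

definition Sigma_data :: "nat \<Rightarrow> nat \<Rightarrow> real vec list \<Rightarrow> (nat \<Rightarrow> real vec) set set" where
  "Sigma_data m p wd = {Bh \<in> L_class m p. wd \<in> restr Bh 0 (length wd - 1)}"

definition n_min :: "nat \<Rightarrow> nat \<Rightarrow> real vec list \<Rightarrow> nat" where
  "n_min m p wd = (LEAST k. \<exists>Bh \<in> Sigma_data m p wd. k = n_of m p Bh)"

definition hankel :: "nat \<Rightarrow> nat \<Rightarrow> real vec list \<Rightarrow> real mat" where
  "hankel q k wd = mat (k * q) (length wd - k + 1) (\<lambda>(i, j). (wd ! (i div q + j)) $ (i mod q))"

definition stack :: "nat \<Rightarrow> (nat \<Rightarrow> real vec) \<Rightarrow> nat \<Rightarrow> nat \<Rightarrow> real vec" where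
  "stack q w t k = vec (k * q) (\<lambda>i. w (t + i div q) $ (i mod q))"

(* QDF Q_Psi(w)(t) for Psi of size (M+1)q; the void matrix gives 0 *)
definition qdf :: "nat \<Rightarrow> real mat \<Rightarrow> (nat \<Rightarrow> real vec) \<Rightarrow> nat \<Rightarrow> real" where
  "qdf q Psi w t = (let v = stack q w t (dim_row Psi div q) in scalar_prod v (Psi *\<^sub>v v))"

definition qdf_deg :: "nat \<Rightarrow> real mat \<Rightarrow> int" where
  "qdf_deg q Psi = int (LEAST k. \<forall>i j. i < dim_row Psi \<longrightarrow> j < dim_col Psi \<longrightarrow>
       k \<le> i div q \<longrightarrow> Psi $$ (i, j) = 0) - 1"

definition nabla :: "nat \<Rightarrow> real mat \<Rightarrow> real mat" where
  "nabla q Psi = four_block_mat (0\<^sub>m q q) (0\<^sub>m q (dim_col Psi)) (0\<^sub>m (dim_row Psi) q) Psi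
              - four_block_mat Psi (0\<^sub>m (dim_row Psi) q) (0\<^sub>m q (dim_col Psi)) (0\<^sub>m q q)"

definition qdf_le_on :: "nat \<Rightarrow> (nat \<Rightarrow> real vec) set \<Rightarrow> real mat \<Rightarrow> real mat \<Rightarrow> bool" where
  "qdf_le_on q Bh Psi1 Psi2 \<longleftrightarrow> (\<forall>w \<in> Bh. \<forall>t. qdf q Psi1 w t \<le> qdf q Psi2 w t)"

definition storage_function :: "nat \<Rightarrow> (nat \<Rightarrow> real vec) set \<Rightarrow> real mat \<Rightarrow> real mat \<Rightarrow> bool" where
  "storage_function q Bh Phi Psi \<longleftrightarrow> (\<forall>w \<in> Bh. \<forall>t. 0 \<le> qdf q Psi w t) \<and>
     qdf_le_on q Bh (nabla q Psi) Phi"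

definition informative_diss :: "nat \<Rightarrow> nat \<Rightarrow> nat \<Rightarrow> real vec list \<Rightarrow> real mat \<Rightarrow> bool" where
  "informative_diss m p L wd Phi \<longleftrightarrow>
     (let q = m + p; d = nat (max (qdf_deg q Phi) (int L)) in
      \<exists>Psi. sym_mat (q * d) Psi \<and> psd Psi \<and>
        (\<forall>Bh \<in> Sigma_data m p wd \<inter> L_cont m p L. qdf_le_on q Bh (nabla q Psi) Phi))"

definition pad_mat :: "nat \<Rightarrow> real mat \<Rightarrow> real mat" where
  "pad_mat k Phi = four_block_mat Phi (0\<^sub>m (dim_row Phi) (k - dim_col Phi))
       (0\<^sub>m (k - dim_row Phi) (dim_col Phi)) (0\<^sub>m (k - dim_row Phi) (k - dim_col Phi))"

definition lmi_cond :: "nat \<Rightarrow> nat \<Rightarrow> real mat \<Rightarrow> real mat \<Rightarrow> real mat \<Rightarrow> bool" where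
  "lmi_cond q d Phi Psi H \<longleftrightarrow>
     psd (transpose_mat H *
       (four_block_mat Psi (0\<^sub>m (dim_row Psi) q) (0\<^sub>m q (dim_col Psi)) (0\<^sub>m q q)
        - four_block_mat (0\<^sub>m q q) (0\<^sub>m q (dim_col Psi)) (0\<^sub>m (dim_row Psi) q) Psi
        + pad_mat ((d + 1) * q) Phi) * H)"

definition inertia :: "real mat \<Rightarrow> nat \<times> nat \<times> nat" where
  "inertia A = ((\<Sum>a | poly (char_poly A) a = 0 \<and> a < 0. order a (char_poly A)),
                order 0 (char_poly A),
                (\<Sum>a | poly (char_poly A) a = 0 \<and> a > 0. order a (char_poly A)))"

definition block22 :: "nat \<Rightarrow> nat \<Rightarrow> real mat \<Rightarrow> real mat" where
  "block22 m p Phi = mat p p (\<lambda>(i, j). Phi $$ (m + i, m + j))"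

end

theory Submission
  imports Defs "HOL-Library.Function_Algebras"
begin

text \<open>For part (i), the rank condition identifies the column space of H with the length d + 1 windows of a
  minimal explanation of the data. Every controllable explanation of lag at most L contains that minimal
  one and, by controllability, coincides with it, so the matrix inequality is dissipativity on all windows.

  For the converse in part (ii), suppose a window of the true behavior lies outside the column space of H
  and let r be a linear functional that vanishes on the columns but not on this window. Adding \<theta> times r to
  the law that determines one output from the past window keeps the data consistent and the lag at most L.
  Choosing the law outside the true behavior so that it contains a chain of first-order filters with generic
  poles makes the perturbed system controllable for all but finitely many \<theta>. Summing the dissipation
  inequality over L + 1 steps bounds a quadratic polynomial in \<theta> from below by zero; comparing coefficients
  and using that the output block of \<Phi> is negative semidefinite produces a zero row of \<Phi>, contrary to
  nonsingularity.\<close>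

section \<open>Linear algebra on function spaces\<close>

text \<open>In the converse, dissipativity may be tested only on systems that are controllable and
  have lag at most L, so a perturbation of the true law has to keep both properties. The lag bound
  is built in by taking the last L samples as state, as in a shift register. Controllability is the
  obstacle: the perturbation pushes the register out of the space R of true windows of length L,
  into directions about which the true law says nothing. That freedom is the remedy: a feedback
  \<phi> that vanishes on R places poles there without touching the data. Since the gain \<theta>
  must become arbitrarily large with both signs, controllability is needed for all but finitely many
  \<theta>. The test trajectory differs from a true one within its first L + 1 samples only in one
  output at time L; hence the storage at time 0 does not depend on \<theta>, and the storage at time
  L + 1 is dropped because it is nonnegative. Systems are linear maps on real vector spaces of
  functions, since tuples, windows and output sequences all serve as states.\<close>

instantiation "fun" :: (type, real_vector) real_vector
begin
definition "r *\<^sub>R f = (\<lambda>x. r *\<^sub>R f x)"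
instance
  by standard (simp_all add: scaleR_fun_def fun_eq_iff scaleR_add_right scaleR_add_left)
end

lemma scaleR_fun_apply [simp]: "(r *\<^sub>R f) x = r *\<^sub>R f x"
  by (simp add: scaleR_fun_def)

lemma sum_fun_apply: "(\<Sum>i\<in>I. f i) x = (\<Sum>i\<in>I. f i x)"
  by (induct I rule: infinite_finite_induct) auto

lemma separating_functional:
  fixes x :: "'a::real_vector"
  assumes "subspace V" "x \<notin> V"
  obtains f :: "'a \<Rightarrow> real" where "linear f" "\<And>v. v \<in> V \<Longrightarrow> f v = 0" "f x = 1"
proof -
  obtain Bs where Bs: "Bs \<subseteq> V" "independent Bs" "V \<subseteq> span Bs"
    using basis_exists by metis
  have sp: "span Bs = V"
    using Bs assms(1) by (simp add: span_subspace)
  have ind: "independent (insert x Bs)"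
    using Bs(2) assms(2) sp by (simp add: independent_insert)
  obtain f :: "'a \<Rightarrow> real" where f: "linear f" "\<forall>b\<in>insert x Bs. f b = (if b = x then 1 else 0)"
    using linear_independent_extend[OF ind, of "\<lambda>b. if b = x then 1 else 0"] by blast
  have "f b = 0" if "b \<in> Bs" for b
    using f(2) that Bs(1) assms(2) by auto
  then have "f v = 0" if "v \<in> V" for v
    using linear_eq_0_on_span[OF f(1)] that sp by blast
  with f show ?thesis
    using that by auto
qed

text \<open>An indexed family rather than a set, because the applications (iterates of a map, images
  of basis vectors, free and impulse responses over a sum type) do not know beforehand that the
  members are distinct. A repetition \<open>x i = x j\<close> would itself be a nontrivial vanishing
  combination.\<close>

lemma family_card_le:
  fixes x :: "'i \<Rightarrow> 'a::real_vector"
  assumes fin: "finite I" "finite F" and sub: "x ` I \<subseteq> span F"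
    and ind: "\<And>c. (\<Sum>i\<in>I. c i *\<^sub>R x i) = 0 \<Longrightarrow> \<forall>i\<in>I. c i = 0"
  shows "card I \<le> card F"
proof -
  have inj: "inj_on x I"
  proof (rule inj_onI, rule ccontr)
    fix i j assume ij: "i \<in> I" "j \<in> I" "x i = x j" "i \<noteq> j"
    let ?c = "\<lambda>l. if l = i then 1 else if l = j then -1 else (0::real)"
    have "(\<Sum>l\<in>I. ?c l *\<^sub>R x l) = (\<Sum>l\<in>{i,j}. ?c l *\<^sub>R x l)"
      using ij fin by (intro sum.mono_neutral_right) auto
    also have "\<dots> = 0"
      using ij by simp
    finally show False
      using ind[of ?c] ij by auto
  qed
  have "independent (x ` I)"
  proof (rule independent_if_scalars_zero)
    show "finite (x ` I)" using fin by simp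
    fix c y assume "(\<Sum>v\<in>x ` I. c v *\<^sub>R v) = 0" "y \<in> x ` I"
    then show "c y = 0"
      using ind[of "c \<circ> x"] sum.reindex[OF inj, of "\<lambda>v. c v *\<^sub>R v"] by auto
  qed
  then have "card (x ` I) \<le> card F"
    using independent_span_bound[OF fin(2) _ sub] by blast
  then show ?thesis
    using card_image[OF inj] by simp
qed

lemma spanning_independent:
  assumes "finite F" "W \<subseteq> span F" "independent Bs" "Bs \<subseteq> W" "card F \<le> card Bs"
  shows "W \<subseteq> span Bs"
proof (rule ccontr)
  assume "\<not> W \<subseteq> span Bs"
  then obtain w where w: "w \<in> W" "w \<notin> span Bs" by blast
  have "finite Bs"
    using independent_span_bound[OF assms(1,3)] assms(2,4) by blast
  have "independent (insert w Bs)" "insert w Bs \<subseteq> span F"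
    using w assms by (auto simp: independent_insert)
  then have "card (insert w Bs) \<le> card F"
    using independent_span_bound[OF assms(1)] by blast
  moreover have "w \<notin> Bs"
    using w(2) by (auto intro: span_base)
  ultimately show False
    using assms(5) \<open>finite Bs\<close> by simp
qed

lemma linear_funpow:
  fixes f :: "'a::real_vector \<Rightarrow> 'a"
  assumes "linear f" shows "linear (f ^^ n)"
proof (induct n)
  case 0
  show ?case using linear_id by (simp add: id_def)
next
  case (Suc n)
  show ?case
    using linear_compose[OF Suc assms] by (simp add: o_def)
qed

section \<open>Discrete-time linear systems\<close>

primrec run :: "('x::real_vector \<Rightarrow> 'x) \<Rightarrow> ('u \<Rightarrow> 'x) \<Rightarrow> 'x \<Rightarrow> (nat \<Rightarrow> 'u) \<Rightarrow> nat \<Rightarrow> 'x" where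
  "run A B x u 0 = x"
| "run A B x u (Suc t) = A (run A B x u t) + B (u t)"

definition delay :: "nat \<Rightarrow> (nat \<Rightarrow> 'a::zero) \<Rightarrow> nat \<Rightarrow> 'a" where
  "delay d u t = (if t < d then 0 else u (t - d))"

lemma run_causal: "(\<And>s. s < t \<Longrightarrow> u s = v s) \<Longrightarrow> run A B x u t = run A B x v t"
  by (induct t) auto

lemma run_comb:
  assumes "linear A" "linear B"
  shows "run A B (a *\<^sub>R x + b *\<^sub>R y) (\<lambda>s. a *\<^sub>R u s + b *\<^sub>R v s) t = a *\<^sub>R run A B x u t + b *\<^sub>R run A B y v t"
  by (induct t)
    (simp_all add: linear_add[OF assms(1)] linear_add[OF assms(2)] linear_scale[OF assms(1)]
      linear_scale[OF assms(2)] scaleR_add_right)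

lemma run_zero:
  assumes "linear A" "linear B"
  shows "run A B 0 (\<lambda>s. 0) t = 0"
  by (induct t) (simp_all add: linear_0[OF assms(1)] linear_0[OF assms(2)])

lemma run_split:
  "run A B x u (s + t) = run A B (run A B x u s) (\<lambda>r. u (s + r)) t"
  by (induct t) simp_all

lemma run_delay_before:
  assumes "linear A" "linear B" "t \<le> d"
  shows "run A B 0 (delay d u) t = 0"
  using run_causal[of t "delay d u" "\<lambda>s. 0" A B 0] run_zero[OF assms(1,2)] assms(3)
  by (simp add: delay_def)

lemma run_delay:
  assumes "linear A" "linear B"
  shows "run A B 0 (delay d u) (d + t) = run A B 0 u t"
proof -
  have "(\<lambda>r. delay d u (d + r)) = u" by (simp add: delay_def fun_eq_iff)
  then show ?thesis
    using run_split[of A B 0 "delay d u" d t] run_delay_before[OF assms, of d d] by simp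
qed

lemma run_invariant:
  assumes "subspace R" "A ` R \<subseteq> R" "\<And>t. B (u t) \<in> R" "x \<in> R"
  shows "run A B x u t \<in> R"
  using assms by (induct t) (auto intro: subspace_add)

lemma run_free: 
  assumes "linear A" "linear B"
  shows "run A B x (\<lambda>s. 0) t = (A ^^ t) x"
  by (induct t) (simp_all add: linear_0[OF assms(2)])

lemma run_decomp:
  assumes "linear A" "linear B"
  shows "run A B x u t = (A ^^ t) x + run A B 0 u t"
  by (induct t) (simp_all add: linear_add[OF assms(1)] add.assoc)

text \<open>Zero is an equilibrium, so the input can be preceded by \<open>N' - N\<close> steps at
  rest.\<close>

lemma reach_mono:
  assumes lin: "linear A" "linear B" and N: "run A B 0 u N = r" "N \<le> N'"
  shows "\<exists>v. run A B 0 v N' = r"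
  using run_delay[OF lin, of "N' - N" u N] N by (metis le_add_diff_inverse2)

text \<open>The sets reachable from rest are subspaces and grow with time, so a time that serves a
  finite basis of \<open>R\<close> serves all of \<open>R\<close>.\<close>

lemma uniform_reach:
  assumes lin: "linear A" "linear B" and fin: "finite F" and F: "R \<subseteq> span F" and R: "subspace R"
    and reach: "\<And>r. r \<in> R \<Longrightarrow> \<exists>u N. run A B 0 u N = r"
  obtains N where "\<And>r. r \<in> R \<Longrightarrow> \<exists>u. run A B 0 u N = r"
proof -
  obtain Bs where Bs: "Bs \<subseteq> R" "independent Bs" "R \<subseteq> span Bs"
    using basis_exists by metis
  have finB: "finite Bs"
    using independent_span_bound[OF fin Bs(2)] Bs(1) F by blast
  obtain uu NN where uN: "\<And>b. b \<in> Bs \<Longrightarrow> run A B 0 (uu b) (NN b) = b"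
    using reach Bs(1) by (metis subsetD)
  define N where "N = Max (NN ` Bs)"
  have "subspace {r. \<exists>u. run A B 0 u N = r}"
    unfolding subspace_def
  proof (safe)
    show "\<exists>u. run A B 0 u N = 0"
      using run_zero[OF lin] by blast
  next
    fix u v
    show "\<exists>ua. run A B 0 ua N = run A B 0 u N + run A B 0 v N"
      using run_comb[OF lin, of 1 0 1 0 u v N] by (intro exI[of _ "\<lambda>s. 1 *\<^sub>R u s + 1 *\<^sub>R v s"]) simp
  next
    fix c u
    show "\<exists>ua. run A B 0 ua N = c *\<^sub>R run A B 0 u N"
      using run_comb[OF lin, of c 0 0 0 u u N] by (intro exI[of _ "\<lambda>s. c *\<^sub>R u s + 0 *\<^sub>R u s"]) simp
  qed
  moreover have "Bs \<subseteq> {r. \<exists>u. run A B 0 u N = r}"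
    using reach_mono[OF lin uN] finB by (auto simp: N_def)
  ultimately have "span Bs \<subseteq> {r. \<exists>u. run A B 0 u N = r}"
    by (rule span_minimal[rotated])
  with Bs(3) show ?thesis
    using that by blast
qed

text \<open>A cascade of first-order filters. Stage 0 is the scalar signal
  \<open>b1 x + b2 u\<close> along the motion from rest; stage k + 1 has pole \<open>\<mu> k\<close>
  and is driven by stage k with one step of delay.\<close>

primrec chain :: "('x::real_vector \<Rightarrow> 'x) \<Rightarrow> ('u \<Rightarrow> 'x) \<Rightarrow> ('x \<Rightarrow> real) \<Rightarrow> ('u \<Rightarrow> real) \<Rightarrow> (nat \<Rightarrow> real)
    \<Rightarrow> (nat \<Rightarrow> 'u) \<Rightarrow> nat \<Rightarrow> nat \<Rightarrow> real" where
  "chain A B b1 b2 \<mu> u 0 = (\<lambda>t. b1 (run A B 0 u t) + b2 (u t))"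
| "chain A B b1 b2 \<mu> u (Suc k) = run (\<lambda>z. \<mu> k * z) (\<lambda>z. z) 0 (chain A B b1 b2 \<mu> u k)"

lemma chain_cong:
  "(\<And>i. i < k \<Longrightarrow> \<mu> i = \<nu> i) \<Longrightarrow> chain A B b1 b2 \<mu> u k = chain A B b1 b2 \<nu> u k"
  by (induct k) auto

lemma chain_causal: "(\<And>s. s \<le> t \<Longrightarrow> u s = v s) \<Longrightarrow> chain A B b1 b2 \<mu> u k t = chain A B b1 b2 \<mu> v k t"
proof (induct k arbitrary: t)
  case 0
  then show ?case
    using run_causal[of t u v A B 0] by simp
next
  case (Suc k)
  show ?case
    unfolding chain.simps by (rule run_causal) (use Suc in auto)
qed

lemma linear_mult_left: "linear (\<lambda>z::real. c * z)"
  by (rule linearI) (simp_all add: algebra_simps)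

context
  fixes A :: "'x::real_vector \<Rightarrow> 'x" and B :: "'u::real_vector \<Rightarrow> 'x"
    and b1 :: "'x \<Rightarrow> real" and b2 :: "'u \<Rightarrow> real"
  assumes linA: "linear A" and linB: "linear B" and lin1: "linear b1" and lin2: "linear b2"
begin

lemma chain_comb:
  "chain A B b1 b2 \<mu> (\<lambda>s. a *\<^sub>R u s + b *\<^sub>R v s) k t = a * chain A B b1 b2 \<mu> u k t + b * chain A B b1 b2 \<mu> v k t"
proof (induct k arbitrary: t)
  case 0
  then show ?case
    using run_comb[OF linA linB, of a 0 b 0 u v t]
    by (simp add: linear_add[OF lin1] linear_add[OF lin2] linear_scale[OF lin1] linear_scale[OF lin2] algebra_simps)
next
  case (Suc k)
  have "chain A B b1 b2 \<mu> (\<lambda>s. a *\<^sub>R u s + b *\<^sub>R v s) k = (\<lambda>t. a *\<^sub>R chain A B b1 b2 \<mu> u k t + b *\<^sub>R chain A B b1 b2 \<mu> v k t)"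
    using Suc by (simp add: fun_eq_iff)
  then show ?case
    using run_comb[OF linear_mult_left[of "\<mu> k"] linear_ident, of a 0 b 0] by simp
qed

lemma chain_zero: "chain A B b1 b2 \<mu> (\<lambda>s. 0) k t = 0"
  using chain_comb[of \<mu> 0 "\<lambda>s. 0" 0 "\<lambda>s. 0" k t] by simp

lemma chain_delay_before: "t < d \<Longrightarrow> chain A B b1 b2 \<mu> (delay d u) k t = 0"
  using chain_causal[of t "delay d u" "\<lambda>s. 0" A B b1 b2 \<mu> k] chain_zero[of \<mu> k t] by (simp add: delay_def)

lemma chain_delay: "chain A B b1 b2 \<mu> (delay d u) k (d + t) = chain A B b1 b2 \<mu> u k t"
proof (induct k arbitrary: t)
  case 0
  then show ?case
    using run_delay[OF linA linB, of d u t] by (simp add: delay_def[of d u "d + t"])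
next
  case (Suc k)
  have "chain A B b1 b2 \<mu> (delay d u) k = delay d (chain A B b1 b2 \<mu> u k)"
  proof
    fix s
    show "chain A B b1 b2 \<mu> (delay d u) k s = delay d (chain A B b1 b2 \<mu> u k) s"
      using chain_delay_before[of s d] Suc[of "s - d"] by (cases "s < d") (simp_all add: delay_def[of d _ s])
  qed
  then show ?case
    using run_delay[OF linear_mult_left[of "\<mu> k"] linear_ident] by simp
qed

text \<open>The coefficient of \<open>\<mu> ^ (N - 1 - t)\<close> in the response is the sample
  \<open>f t\<close>, so distinct samples before N cannot cancel as polynomials in the pole.\<close>

lemma filter_poly:
  obtains P :: "real poly" where "\<And>\<mu>. run (\<lambda>z. \<mu> * z) (\<lambda>z. z) 0 f N = poly P \<mu>"
    and "(\<exists>t<N. f t \<noteq> 0) \<Longrightarrow> P \<noteq> 0"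
proof -
  define P where "P = (\<Sum>t<N. monom (f t) (N - 1 - t))"
  have ev: "run (\<lambda>z. \<mu> * z) (\<lambda>z. z) 0 f N = (\<Sum>t<N. f t * \<mu> ^ (N - 1 - t))" for \<mu>
  proof (induct N)
    case (Suc N)
    have "(\<Sum>t<N. f t * \<mu> ^ (N - t)) = (\<Sum>t<N. \<mu> * (f t * \<mu> ^ (N - 1 - t)))"
    proof (rule sum.cong[OF refl])
      fix t assume "t \<in> {..<N}"
      then have "N - t = Suc (N - 1 - t)" by auto
      then show "f t * \<mu> ^ (N - t) = \<mu> * (f t * \<mu> ^ (N - 1 - t))" by simp
    qed
    with Suc show ?case by (simp add: sum_distrib_left)
  qed simp
  have "P \<noteq> 0" if "t < N" "f t \<noteq> 0" for t
  proof -
    have "coeff P (N - 1 - t) = (\<Sum>s<N. if s = t then f s else 0)"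
      unfolding P_def coeff_sum by (rule sum.cong) (use that in \<open>auto\<close>)
    also have "\<dots> = f t" using that by simp
    finally show ?thesis using that by auto
  qed
  then show ?thesis
    using that[of P] ev by (auto simp: P_def poly_sum poly_monom)
qed

text \<open>The pole of each added filter only has to avoid the finitely many zeros of a polynomial: the
  response of the previous stage to an input that steers all previous stages back to rest.\<close>

lemma chain_reach:
  assumes R: "subspace R" "A ` R \<subseteq> R" "range B \<subseteq> R"
    and reach: "\<And>r. r \<in> R \<Longrightarrow> \<exists>u. run A B 0 u N0 = r"
    and nz: "r0 \<in> R" "b1 r0 + b2 u0 \<noteq> 0"
  shows "\<exists>\<mu> N. \<forall>r\<in>R. \<forall>e. \<exists>u. run A B 0 u N = r \<and> (\<forall>k<c. chain A B b1 b2 \<mu> u (Suc k) N = e k)"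
proof (induct c)
  case 0
  then show ?case using reach by auto
next
  case (Suc c)
  let ?ch = "chain A B b1 b2"
  obtain \<mu> N where N: "\<And>r e. r \<in> R \<Longrightarrow> \<exists>u. run A B 0 u N = r \<and> (\<forall>k<c. ?ch \<mu> u (Suc k) N = e k)"
    using Suc by blast
  have inR: "run A B 0 u t \<in> R" for u t
    using run_invariant[OF R(1,2)] R(1,3) subspace_0 by blast
  \<comment> \<open>A nonzero sample of the last stage built so far: for c = 0 it is the signal at
    \<open>r0\<close> and \<open>u0\<close>, otherwise the induction hypothesis steers stage c to
    1.\<close>
  obtain u1 t1 where u1: "?ch \<mu> u1 c t1 \<noteq> 0"
  proof (cases c)
    case 0
    obtain u where u: "run A B 0 u N0 = r0" using reach nz(1) by blast
    have "run A B 0 (u(N0 := u0)) N0 = r0"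
      using run_causal[of N0 "u(N0 := u0)" u A B 0] u by simp
    then have "?ch \<mu> (u(N0 := u0)) c N0 \<noteq> 0"
      using nz(2) 0 by simp
    then show ?thesis using that by blast
  next
    case (Suc c')
    obtain u where "\<forall>k<c. ?ch \<mu> u (Suc k) N = 1"
      using N[of 0 "\<lambda>_. 1"] subspace_0[OF R(1)] by auto
    then have "?ch \<mu> u c N \<noteq> 0" using Suc by simp
    then show ?thesis using that by blast
  qed
  \<comment> \<open>\<open>u2\<close> excites stage c at \<open>t1\<close> and then stops.
    \<open>u3\<close> reaches from rest, in N steps, the same state and the same stages 1 to c that
    \<open>u2\<close> has at time M. Started right after \<open>t1\<close> and subtracted, it
    cancels them at M but leaves the sample at \<open>t1\<close> untouched.\<close>
  define u2 where "u2 = (\<lambda>s. if s \<le> t1 then u1 s else 0)"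
  define M where "M = Suc t1 + N"
  obtain u3 where u3: "run A B 0 u3 N = run A B 0 u2 M" "\<forall>k<c. ?ch \<mu> u3 (Suc k) N = ?ch \<mu> u2 (Suc k) M"
    using N[OF inR, of u2 M "\<lambda>k. ?ch \<mu> u2 (Suc k) M"] by auto
  define u4 where "u4 = (\<lambda>s. 1 *\<^sub>R u2 s + (-1) *\<^sub>R delay (Suc t1) u3 s)"
  have run4: "run A B 0 u4 M = 0"
    using run_comb[OF linA linB, of 1 0 "-1" 0 u2 "delay (Suc t1) u3" M] run_delay[OF linA linB, of "Suc t1" u3 N] u3(1)
    unfolding u4_def M_def[symmetric] by simp
  have ch4: "?ch \<mu> u4 k t = ?ch \<mu> u2 k t - ?ch \<mu> (delay (Suc t1) u3) k t" for k t
    unfolding u4_def chain_comb by simp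
  have z4: "?ch \<mu> u4 (Suc k) M = 0" if "k < c" for k
    using ch4[of "Suc k" M] u3(2) that chain_delay[of \<mu> "Suc t1" u3 "Suc k" N] by (simp add: M_def)
  have "?ch \<mu> u4 c t1 = ?ch \<mu> u1 c t1"
    using ch4[of c t1] chain_delay_before[of t1 "Suc t1" \<mu> u3 c] chain_causal[of t1 u2 u1 A B b1 b2 \<mu> c]
    by (simp add: u2_def)
  then have n4: "\<exists>t<M. ?ch \<mu> u4 c t \<noteq> 0"
    using u1 by (intro exI[of _ t1]) (simp add: M_def)
  \<comment> \<open>Under \<open>u4\<close> the state and all earlier filters are back at 0 at time
    M, so the new filter alone is excited, provided that its pole avoids the roots of
    \<open>P\<close>.\<close>
  obtain P :: "real poly" where P: "\<And>x. run (\<lambda>z. x * z) (\<lambda>z. z) 0 (?ch \<mu> u4 c) M = poly P x" "P \<noteq> 0"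
    using filter_poly[where f = "?ch \<mu> u4 c" and N = M] n4 by metis
  obtain x where x: "poly P x \<noteq> 0"
    using poly_roots_finite[OF P(2)] infinite_UNIV_char_0 by (metis (mono_tags, lifting) ex_new_if_finite mem_Collect_eq)
  define \<nu> where "\<nu> = \<mu>(c := x)"
  have eq: "?ch \<nu> u k = ?ch \<mu> u k" if "k \<le> c" for u k
    by (rule chain_cong) (use that in \<open>simp add: \<nu>_def\<close>)
  have g4: "?ch \<nu> u4 (Suc c) M \<noteq> 0"
    using P(1)[of x] x eq[of c u4] by (simp add: \<nu>_def)
  define K where "K = N + M"
  have "\<exists>u. run A B 0 u K = r \<and> (\<forall>k<Suc c. ?ch \<nu> u (Suc k) K = e k)" if r: "r \<in> R" for r e
  proof -
    obtain u5 where u5: "run A B 0 u5 N = r" "\<And>k. k < c \<Longrightarrow> ?ch \<mu> u5 (Suc k) N = e k"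
      using N[OF r, of e] by blast
    \<comment> \<open>Both inputs are delayed so that they end at the common time K. There
      \<open>u7\<close> affects only stage c + 1 and can correct the value left by
      \<open>u6\<close>.\<close>
    define u6 where "u6 = delay M u5"
    define u7 where "u7 = delay N u4"
    have a6: "run A B 0 u6 K = r" "run A B 0 u7 K = 0"
      using run_delay[OF linA linB, of M u5 N] run_delay[OF linA linB, of N u4 M] u5 run4
      by (simp_all add: u6_def u7_def K_def add.commute)
    have b6: "?ch \<nu> u6 (Suc k) K = e k" "?ch \<nu> u7 (Suc k) K = 0" if "k < c" for k
      using chain_delay[of \<nu> M u5 "Suc k" N] chain_delay[of \<nu> N u4 "Suc k" M] u5(2)[OF that] z4[OF that]
        eq[of "Suc k"] that
      by (simp_all add: u6_def u7_def K_def add.commute del: chain.simps)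
    have c7: "?ch \<nu> u7 (Suc c) K \<noteq> 0"
      using chain_delay[of \<nu> N u4 "Suc c" M] g4 by (simp add: u7_def K_def del: chain.simps)
    define q where "q = (e c - ?ch \<nu> u6 (Suc c) K) / ?ch \<nu> u7 (Suc c) K"
    define u where "u = (\<lambda>s. 1 *\<^sub>R u6 s + q *\<^sub>R u7 s)"
    have "run A B 0 u K = r"
      using run_comb[OF linA linB, of 1 0 q 0 u6 u7 K] a6 by (simp add: u_def)
    moreover have "?ch \<nu> u k K = ?ch \<nu> u6 k K + q * ?ch \<nu> u7 k K" for k
      unfolding u_def chain_comb by simp
    then have "?ch \<nu> u (Suc k) K = e k" if "k < Suc c" for k
      using b6[of k] c7 that by (cases "k = c") (auto simp: q_def simp del: chain.simps)
    ultimately show ?thesis by blast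
  qed
  then show ?case by blast
qed

end

lemma run_sum:
  assumes "linear A" "linear B"
  shows "run A B 0 (\<lambda>s. \<Sum>i\<in>I. c i *\<^sub>R u i s) t = (\<Sum>i\<in>I. c i *\<^sub>R run A B 0 (u i) t)"
  by (induct t)
    (simp_all add: linear_sum[OF assms(1)] linear_sum[OF assms(2)] linear_scale[OF assms(1)]
      linear_scale[OF assms(2)] scaleR_add_right sum.distrib)

lemma solve_nonsingular:
  fixes M :: "real mat"
  assumes M: "M \<in> carrier_mat n n" "det M \<noteq> 0"
  obtains \<kappa> where "\<And>j. j < n \<Longrightarrow> (\<Sum>i<n. M $$ (j, i) * \<kappa> i) = b j"
proof -
  obtain N where N: "N \<in> carrier_mat n n" "M * N = 1\<^sub>m n"
    using det_non_zero_imp_unit[OF M(1,2), of undefined] by (auto simp: Units_def ring_mat_def)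
  define v where "v = N *\<^sub>v vec n b"
  have "M *\<^sub>v v = vec n b"
    using assoc_mult_mat_vec[OF M(1) N(1), of "vec n b"] N(2) by (simp add: v_def)
  then have "(M *\<^sub>v v) $ j = vec n b $ j" for j by simp
  moreover have "dim_vec v = n" using N(1) by (simp add: v_def)
  moreover have "(M *\<^sub>v v) $ j = (\<Sum>i<n. M $$ (j, i) * v $ i)" if "j < n" "dim_vec v = n" for j
    using that M(1) by (simp add: scalar_prod_def lessThan_atLeast0)
  ultimately have "(\<Sum>i<n. M $$ (j, i) * v $ i) = b j" if "j < n" for j
    using that by (metis index_vec)
  then show ?thesis using that by blast
qed

text \<open>As \<theta> tends to 0 the component of the state outside R, divided by \<theta>, tends to the response of
  a chain of first-order filters fed by b1 x + b2 u; lemma chain_reach makes that limit reachable,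
  and reachability can then fail only at roots of a determinant that is 1 at \<theta> = 0.\<close>

lemma generic_feedback:
  fixes A :: "'x::real_vector \<Rightarrow> 'x" and B :: "'u::real_vector \<Rightarrow> 'x"
  assumes linA: "linear A" and linB: "linear B" and lin1: "linear b1" and lin2: "linear b2"
    and R: "subspace R" "A ` R \<subseteq> R" "range B \<subseteq> R"
    and S: "S = span (R \<union> range (\<lambda>j. (A ^^ j) g))" "finite F" "S \<subseteq> span F"
    and reach: "\<And>r. r \<in> R \<Longrightarrow> \<exists>u N. run A B 0 u N = r"
    and nz: "r0 \<in> R" "b1 r0 + b2 u0 \<noteq> 0"
  obtains \<phi> where "linear \<phi>" "\<And>r. r \<in> R \<Longrightarrow> \<phi> r = 0"
    "finite {\<theta>. \<not> (\<exists>N. \<forall>s\<in>S. \<exists>u. run (\<lambda>x. A x + (\<phi> x + \<theta> * b1 x) *\<^sub>R g) (\<lambda>v. B v + (\<theta> * b2 v) *\<^sub>R g) 0 u N = s)}"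
proof -
  define G where "G j = (A ^^ j) g" for j
  \<comment> \<open>The Krylov filtration from \<open>R\<close> in the direction \<open>g\<close>.
    Its length c, found below, is the codimension of \<open>R\<close> in \<open>S\<close> and hence
    the number of filters.\<close>
  define V where "V c = span (R \<union> G ` {..<c})" for c
  have V_mono: "V i \<subseteq> V j" if "i \<le> j" for i j
    unfolding V_def by (rule span_mono) (use that in auto)
  have V_S: "V i \<subseteq> S" for i
    unfolding V_def S(1) by (rule span_mono) (auto simp: G_def)
  have R_S: "R \<subseteq> S" unfolding S(1) by (auto intro: span_base)
  have V0: "V 0 = R" using R(1) by (simp add: V_def span_eq_iff)
  have "\<exists>c. G c \<in> V c"
  proof (rule ccontr)
    assume no: "\<not> (\<exists>c. G c \<in> V c)"
    have "card {..<Suc (card F)} \<le> card F"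
    proof (rule family_card_le[where x = G])
      show "G ` {..<Suc (card F)} \<subseteq> span F"
        using S(3) unfolding S(1) G_def by (auto intro: span_base)
      fix a assume sum0: "(\<Sum>i\<in>{..<Suc (card F)}. a i *\<^sub>R G i) = 0"
      have "a i = 0" if "i < n" "n \<le> Suc (card F)" "(\<Sum>i<n. a i *\<^sub>R G i) = 0" for i n
        using that
      proof (induct n)
        case (Suc n)
        have "a n = 0"
        proof (rule ccontr)
          assume an: "a n \<noteq> 0"
          have "G n = (1 / a n) *\<^sub>R (a n *\<^sub>R G n)" using an by simp
          also have "a n *\<^sub>R G n = - (\<Sum>i<n. a i *\<^sub>R G i)"
            using Suc.prems(3) by (simp add: add_eq_0_iff)
          also have "(1 / a n) *\<^sub>R \<dots> \<in> V n"
            unfolding V_def by (intro span_scale span_neg span_sum) (auto intro: span_base)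
          finally show False using no by blast
        qed
        with Suc show ?case by (cases "i = n") auto
      qed simp
      then show "\<forall>i\<in>{..<Suc (card F)}. a i = 0" using sum0 by blast
    qed (use S(2) in auto)
    then show False by simp
  qed
  define c where "c = (LEAST c. G c \<in> V c)"
  have c: "G c \<in> V c" unfolding c_def by (rule LeastI_ex) fact
  have c_min: "G j \<notin> V j" if "j < c" for j
    using not_less_Least[of j "\<lambda>c. G c \<in> V c"] that by (auto simp: c_def)
  have A_V: "A x \<in> V c" if "x \<in> V c" for x
  proof -
    have "V c \<subseteq> {x. A x \<in> V c}"
      unfolding V_def
    proof (rule span_minimal)
      show "R \<union> G ` {..<c} \<subseteq> {x. A x \<in> span (R \<union> G ` {..<c})}"
      proof safe
        fix x assume "x \<in> R" then show "A x \<in> span (R \<union> G ` {..<c})"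
          using R(2) by (auto intro: span_base)
      next
        fix j assume j: "j < c"
        have "A (G j) = G (Suc j)" by (simp add: G_def)
        then show "A (G j) \<in> span (R \<union> G ` {..<c})"
          using c j by (cases "Suc j = c") (auto simp: V_def intro: span_base)
      qed
      show "subspace {x. A x \<in> span (R \<union> G ` {..<c})}"
        by (auto simp: subspace_def linear_0[OF linA] linear_add[OF linA] linear_scale[OF linA]
            span_add span_scale span_zero)
    qed
    then show ?thesis using that by blast
  qed
  have "G j \<in> V c" for j
  proof (induct j)
    case 0
    show ?case using c by (cases c) (auto simp: V_def intro: span_base)
  next
    case (Suc j)
    then show ?case using A_V by (simp add: G_def)
  qed
  then have "R \<union> range G \<subseteq> V c"
    using V_mono[of 0 c] V0 by auto
  then have "span (R \<union> range G) \<subseteq> V c"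
    unfolding V_def by (rule span_minimal) (rule subspace_span)
  then have S_V: "S = V c"
    using V_S[of c] by (simp add: S(1) G_def[abs_def])
  \<comment> \<open>\<open>\<zeta>\<close> reads off the last Krylov direction modulo the earlier
    ones. For c = 0 there is no such direction and the zero functional is taken.\<close>
  obtain \<zeta> :: "'x \<Rightarrow> real" where \<zeta>: "linear \<zeta>" "\<And>x. x \<in> V (c - 1) \<Longrightarrow> \<zeta> x = 0" "c > 0 \<Longrightarrow> \<zeta> (G (c - 1)) = 1"
  proof (cases "c > 0")
    case True
    then have "G (c - 1) \<notin> V (c - 1)" using c_min[of "c - 1"] by simp
    then show ?thesis
      using separating_functional[of "V (c - 1)" "G (c - 1)"] that by (metis V_def subspace_span)
  next
    case False
    then show ?thesis using that[of "\<lambda>_. 0"] linear_zero by auto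
  qed
  obtain N0 where N0: "\<And>r. r \<in> R \<Longrightarrow> \<exists>u. run A B 0 u N0 = r"
    using uniform_reach[OF linA linB S(2) _ R(1) reach] R_S S(3) by blast
  let ?ch = "chain A B b1 b2"
  obtain \<mu> N where N: "\<And>r e. r \<in> R \<Longrightarrow> \<exists>u. run A B 0 u N = r \<and> (\<forall>k<c. ?ch \<mu> u (Suc k) N = e k)"
    using chain_reach[OF linA linB lin1 lin2 R N0 nz, of c] by metis
  \<comment> \<open>\<open>\<psi> k\<close> is \<open>\<zeta>\<close> composed with the first k of
    the factors \<open>A - \<mu> (c - 1)\<close>, \<open>A - \<mu> (c - 2)\<close> and so on. For k
    < c these are coordinates of \<open>S\<close> modulo \<open>R\<close> in which the closed loop
    becomes a cascade; the feedback \<open>- \<psi> c\<close> is Ackermann's formula for the poles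
    \<open>\<mu>\<close>.\<close>
  define \<psi> where "\<psi> k = rec_nat \<zeta> (\<lambda>k f x. f (A x) - \<mu> (c - 1 - k) * f x) k" for k
  have \<psi>0: "\<psi> 0 = \<zeta>" and \<psi>S: "\<psi> (Suc k) = (\<lambda>x. \<psi> k (A x) - \<mu> (c - 1 - k) * \<psi> k x)" for k
    by (simp_all add: \<psi>_def)
  have lin\<psi>: "linear (\<psi> k)" for k
  proof (induct k)
    case (Suc k)
    show ?case unfolding \<psi>S
      by (rule linearI) (simp_all add: linear_add[OF Suc] linear_add[OF linA] linear_scale[OF Suc]
        linear_scale[OF linA] algebra_simps)
  qed (simp add: \<psi>0 \<zeta>)
  have \<psi>R: "\<psi> k r = 0" if "r \<in> R" for k r
    using that
  proof (induct k arbitrary: r)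
    case 0
    then show ?case using \<zeta>(2) V_mono[of 0 "c - 1"] V0 by (auto simp: \<psi>0)
  next
    case (Suc k)
    then show ?case using R(2) by (auto simp: \<psi>S)
  qed
  have \<psi>G: "\<psi> k (G j) = (if j + k + 1 = c then 1 else 0)" if "j + k + 1 \<le> c" for k j
    using that
  proof (induct k arbitrary: j)
    case 0
    have "G j \<in> V (c - 1)" if "j + 1 < c"
      unfolding V_def by (rule span_base) (use that in auto)
    then show ?case using \<zeta>(3) \<zeta>(2)[of "G j"] 0 by (auto simp: \<psi>0)
  next
    case (Suc k)
    have "A (G j) = G (Suc j)" by (simp add: G_def)
    then show ?case using Suc(1)[of "Suc j"] Suc(1)[of j] Suc(2) by (simp add: \<psi>S)
  qed
  \<comment> \<open>By \<open>\<psi>G\<close> the table of values \<open>\<psi> k (G j)\<close> is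
    antitriangular with 1 on the antidiagonal, so the \<open>\<psi> k\<close> detect the Krylov
    directions one after the other, starting from the last.\<close>
  have \<psi>inj: "s \<in> R" if "s \<in> V n" "n \<le> c" "\<And>k. k < c \<Longrightarrow> \<psi> k s = 0" for s n
    using that
  proof (induct n arbitrary: s)
    case 0
    then show ?case using V0 by simp
  next
    case (Suc n)
    have "V (Suc n) = span (insert (G n) (R \<union> G ` {..<n}))"
      by (simp add: V_def lessThan_Suc)
    then obtain a where a: "s - a *\<^sub>R G n \<in> V n"
      using Suc.prems(1) span_breakdown_eq[of s "G n" "R \<union> G ` {..<n}"] by (auto simp: V_def)
    have "V n \<subseteq> {x. \<psi> (c - 1 - n) x = 0}"
      unfolding V_def
    proof (rule span_minimal)
      show "R \<union> G ` {..<n} \<subseteq> {x. \<psi> (c - 1 - n) x = 0}"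
        using \<psi>R \<psi>G Suc.prems(2) by auto
    qed (rule linear_subspace_kernel[OF lin\<psi>])
    then have "\<psi> (c - 1 - n) (s - a *\<^sub>R G n) = 0" using a by blast
    then have "a = 0"
      using Suc.prems(2,3) \<psi>G[of n "c - 1 - n"] by (simp add: linear_diff[OF lin\<psi>] linear_scale[OF lin\<psi>])
    then show ?case using Suc a by simp
  qed
  define \<phi> where "\<phi> x = - \<psi> c x" for x
  have lin\<phi>: "linear \<phi>"
    unfolding \<phi>_def[abs_def] by (rule linear_compose_neg[OF lin\<psi>])
  have \<phi>R: "\<phi> r = 0" if "r \<in> R" for r
    using \<psi>R[OF that] by (simp add: \<phi>_def)
  define A' where "A' \<theta> x = A x + (\<phi> x + \<theta> * b1 x) *\<^sub>R g" for \<theta> x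
  define B' where "B' \<theta> v = B v + (\<theta> * b2 v) *\<^sub>R g" for \<theta> v
  \<comment> \<open>\<open>y\<close> is the deviation from the unperturbed motion divided by
    \<theta>. As the feedback is silent on \<open>R\<close>, the only source of the deviation is
    stage 0 of the cascade, entering along \<open>g\<close>.\<close>
  define y where "y \<theta> u = run (A' \<theta>) (\<lambda>\<beta>. \<beta> *\<^sub>R g) 0 (?ch \<mu> u 0)" for \<theta> u
  have linA': "linear (A' \<theta>)" for \<theta>
    unfolding A'_def[abs_def]
    by (rule linearI) (simp_all add: linear_add[OF linA] linear_add[OF lin1] linear_add[OF lin\<phi>]
        linear_scale[OF linA] linear_scale[OF lin1] linear_scale[OF lin\<phi>] algebra_simps)
  have linB': "linear (B' \<theta>)" for \<theta>
    unfolding B'_def[abs_def]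
    by (rule linearI) (simp_all add: linear_add[OF linB] linear_add[OF lin2]
        linear_scale[OF linB] linear_scale[OF lin2] algebra_simps)
  have inR: "run A B 0 u t \<in> R" for u t
    using run_invariant[OF R(1,2)] R(1,3) subspace_0 by blast
  have run': "run (A' \<theta>) (B' \<theta>) 0 u t = run A B 0 u t + \<theta> *\<^sub>R y \<theta> u t" for \<theta> u t
  proof (induct t)
    case (Suc t)
    have "run (A' \<theta>) (B' \<theta>) 0 u (Suc t) = A' \<theta> (run A B 0 u t) + \<theta> *\<^sub>R A' \<theta> (y \<theta> u t) + B' \<theta> (u t)"
      using Suc by (simp add: linear_add[OF linA'] linear_scale[OF linA'])
    also have "A' \<theta> (run A B 0 u t) = A (run A B 0 u t) + (\<theta> * b1 (run A B 0 u t)) *\<^sub>R g"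
      using \<phi>R[OF inR] by (simp add: A'_def)
    finally show ?case
      by (simp add: B'_def y_def algebra_simps)
  qed (simp add: y_def)
  have y_poly: "\<exists>P. \<forall>\<theta>. f (y \<theta> u t) = poly P \<theta>" if "linear f" for f :: "'x \<Rightarrow> real" and u t
    using that
  proof (induct t arbitrary: f)
    case 0
    then show ?case by (intro exI[of _ 0]) (simp add: y_def linear_0)
  next
    case (Suc t)
    obtain P1 where P1: "\<forall>\<theta>. f (A (y \<theta> u t)) = poly P1 \<theta>"
      using Suc(1)[OF linear_compose[OF linA Suc(2)]] by (auto simp: o_def)
    obtain P2 where P2: "\<forall>\<theta>. \<phi> (y \<theta> u t) = poly P2 \<theta>" using Suc(1)[OF lin\<phi>] by blast
    obtain P3 where P3: "\<forall>\<theta>. b1 (y \<theta> u t) = poly P3 \<theta>" using Suc(1)[OF lin1] by blast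
    have "f (y \<theta> u (Suc t)) = poly (P1 + smult (f g) (P2 + [:0, 1:] * P3) + [:?ch \<mu> u 0 t * f g:]) \<theta>" for \<theta>
    proof -
      have "y \<theta> u (Suc t) = A' \<theta> (y \<theta> u t) + ?ch \<mu> u 0 t *\<^sub>R g" by (simp add: y_def)
      then show ?thesis
        using P1 P2 P3 by (simp add: A'_def linear_add[OF Suc(2)] linear_scale[OF Suc(2)] algebra_simps)
    qed
    then show ?case by blast
  qed
  \<comment> \<open>At zero gain the deviation does not influence its own drive, and
    \<open>\<phi>\<close> cancels the term \<open>\<psi> c\<close>. What remains of the recursion
    for the \<open>\<psi> k\<close> is the filter cascade in reverse order.\<close>
  have y0: "\<psi> k (y 0 u t) = ?ch \<mu> u (c - k) t" if "k < c" for k u t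
    using that
  proof (induct t arbitrary: k)
    case 0
    then obtain k' where "c - k = Suc k'" by (metis Suc_diff_Suc)
    then show ?case by (simp add: y_def linear_0[OF lin\<psi>])
  next
    case (Suc t)
    have ck: "c - k = Suc (c - 1 - k)" using Suc.prems by simp
    have ys: "y 0 u (Suc t) = A (y 0 u t) + (\<phi> (y 0 u t) + ?ch \<mu> u 0 t) *\<^sub>R g"
      by (simp add: y_def A'_def algebra_simps)
    have "\<psi> k (A (y 0 u t)) = \<psi> (Suc k) (y 0 u t) + \<mu> (c - 1 - k) * \<psi> k (y 0 u t)"
      by (simp add: \<psi>S)
    moreover have "\<psi> k g = (if Suc k = c then 1 else 0)"
      using \<psi>G[of 0 k] Suc.prems by (simp add: G_def)
    ultimately have "\<psi> k (y 0 u (Suc t)) = \<mu> (c - 1 - k) * \<psi> k (y 0 u t) +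
        (if Suc k = c then ?ch \<mu> u 0 t else \<psi> (Suc k) (y 0 u t))"
      by (simp add: ys linear_add[OF lin\<psi>] linear_scale[OF lin\<psi>] \<phi>_def)
    also have "\<dots> = \<mu> (c - 1 - k) * ?ch \<mu> u (c - k) t + ?ch \<mu> u (c - 1 - k) t"
      using Suc(1)[of k] Suc(1)[of "Suc k"] Suc.prems by (auto simp del: chain.simps)
    also have "\<dots> = ?ch \<mu> u (c - k) (Suc t)" unfolding ck by simp
    finally show ?case .
  qed
  obtain Bs where Bs: "Bs \<subseteq> R" "independent Bs" "R \<subseteq> span Bs"
    using basis_exists by metis
  have "finite Bs"
    using independent_span_bound[OF S(2) Bs(2)] Bs(1) R_S S(3) by blast
  then obtain bs where bs: "set bs = Bs" "distinct bs"
    using finite_distinct_list by blast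
  define n where "n = length bs"
  have "\<exists>f::'x \<Rightarrow> real. linear f \<and> (\<forall>b\<in>Bs. f b = (if b = bs ! i then 1 else 0))" for i
    using linear_independent_extend[OF Bs(2), of "\<lambda>b. if b = bs ! i then 1 else 0"] .
  then obtain f :: "nat \<Rightarrow> 'x \<Rightarrow> real" where f: "\<And>i. linear (f i)" "\<And>i b. b \<in> Bs \<Longrightarrow> f i b = (if b = bs ! i then 1 else 0)"
    by metis
  have f_inj: "r = 0" if "r \<in> R" and fr: "\<And>i. i < n \<Longrightarrow> f i r = 0" for r
  proof -
    obtain a where a: "r = (\<Sum>b\<in>Bs. a b *\<^sub>R b)"
      using \<open>r \<in> R\<close> Bs(3) span_finite[OF \<open>finite Bs\<close>] by auto
    have "a (bs ! i) = 0" if i: "i < n" for i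
    proof -
      have m: "bs ! i \<in> Bs" using i bs(1) by (auto simp: n_def)
      have "f i r = (\<Sum>b\<in>Bs. a b * f i b)"
        by (simp add: a linear_sum[OF f(1)] linear_scale[OF f(1)])
      also have "\<dots> = (\<Sum>b\<in>Bs. if b = bs ! i then a b else 0)"
        by (rule sum.cong) (auto simp: f(2))
      also have "\<dots> = a (bs ! i)" using m \<open>finite Bs\<close> by simp
      finally show ?thesis using fr[OF i] by simp
    qed
    then have "a b = 0" if "b \<in> Bs" for b
      using that bs(1) by (metis in_set_conv_nth n_def)
    then show ?thesis by (simp add: a)
  qed
  \<comment> \<open>Test inputs, one for each of the n + c dimensions of \<open>S\<close>: those
    with index below n end at the basis vectors of \<open>R\<close> with all filters at 0, the
    others end at state 0 with exactly one filter at 1.\<close>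
  define r where "r i = (if i < n then bs ! i else 0)" for i
  have rR: "r i \<in> R" for i
    using Bs(1) bs(1) subspace_0[OF R(1)] by (auto simp: r_def n_def)
  have "\<exists>u. run A B 0 u N = r i \<and> (\<forall>k<c. ?ch \<mu> u (Suc k) N = (if i = n + (c - 1 - k) then 1 else 0))" for i
    using N[OF rR, of i "\<lambda>k. if i = n + (c - 1 - k) then 1 else 0"] by blast
  then obtain uu where uu: "\<And>i. run A B 0 (uu i) N = r i"
    "\<And>i k. k < c \<Longrightarrow> ?ch \<mu> (uu i) (Suc k) N = (if i = n + (c - 1 - k) then 1 else 0)"
    by metis
  have "\<exists>P. \<forall>\<theta>. poly P \<theta> = (if j < n then f j (r i + \<theta> *\<^sub>R y \<theta> (uu i) N) else \<psi> (j - n) (y \<theta> (uu i) N))" for j i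
  proof (cases "j < n")
    case True
    obtain P where P: "\<forall>\<theta>. f j (y \<theta> (uu i) N) = poly P \<theta>" using y_poly[OF f(1)] by blast
    show ?thesis
      by (rule exI[of _ "[:f j (r i):] + [:0, 1:] * P"])
        (use P True in \<open>simp add: linear_add[OF f(1)] linear_scale[OF f(1)]\<close>)
  next
    case False
    then show ?thesis using y_poly[OF lin\<psi>, of "j - n" "uu i" N] by auto
  qed
  then obtain P where P: "\<And>j i \<theta>. poly (P j i) \<theta> = (if j < n then f j (r i + \<theta> *\<^sub>R y \<theta> (uu i) N) else \<psi> (j - n) (y \<theta> (uu i) N))"
    by metis
  \<comment> \<open>Coordinates of the final states, polynomial in \<theta>. The rows of the
    \<open>\<psi> k\<close> refer to \<open>y\<close>, that is, they are divided by \<theta>; this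
    keeps the matrix from degenerating at \<theta> = 0, where it is the identity.\<close>
  define PM where "PM = mat (n + c) (n + c) (\<lambda>(j, i). P j i)"
  have PM: "PM \<in> carrier_mat (n + c) (n + c)" by (simp add: PM_def)
  define M where "M \<theta> = map_mat (\<lambda>p. poly p \<theta>) PM" for \<theta>
  have M: "M \<theta> \<in> carrier_mat (n + c) (n + c)" for \<theta> by (simp add: M_def PM_def)
  have detM: "det (M \<theta>) = poly (det PM) \<theta>" for \<theta>
  proof -
    have "comm_ring_hom (\<lambda>p. poly p \<theta>)" by standard auto
    then show ?thesis unfolding M_def by (rule comm_ring_hom.hom_det)
  qed
  have M0: "M 0 = 1\<^sub>m (n + c)"
  proof (rule eq_matI)
    fix j i assume ji: "j < dim_row (1\<^sub>m (n + c))" "i < dim_col (1\<^sub>m (n + c))"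
    show "M 0 $$ (j, i) = 1\<^sub>m (n + c) $$ (j, i)"
    proof (cases "j < n")
      case True
      have "f j (r i) = (if i = j then 1 else 0)"
        using True bs nth_eq_iff_index_eq[OF bs(2), of i j] f(2)[of "bs ! i" j] linear_0[OF f(1)]
        by (auto simp: r_def n_def)
      with True ji show ?thesis by (simp add: M_def PM_def P)
    next
      case False
      then have k: "j - n < c" using ji by simp
      have e: "c - (j - n) = Suc (c - 1 - (j - n))" and lt: "c - 1 - (j - n) < c" using k by auto
      have "\<psi> (j - n) (y 0 (uu i) N) = (if i = n + (c - 1 - (c - 1 - (j - n))) then 1 else 0)"
        using y0[OF k, of "uu i" N, unfolded e] uu(2)[OF lt, of i] by (rule trans)
      also have "n + (c - 1 - (c - 1 - (j - n))) = j" using k False by simp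
      finally show ?thesis using False ji by (simp add: M_def PM_def P)
    qed
  qed (use M in \<open>auto simp: M_def PM_def\<close>)
  have "poly (det PM) 0 = 1" by (simp only: detM[symmetric] M0 det_one)
  then have "det PM \<noteq> 0" by auto
  then have fin: "finite {\<theta>. poly (det PM) \<theta> = 0}"
    by (rule poly_roots_finite)
  have "\<exists>u. run (A' \<theta>) (B' \<theta>) 0 u N = s" if \<theta>: "\<theta> \<noteq> 0" "poly (det PM) \<theta> \<noteq> 0" and s: "s \<in> S" for \<theta> s
  proof -
    obtain \<kappa> where \<kappa>: "\<And>j. j < n + c \<Longrightarrow>
        (\<Sum>i<n + c. M \<theta> $$ (j, i) * \<kappa> i) = (if j < n then f j s else \<psi> (j - n) s / \<theta>)"
      using solve_nonsingular[OF M[of \<theta>], of "\<lambda>j. if j < n then f j s else \<psi> (j - n) s / \<theta>"] \<theta>(2) detM[of \<theta>]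
      by metis
    define u where "u = (\<lambda>t. \<Sum>i<n + c. \<kappa> i *\<^sub>R uu i t)"
    have ru: "run (A' \<theta>) (B' \<theta>) 0 u N = (\<Sum>i<n + c. \<kappa> i *\<^sub>R (r i + \<theta> *\<^sub>R y \<theta> (uu i) N))"
      unfolding u_def run_sum[OF linA' linB'] by (simp add: run' uu)
    define z where "z = s - run (A' \<theta>) (B' \<theta>) 0 u N"
    have gS: "g \<in> S" unfolding S(1) by (rule span_base) (auto intro: exI[of _ 0] image_eqI[of _ _ 0])
    have A'S: "A' \<theta> ` S \<subseteq> S"
      using A_V gS S_V by (auto simp: A'_def S(1) intro!: span_add span_scale)
    have "run (A' \<theta>) (B' \<theta>) 0 u N \<in> S"
      by (rule run_invariant)
        (use A'S gS R(3) R_S in \<open>auto simp: B'_def S(1) intro!: span_add span_scale span_zero\<close>)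
    then have "z \<in> S" using s by (auto simp: z_def S(1) intro: span_diff)
    moreover have "\<psi> k z = 0" if k: "k < c" for k
    proof -
      have "\<psi> k (run (A' \<theta>) (B' \<theta>) 0 u N) = (\<Sum>i<n + c. \<kappa> i * (\<theta> * \<psi> k (y \<theta> (uu i) N)))"
        by (simp add: ru linear_sum[OF lin\<psi>] linear_scale[OF lin\<psi>] linear_add[OF lin\<psi>] \<psi>R[OF rR])
      also have "\<dots> = \<theta> * (\<Sum>i<n + c. M \<theta> $$ (n + k, i) * \<kappa> i)"
        unfolding sum_distrib_left by (rule sum.cong) (use k in \<open>auto simp: M_def PM_def P\<close>)
      also have "\<dots> = \<psi> k s" using \<kappa>[of "n + k"] k \<theta>(1) by simp
      finally show ?thesis by (simp add: z_def linear_diff[OF lin\<psi>])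
    qed
    ultimately have "z \<in> R" using \<psi>inj[of z c] S_V by blast
    moreover have "f j z = 0" if j: "j < n" for j
    proof -
      have "f j (run (A' \<theta>) (B' \<theta>) 0 u N) = (\<Sum>i<n + c. M \<theta> $$ (j, i) * \<kappa> i)"
        unfolding ru linear_sum[OF f(1)]
        by (rule sum.cong) (use j in \<open>auto simp: M_def PM_def P linear_scale[OF f(1)]\<close>)
      then show ?thesis using \<kappa>[of j] j by (simp add: z_def linear_diff[OF f(1)])
    qed
    ultimately have "z = 0" using f_inj by blast
    then show ?thesis by (auto simp: z_def)
  qed
  then have "{\<theta>. \<not> (\<exists>N. \<forall>s\<in>S. \<exists>u. run (A' \<theta>) (B' \<theta>) 0 u N = s)} \<subseteq> {0} \<union> {\<theta>. poly (det PM) \<theta> = 0}"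
    by blast
  then have "finite {\<theta>. \<not> (\<exists>N. \<forall>s\<in>S. \<exists>u. run (A' \<theta>) (B' \<theta>) 0 u N = s)}"
    using fin finite_subset by blast
  then show ?thesis
    using that[OF lin\<phi> \<phi>R] unfolding A'_def[abs_def] B'_def[abs_def] by blast
qed

section \<open>Input-output behaviors and windows\<close>

definition resp :: "('x::real_vector \<Rightarrow> 'x) \<Rightarrow> ((nat \<Rightarrow> real) \<Rightarrow> 'x) \<Rightarrow> ('x \<Rightarrow> nat \<Rightarrow> real)
    \<Rightarrow> ((nat \<Rightarrow> real) \<Rightarrow> nat \<Rightarrow> real) \<Rightarrow> 'x \<Rightarrow> (nat \<Rightarrow> nat \<Rightarrow> real) \<Rightarrow> nat \<Rightarrow> nat \<Rightarrow> real" where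
  "resp f g h k x u t = h (run f g x u t) + k (u t)"

text \<open>Padding with zeros gives windows of all lengths one type and makes cutting a window a
  linear map.\<close>

definition win :: "nat \<Rightarrow> (nat \<Rightarrow> nat \<Rightarrow> real) \<Rightarrow> nat \<Rightarrow> nat \<Rightarrow> nat \<Rightarrow> real" where
  "win K w t = (\<lambda>j i. if j < K then w (t + j) i else 0)"

lemma win_shift: "win K (\<lambda>s. w (s + a)) t = win K w (t + a)"
  by (auto simp: win_def fun_eq_iff ac_simps)

lemma win_eq_iff: "win K v s = win K w t \<longleftrightarrow> (\<forall>j<K. v (s + j) = w (t + j))"
  by (auto simp: win_def fun_eq_iff)

lemma linear_win: "linear (\<lambda>w. win K w t)"
  by (rule linearI) (auto simp: win_def fun_eq_iff)

text \<open>The kernel form of the rank equality that defines the lag: the observability matrix of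
  depth L already has the kernel of the one of depth L + 1. Unlike ranks, this makes sense for every
  state space.\<close>

definition lag_le :: "nat \<Rightarrow> 'x set \<Rightarrow> ('x::real_vector \<Rightarrow> 'x) \<Rightarrow> ('x \<Rightarrow> nat \<Rightarrow> real) \<Rightarrow> bool" where
  "lag_le L E f h \<longleftrightarrow> (\<forall>x\<in>E. (\<forall>j<L. h ((f ^^ j) x) = 0) \<longrightarrow> h ((f ^^ L) x) = 0)"

definition sig_controllable :: "(nat \<Rightarrow> 'b) set \<Rightarrow> bool" where
  "sig_controllable Bf \<longleftrightarrow> (\<forall>w1 \<in> Bf. \<forall>w2 \<in> Bf. \<forall>t1. \<exists>w \<in> Bf. \<exists>t2 \<ge> t1.
      (\<forall>t \<le> t1. w t = w1 t) \<and> (\<forall>t \<ge> t2. w t = w2 (t - t2)))"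

text \<open>Signals carry the inputs in the channels below m and the outputs in the channels from m up to
  q; the maps h and k give the contributions of state and input to all channels at once.\<close>

locale io_sys =
  fixes m q :: nat and E :: "'x::real_vector set"
    and f :: "'x \<Rightarrow> 'x" and g :: "(nat \<Rightarrow> real) \<Rightarrow> 'x"
    and h :: "'x \<Rightarrow> nat \<Rightarrow> real" and k :: "(nat \<Rightarrow> real) \<Rightarrow> nat \<Rightarrow> real"
  assumes m_le_q: "m \<le> q"
    and lin_f: "linear f" and lin_g: "linear g" and lin_h: "linear h" and lin_k: "linear k"
    and E: "subspace E" "f ` E \<subseteq> E" "range g \<subseteq> E"
    and h_in: "\<And>x i. x \<in> E \<Longrightarrow> i < m \<Longrightarrow> h x i = 0"
    and h_out: "\<And>x i. x \<in> E \<Longrightarrow> q \<le> i \<Longrightarrow> h x i = 0"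
    and k_in: "\<And>u i. i < m \<Longrightarrow> k u i = u i"
    and k_out: "\<And>u i. q \<le> i \<Longrightarrow> k u i = 0"
    and g_cong: "\<And>u v. (\<And>i. i < m \<Longrightarrow> u i = v i) \<Longrightarrow> g u = g v"
    and k_cong: "\<And>u v. (\<And>i. i < m \<Longrightarrow> u i = v i) \<Longrightarrow> k u = k v"
begin

abbreviation "rsp \<equiv> resp f g h k"

text \<open>\<open>rsp x w\<close> reads only the input channels of \<open>w\<close> and reproduces
  them, so the fixed point condition says that the remaining channels are the outputs produced from
  \<open>x\<close>.\<close>

definition beh :: "(nat \<Rightarrow> nat \<Rightarrow> real) set" where
  "beh = {w. \<exists>x\<in>E. rsp x w = w}"

lemma run_E: "x \<in> E \<Longrightarrow> run f g x u t \<in> E"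
  using run_invariant[OF E(1,2), of g u x t] E(3) by blast

lemma run_input_cong:
  "(\<And>s i. s < t \<Longrightarrow> i < m \<Longrightarrow> u s i = v s i) \<Longrightarrow> run f g x u t = run f g x v t"
proof (induct t)
  case (Suc t)
  have "g (u t) = g (v t)" by (rule g_cong) (simp add: Suc(2))
  with Suc show ?case by simp
qed simp

lemma resp_cong:
  assumes "\<And>s i. s \<le> t \<Longrightarrow> i < m \<Longrightarrow> u s i = v s i"
  shows "rsp x u t = rsp x v t"
proof -
  have "run f g x u t = run f g x v t" by (rule run_input_cong) (simp add: assms)
  moreover have "k (u t) = k (v t)" by (rule k_cong) (simp add: assms)
  ultimately show ?thesis by (simp add: resp_def)
qed

lemma resp_in: "x \<in> E \<Longrightarrow> i < m \<Longrightarrow> rsp x u t i = u t i"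
  using h_in[OF run_E] k_in by (simp add: resp_def)

lemma resp_out: "x \<in> E \<Longrightarrow> q \<le> i \<Longrightarrow> rsp x u t i = 0"
  using h_out[OF run_E] k_out by (simp add: resp_def)

lemma resp_beh:
  assumes "x \<in> E" shows "rsp x u \<in> beh"
proof -
  have "rsp x (rsp x u) = rsp x u"
    by (rule ext, rule resp_cong) (rule resp_in[OF assms])
  then show ?thesis unfolding beh_def using assms by auto
qed

lemma resp_split: "rsp x u (s + t) = rsp (run f g x u s) (\<lambda>r. u (s + r)) t"
  by (simp add: resp_def run_split)

lemma resp_comb: "rsp (a *\<^sub>R x + b *\<^sub>R y) (\<lambda>s. a *\<^sub>R u s + b *\<^sub>R v s) t = a *\<^sub>R rsp x u t + b *\<^sub>R rsp y v t"
  using run_comb[OF lin_f lin_g, of a x b y u v t]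
  by (simp add: resp_def linear_add[OF lin_h] linear_add[OF lin_k] linear_scale[OF lin_h]
      linear_scale[OF lin_k] scaleR_add_right)

lemma resp_zero: "rsp 0 (\<lambda>s. 0) t = 0"
  by (simp add: resp_def run_zero[OF lin_f lin_g] linear_0[OF lin_h] linear_0[OF lin_k])

lemma resp_free: "rsp x (\<lambda>s. 0) t = h ((f ^^ t) x)"
  by (simp add: resp_def run_free[OF lin_f lin_g] linear_0[OF lin_k])

lemma beh_out: "w \<in> beh \<Longrightarrow> q \<le> i \<Longrightarrow> w t i = 0"
  unfolding beh_def by (auto dest: resp_out[of _ i w t])

lemma beh_subspace: "subspace beh"
proof -
  have comb: "(\<lambda>t. a *\<^sub>R v t + b *\<^sub>R w t) \<in> beh" if vw: "v \<in> beh" "w \<in> beh" for v w a b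
  proof -
    obtain x y where x: "x \<in> E" "rsp x v = v" and y: "y \<in> E" "rsp y w = w"
      using vw by (auto simp: beh_def)
    have "a *\<^sub>R x + b *\<^sub>R y \<in> E" using E(1) x(1) y(1) by (simp add: subspace_add subspace_scale)
    moreover have "rsp (a *\<^sub>R x + b *\<^sub>R y) (\<lambda>t. a *\<^sub>R v t + b *\<^sub>R w t) = (\<lambda>t. a *\<^sub>R v t + b *\<^sub>R w t)"
      using resp_comb x(2) y(2) by (simp add: fun_eq_iff)
    ultimately show ?thesis unfolding beh_def by blast
  qed
  have "0 \<in> beh"
  proof -
    have "rsp 0 (\<lambda>s. 0) = 0" by (rule ext) (simp add: resp_zero)
    then show ?thesis using resp_beh[OF subspace_0[OF E(1)], of "\<lambda>s. 0"] by simp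
  qed
  then show ?thesis
    using comb[of _ _ 1 1] comb[of _ _ _ 0] by (auto simp: subspace_def plus_fun_def scaleR_fun_def)
qed

lemma beh_shift:
  assumes "w \<in> beh" shows "(\<lambda>t. w (t + a)) \<in> beh"
proof -
  obtain x where x: "x \<in> E" "rsp x w = w" using assms by (auto simp: beh_def)
  have "rsp (run f g x w a) (\<lambda>r. w (r + a)) = (\<lambda>t. w (t + a))"
    using fun_cong[OF x(2)] resp_split[of x w a] by (simp add: fun_eq_iff add.commute)
  then show ?thesis unfolding beh_def using run_E[OF x(1)] by blast
qed

lemma beh_input:
  assumes "w \<in> beh"
  obtains w' where "w' \<in> beh" "\<And>s. s < t \<Longrightarrow> w' s = w s" "\<And>s i. t \<le> s \<Longrightarrow> i < m \<Longrightarrow> w' s i = u s i"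
proof -
  obtain x where x: "x \<in> E" "rsp x w = w" using assms by (auto simp: beh_def)
  define v where "v = (\<lambda>s. if s < t then w s else u s)"
  have "rsp x v s = w s" if "s < t" for s
    using resp_cong[of s v w x] fun_cong[OF x(2), of s] that by (simp add: v_def)
  then show ?thesis
    using that[of "rsp x v"] resp_beh[OF x(1)] resp_in[OF x(1)] by (simp add: v_def)
qed

lemma lag_step:
  assumes lag: "lag_le L E f h" and w: "w \<in> beh" "\<And>s. s < L \<Longrightarrow> w s = 0" "\<And>i. i < m \<Longrightarrow> w L i = 0"
  shows "w L = 0"
proof -
  obtain x where x: "x \<in> E" "rsp x w = w" using w(1) by (auto simp: beh_def)
  have fr: "w s = h ((f ^^ s) x)" if "s \<le> L" for s
  proof -
    have "rsp x w s = rsp x (\<lambda>s. 0) s"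
      by (rule resp_cong) (use that w in \<open>auto simp: le_less\<close>)
    then show ?thesis using fun_cong[OF x(2), of s] by (simp add: resp_free)
  qed
  then show ?thesis
    using lag x(1) w(2) unfolding lag_le_def by (metis less_imp_le order_refl)
qed

lemma lag_agree:
  assumes lag: "lag_le L E f h" and vw: "v \<in> beh" "w \<in> beh" and ag: "\<And>s. s < L \<Longrightarrow> v s = w s"
    "\<And>i. i < m \<Longrightarrow> v L i = w L i"
  shows "v L = w L"
proof -
  have "v - w \<in> beh" using subspace_diff[OF beh_subspace vw] .
  then have "(v - w) L = 0"
    using lag_step[OF lag, of "v - w"] ag by simp
  then show ?thesis by simp
qed

lemma lag_unique:
  assumes lag: "lag_le L E f h" and vw: "v \<in> beh" "w \<in> beh" and ag: "\<And>s. s < L \<Longrightarrow> v s = w s"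
    "\<And>s i. i < m \<Longrightarrow> v s i = w s i"
  shows "v = w"
proof
  fix t
  show "v t = w t"
  proof (induct t rule: less_induct)
    case (less t)
    show ?case
    proof (cases "t < L")
      case False
      then have "v (s + (t - L)) = w (s + (t - L))" if "s < L" for s
        using less[of "s + (t - L)"] that by simp
      then show ?thesis
        using lag_agree[OF lag beh_shift[OF vw(1), of "t - L"] beh_shift[OF vw(2), of "t - L"]] ag(2) False
        by simp
    qed (use ag in simp)
  qed
qed

text \<open>The first window fixes an initial state. Afterwards the response to the inputs of
  \<open>w\<close> cannot leave \<open>w\<close>: the last L samples and the current input agree
  with those of a trajectory, and by the lag bound they determine the current output.\<close>

lemma beh_complete:
  assumes lag: "lag_le L E f h" and w: "\<And>t. \<exists>v\<in>beh. win (Suc L) w t = win (Suc L) v 0"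
  shows "w \<in> beh"
proof -
  obtain v where v: "v \<in> beh" "\<And>j. j \<le> L \<Longrightarrow> w j = v j"
    using w[of 0] by (auto simp: win_eq_iff less_Suc_eq_le)
  obtain x where x: "x \<in> E" "rsp x v = v" using v(1) by (auto simp: beh_def)
  have wx: "rsp x w \<in> beh" using resp_beh[OF x(1)] .
  have "rsp x w t = w t" for t
  proof (induct t rule: less_induct)
    case (less t)
    show ?case
    proof (cases "t \<le> L")
      case True
      have "rsp x w t = rsp x v t" by (rule resp_cong) (use v(2) True in simp)
      then show ?thesis using fun_cong[OF x(2), of t] v(2)[OF True] by simp
    next
      case False
      obtain v' where v': "v' \<in> beh" "\<And>j. j \<le> L \<Longrightarrow> w (t - L + j) = v' j"
        using w[of "t - L"] by (auto simp: win_eq_iff less_Suc_eq_le)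
      have wt: "w t = v' L" using v'(2)[of L] False by simp
      have "rsp x w (L + (t - L)) = v' L"
      proof (rule lag_agree[OF lag beh_shift[OF wx, of "t - L"] v'(1)])
        show "rsp x w (s + (t - L)) = v' s" if "s < L" for s
          using less[of "s + (t - L)"] v'(2)[of s] that False by (simp add: add.commute)
        show "rsp x w (L + (t - L)) i = v' L i" if "i < m" for i
          using resp_in[OF x(1) that] wt False by simp
      qed
      then show ?thesis using wt False by simp
    qed
  qed
  then have "rsp x w = w" by auto
  then show ?thesis using wx by simp
qed

text \<open>The connecting input steers from rest to the initial state of \<open>w2\<close> minus
  the free motion of the current state; superposition then lands at the initial state of
  \<open>w2\<close>.\<close>

lemma reach_imp_controllable:
  assumes reach: "\<And>s. s \<in> E \<Longrightarrow> \<exists>u. run f g 0 u N = s"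
  shows "sig_controllable beh"
  unfolding sig_controllable_def
proof (intro ballI allI)
  fix w1 w2 t1 assume "w1 \<in> beh" "w2 \<in> beh"
  then obtain x1 x2 where x1: "x1 \<in> E" "rsp x1 w1 = w1" and x2: "x2 \<in> E" "rsp x2 w2 = w2"
    by (auto simp: beh_def)
  let ?s1 = "run f g x1 w1 (Suc t1)"
  have "(f ^^ N) ?s1 \<in> E"
    using run_free[OF lin_f lin_g] run_E[OF run_E[OF x1(1)]] by metis
  then obtain u where u: "run f g 0 u N = x2 - (f ^^ N) ?s1"
    using reach subspace_diff[OF E(1) x2(1)] by blast
  define U where "U = (\<lambda>t. if t \<le> t1 then w1 t else if t < Suc t1 + N then u (t - Suc t1) else w2 (t - (Suc t1 + N)))"
  have s1: "run f g x1 U (Suc t1) = ?s1"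
    by (rule run_causal) (simp add: U_def)
  have "run f g ?s1 (\<lambda>r. U (Suc t1 + r)) N = run f g ?s1 u N"
    by (rule run_causal) (simp add: U_def)
  then have x2U: "run f g x1 U (Suc t1 + N) = x2"
    using run_split[of f g x1 U "Suc t1" N] s1 u run_decomp[OF lin_f lin_g, of ?s1 u N]
    by (simp del: run.simps)
  have "rsp x1 U t = w1 t" if "t \<le> t1" for t
    using resp_cong[of t U w1 x1] fun_cong[OF x1(2), of t] that by (simp add: U_def)
  moreover have "rsp x1 U t = w2 (t - (Suc t1 + N))" if "t \<ge> Suc t1 + N" for t
  proof -
    have "(\<lambda>r. U (Suc t1 + N + r)) = w2" by (simp add: U_def fun_eq_iff)
    then show ?thesis
      using resp_split[of x1 U "Suc t1 + N" "t - (Suc t1 + N)"] that x2U x2(2) by (metis le_add_diff_inverse)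
  qed
  ultimately show "\<exists>w\<in>beh. \<exists>t2\<ge>t1. (\<forall>t\<le>t1. w t = w1 t) \<and> (\<forall>t\<ge>t2. w t = w2 (t - t2))"
    using resp_beh[OF x1(1)] by (intro bexI[of _ "rsp x1 U"] exI[of _ "Suc t1 + N"]) auto
qed

lemma controllable_from_rest:
  assumes "sig_controllable beh" "w \<in> beh"
  obtains v t2 where "v \<in> beh" "t1 \<le> t2" "\<And>t. t \<le> t1 \<Longrightarrow> v t = 0" "\<And>t. v (t + t2) = w t"
proof -
  have "0 \<in> beh" using subspace_0[OF beh_subspace] .
  then obtain v t2 where "v \<in> beh" "t2 \<ge> t1" "\<forall>t\<le>t1. v t = 0 t" "\<forall>t\<ge>t2. v t = w (t - t2)"
    using assms unfolding sig_controllable_def by blast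
  then show ?thesis using that[of v t2] by (simp add: zero_fun_def)
qed

end

text \<open>Controllability of the larger behavior joins any of its trajectories to a long enough
  rest. From rest, the lag bound makes a trajectory a function of its input alone, and the smaller
  behavior accepts every input; so it contains the joined trajectory and, by shift invariance, the
  given one.\<close>

lemma controllable_subbehavior_eq:
  assumes "io_sys m q E f g h k" "io_sys m q E' f' g' h' k'"
    and sub: "io_sys.beh E' f' g' h' k' \<subseteq> io_sys.beh E f g h k"
    and lag: "lag_le L E f h" and con: "sig_controllable (io_sys.beh E f g h k)"
  shows "io_sys.beh E f g h k = io_sys.beh E' f' g' h' k'"
proof -
  interpret S: io_sys m q E f g h k by fact
  interpret S': io_sys m q E' f' g' h' k' by fact
  have "w \<in> S'.beh" if wS: "w \<in> S.beh" for w
  proof -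
    obtain v t2 where v: "v \<in> S.beh" "\<And>t. t \<le> L \<Longrightarrow> v t = 0" "\<And>t. v (t + t2) = w t"
      using S.controllable_from_rest[OF con wS, of L] by metis
    have v'1: "S'.rsp 0 v \<in> S'.beh" using S'.resp_beh subspace_0[OF S'.E(1)] by blast
    have "S'.rsp 0 v t = v t" if "t < L" for t
      using S'.resp_cong[of t v "\<lambda>s. 0" 0] S'.resp_zero v(2) that by (simp)
    then have "S'.rsp 0 v = v"
      using S.lag_unique[OF lag subsetD[OF sub v'1] v(1)] S'.resp_in[OF subspace_0[OF S'.E(1)]] by blast
    then have "v \<in> S'.beh" using v'1 by simp
    then have "(\<lambda>t. v (t + t2)) \<in> S'.beh" by (rule S'.beh_shift)
    then show ?thesis using v(3) by simp
  qed
  with sub show ?thesis by blast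
qed

section \<open>Shift-register systems whose state is the window of the last L samples\<close>

definition window_space :: "nat \<Rightarrow> nat \<Rightarrow> (nat \<Rightarrow> nat \<Rightarrow> real) set" where
  "window_space L q = {x. \<forall>j i. L \<le> j \<or> q \<le> i \<longrightarrow> x j i = 0}"

text \<open>The input part of the sample at position L: a past window plus
  \<open>in_slot m L u\<close> is all that is known before the output at time L is computed.\<close>

definition in_slot :: "nat \<Rightarrow> nat \<Rightarrow> (nat \<Rightarrow> real) \<Rightarrow> nat \<Rightarrow> nat \<Rightarrow> real" where
  "in_slot m L u = (\<lambda>j i. if j = L \<and> i < m then u i else 0)"

definition drop_first :: "nat \<Rightarrow> (nat \<Rightarrow> nat \<Rightarrow> real) \<Rightarrow> nat \<Rightarrow> nat \<Rightarrow> real" where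
  "drop_first L v = (\<lambda>j i. if j < L then v (Suc j) i else 0)"

definition unit_win :: "nat \<Rightarrow> nat \<Rightarrow> nat \<Rightarrow> nat \<Rightarrow> real" where
  "unit_win l c = (\<lambda>j i. if j = l \<and> i = c then 1 else 0)"

lemma linear_in_slot: "linear (in_slot m L)"
  by (rule linearI) (auto simp: in_slot_def fun_eq_iff)

lemma linear_drop_first: "linear (drop_first L)"
  by (rule linearI) (auto simp: drop_first_def fun_eq_iff)

lemma subspace_window_space: "subspace (window_space L q)"
  by (auto simp: subspace_def window_space_def)

lemma unit_win_sum:
  "(\<Sum>l<L. \<Sum>c<q. x l c *\<^sub>R unit_win l c) j i = (if j < L \<and> i < q then x j i else 0)"
proof -
  have "(\<Sum>c<q. x l c *\<^sub>R unit_win l c) j i = (if l = j then (\<Sum>c<q. if c = i then x l c else 0) else 0)" for l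
  proof (cases "l = j")
    case True
    have "x l c * (if i = c then 1 else 0) = (if c = i then x l c else 0)" for c by simp
    with True show ?thesis by (simp add: sum_fun_apply unit_win_def)
  qed (simp add: sum_fun_apply unit_win_def)
  then have "(\<Sum>l<L. \<Sum>c<q. x l c *\<^sub>R unit_win l c) j i = (\<Sum>l<L. if l = j then (\<Sum>c<q. if c = i then x l c else 0) else 0)"
    by (simp only: sum_fun_apply)
  then show ?thesis by simp
qed

lemma window_space_span:
  obtains F where "finite F" "window_space L q \<subseteq> span F"
proof -
  let ?F = "(\<lambda>(j, i). unit_win j i) ` ({..<L} \<times> {..<q})"
  have "x \<in> span ?F" if "x \<in> window_space L q" for x
  proof -
    have "x = (\<Sum>l<L. \<Sum>c<q. x l c *\<^sub>R unit_win l c)"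
      using that by (intro ext) (auto simp: unit_win_sum window_space_def)
    also have "\<dots> \<in> span ?F"
      by (intro span_sum span_scale span_base) auto
    finally show ?thesis .
  qed
  then show ?thesis using that[of ?F] by auto
qed

lemma run_cong_on:
  assumes "x \<in> S" "A ` S \<subseteq> S" "range B \<subseteq> S" "subspace S"
    and "\<And>s. s \<in> S \<Longrightarrow> A' s = A s" "\<And>u. B' u = B u"
  shows "run A' B' x u t = run A B x u t"
proof (induct t)
  case (Suc t)
  have "run A B x u t \<in> S" using run_invariant[OF assms(4,2)] assms(1,3) by blast
  with Suc show ?case using assms(5,6) by simp
qed simp

text \<open>An autoregressive law: \<open>c\<close> completes the past window and the current input
  to a window of length L + 1, and dropping its oldest sample gives the next state. The space
  \<open>S\<close> of admissible registers may be smaller than the whole window space, because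
  reachability will be established only there.\<close>

locale window_law =
  fixes m q L :: nat and S :: "(nat \<Rightarrow> nat \<Rightarrow> real) set"
    and c :: "(nat \<Rightarrow> nat \<Rightarrow> real) \<Rightarrow> nat \<Rightarrow> nat \<Rightarrow> real"
  assumes mq: "m \<le> q" and lin_c: "linear c"
    and c_section: "\<And>x j i. j < L \<or> j = L \<and> i < m \<Longrightarrow> c x j i = x j i"
    and c_zero: "\<And>x j i. L < j \<or> j = L \<and> q \<le> i \<Longrightarrow> c x j i = 0"
    and S: "subspace S" "S \<subseteq> window_space L q"
    and S_next: "\<And>s. s \<in> S \<Longrightarrow> drop_first L (c s) \<in> S" "\<And>u. drop_first L (c (in_slot m L u)) \<in> S"
begin

abbreviation "fW \<equiv> \<lambda>s. drop_first L (c s)"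
abbreviation "gW \<equiv> \<lambda>u. drop_first L (c (in_slot m L u))"
abbreviation "hW \<equiv> \<lambda>s. c s L"
abbreviation "kW \<equiv> \<lambda>u. c (in_slot m L u) L"

sublocale io_sys m q S fW gW hW kW
proof (rule io_sys.intro)
  show "linear fW"
    using linear_compose[OF lin_c linear_drop_first] by (simp add: o_def)
  have cs: "linear (\<lambda>u. c (in_slot m L u))"
    using linear_compose[OF linear_in_slot lin_c] by (simp add: o_def)
  show "linear gW"
    using linear_compose[OF cs linear_drop_first] by (simp add: o_def)
  show "linear hW"
    by (rule linearI) (simp_all add: linear_add[OF lin_c] linear_scale[OF lin_c])
  show "linear kW"
    by (rule linearI) (simp_all add: linear_add[OF cs] linear_scale[OF cs])
  show "c s L i = 0" if "s \<in> S" "i < m" for s i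
    using c_section[of L i s] that S(2) by (auto simp: window_space_def)
  show "c s L i = 0" if "s \<in> S" "q \<le> i" for s i
    using c_zero that by blast
  show "c (in_slot m L u) L i = u i" if "i < m" for u i
    using c_section[of L i] that by (simp add: in_slot_def)
  show "c (in_slot m L u) L i = 0" if "q \<le> i" for u i
    using c_zero that by blast
  have sl: "in_slot m L u = in_slot m L v" if "\<And>i. i < m \<Longrightarrow> u i = v i" for u v
    using that by (auto simp: in_slot_def fun_eq_iff)
  show "gW u = gW v" if "\<And>i. i < m \<Longrightarrow> u i = v i" for u v
    using sl[OF that] by simp
  show "kW u = kW v" if "\<And>i. i < m \<Longrightarrow> u i = v i" for u v
    using sl[OF that] by simp
qed (use S S_next mq in auto)

text \<open>Content moves down one slot per step, so after d steps slot j holds what was in slot j +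
  d or, once j + d reaches L, a sample produced meanwhile.\<close>

lemma run_slots:
  assumes "j < L"
  shows "run fW gW s u (t + d) j = (if L \<le> j + d then rsp s u (t + (j + d - L)) else run fW gW s u t (j + d))"
  using assms
proof (induct d arbitrary: j)
  case (Suc d)
  let ?x = "run fW gW s u (t + d)"
  have x: "run fW gW s u (t + Suc d) j = (c ?x + c (in_slot m L (u (t + d)))) (Suc j)"
    using Suc.prems by (simp add: drop_first_def fun_eq_iff)
  show ?case
  proof (cases "Suc j < L")
    case True
    then have "c ?x (Suc j) = ?x (Suc j)" "c (in_slot m L (u (t + d))) (Suc j) = 0"
      using c_section by (auto simp: fun_eq_iff in_slot_def)
    then show ?thesis using x Suc.hyps[OF True] by simp
  next
    case False
    then have j: "Suc j = L" using Suc.prems by simp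
    then have "j + Suc d - L = d" by simp
    then show ?thesis using x j by (simp add: resp_def fun_eq_iff)
  qed
qed simp

lemma run_window:
  assumes "s \<in> S"
  shows "run fW gW s u (t + L) = win L (rsp s u) t"
proof (intro ext)
  fix j i
  show "run fW gW s u (t + L) j i = win L (rsp s u) t j i"
    using run_slots[of j s u t L] run_E[OF assms, of u "t + L"] S(2)
    by (auto simp: win_def window_space_def)
qed

lemma beh_window:
  assumes "w \<in> beh"
  shows "win L w t \<in> S" "win (Suc L) w t = c (win L w t + in_slot m L (w (t + L)))"
proof -
  obtain s where s: "s \<in> S" "rsp s w = w" using assms by (auto simp: beh_def)
  have r: "run fW gW s w (t + L) = win L w t" using run_window[OF s(1), of w t] s(2) by simp
  then show "win L w t \<in> S" using run_E[OF s(1)] by metis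
  have "w (t + L) = c (win L w t + in_slot m L (w (t + L))) L"
    using fun_cong[OF s(2), of "t + L"] r by (simp add: resp_def linear_add[OF lin_c])
  then have top: "w (t + L) i = c (win L w t + in_slot m L (w (t + L))) L i" for i
    by (rule fun_cong)
  show "win (Suc L) w t = c (win L w t + in_slot m L (w (t + L)))"
  proof (intro ext)
    fix j i
    consider "j < L" | "j = L" | "L < j" by linarith
    then show "win (Suc L) w t j i = c (win L w t + in_slot m L (w (t + L))) j i"
    proof cases
      case 1
      then show ?thesis using c_section[of j i] by (simp add: win_def in_slot_def)
    next
      case 2
      then show ?thesis using top[of i] by (simp add: win_def)
    next
      case 3
      then show ?thesis using c_zero[of j i] by (simp add: win_def)
    qed
  qed
qed

text \<open>After L steps the register contains only samples that the free motion has produced. If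
  these vanish, the state is 0 and so is the next output.\<close>

lemma lag_window: "lag_le L S fW hW"
  unfolding lag_le_def
proof (intro ballI impI)
  fix s assume s: "s \<in> S" and z: "\<forall>j<L. hW ((fW ^^ j) s) = 0"
  have "win L (rsp s (\<lambda>s. 0)) 0 = 0"
    unfolding win_def resp_free using z by (auto simp: fun_eq_iff)
  then have "(fW ^^ L) s = 0"
    using run_window[OF s, of "\<lambda>s. 0" 0] run_free[OF lin_f lin_g, of s L] by simp
  then show "hW ((fW ^^ L) s) = 0" by (simp add: linear_0[OF lin_c])
qed

lemma beh_start:
  assumes reach: "\<And>s. s \<in> S \<Longrightarrow> \<exists>u N. run fW gW 0 u N = s" and s: "s \<in> S"
  obtains w where "w \<in> beh" "win L w 0 = s" "\<And>t i. L \<le> t \<Longrightarrow> i < m \<Longrightarrow> w t i = u t i"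
proof -
  obtain v N where "run fW gW 0 v N = s" using reach s by blast
  \<comment> \<open>The extra L steps fill the register, so that the state \<open>s\<close> at time
    N + L is really the window of the samples from time N on.\<close>
  then obtain v where v: "run fW gW 0 v (N + L) = s"
    using reach_mono[OF lin_f lin_g, of v N s "N + L"] by auto
  define U where "U = (\<lambda>t. if t < N + L then v t else u (t - N))"
  define w where "w = (\<lambda>t. rsp 0 U (t + N))"
  have 0: "0 \<in> S" using subspace_0[OF S(1)] .
  have "w \<in> beh" unfolding w_def by (rule beh_shift[OF resp_beh[OF 0]])
  moreover have "run fW gW 0 U (N + L) = s"
    using run_causal[of "N + L" U v fW gW 0] v by (simp add: U_def)
  then have "win L w 0 = s"
    using run_window[OF 0, of U N] by (simp add: w_def win_shift)
  moreover have "w t i = u t i" if "L \<le> t" "i < m" for t i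
    using resp_in[OF 0 that(2), of U "t + N"] that(1) by (simp add: w_def U_def)
  ultimately show ?thesis using that by blast
qed

end

section \<open>Perturbing the law of the true behavior\<close>

lemma (in io_sys) completion_exists:
  assumes lag: "lag_le L E f h"
  obtains cm where "linear cm"
    "\<And>x j i. j < L \<or> j = L \<and> i < m \<Longrightarrow> cm x j i = x j i"
    "\<And>x j i. L < j \<or> j = L \<and> q \<le> i \<Longrightarrow> cm x j i = 0"
    "\<And>w t. w \<in> beh \<Longrightarrow> cm (win L w t + in_slot m L (w (t + L))) = win (Suc L) w t"
proof -
  define p :: "(nat \<Rightarrow> nat \<Rightarrow> real) \<Rightarrow> nat \<Rightarrow> nat \<Rightarrow> real"
    where "p v = (\<lambda>j i. if j < L \<or> j = L \<and> i < m then v j i else 0)" for v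
  define W where "W = (\<lambda>w. win (Suc L) w 0) ` beh"
  have lin_p: "linear p"
    by (rule linearI) (auto simp: p_def fun_eq_iff)
  have subW: "subspace W"
    unfolding W_def by (rule linear_subspace_image[OF linear_win beh_subspace])
  \<comment> \<open>Here the lag bound enters: L zero samples followed by a zero input force a zero
    output, so the output at time L is a function of the rest of the window.\<close>
  have "inj_on p W"
  proof (subst linear_injective_on_subspace_0[OF lin_p subW], intro ballI impI)
    fix v assume "v \<in> W" and pv: "p v = 0"
    then obtain w where w: "w \<in> beh" "v = win (Suc L) w 0" by (auto simp: W_def)
    have z: "w j i = 0" if "j < L \<or> j = L \<and> i < m" for j i
      using fun_cong[OF fun_cong[OF pv, of j], of i] w(2) that by (auto simp: p_def win_def)
    have "w L = 0"
      by (rule lag_step[OF lag w(1)]) (use z in \<open>auto simp: fun_eq_iff\<close>)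
    then have "w j i = 0" if "j < Suc L" for j i
      using z[of j i] that by (cases "j = L") auto
    then show "v = 0" by (auto simp: w(2) win_def fun_eq_iff)
  qed
  then obtain ci where ci: "linear ci" "\<And>v. v \<in> W \<Longrightarrow> ci (p v) = v"
    using linear_exists_left_inverse_on[OF lin_p subW] by blast
  \<comment> \<open>Off the true windows the completion is whatever the linear extension
    \<open>ci\<close> provides; a feedback added later adjusts the poles there.\<close>
  define cm where "cm x = (\<lambda>j i. if j < L \<or> j = L \<and> i < m then x j i else if j = L \<and> i < q then ci x j i else 0)" for x
  have "linear cm"
    by (rule linearI) (auto simp: cm_def fun_eq_iff linear_add[OF ci(1)] linear_scale[OF ci(1)])
  moreover have "cm (win L w t + in_slot m L (w (t + L))) = win (Suc L) w t" if w: "w \<in> beh" for w t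
  proof -
    let ?v = "win (Suc L) w t"
    have pe: "win L w t + in_slot m L (w (t + L)) = p ?v"
      by (auto simp: fun_eq_iff win_def in_slot_def p_def)
    have "?v \<in> W"
      using beh_shift[OF w, of t] win_shift[of "Suc L" w t 0] unfolding W_def by (auto intro!: image_eqI)
    then have "ci (p ?v) = ?v" by (rule ci(2))
    then show ?thesis
      unfolding pe cm_def using beh_out[OF w] by (auto simp: fun_eq_iff p_def win_def)
  qed
  moreover have c1: "cm x j i = x j i" if "j < L \<or> j = L \<and> i < m" for x j i
    using that by (auto simp: cm_def)
  moreover have c2: "cm x j i = 0" if "L < j \<or> j = L \<and> q \<le> i" for x j i
    using that m_le_q by (auto simp: cm_def)
  ultimately show ?thesis
    by (intro that[of cm])
qed

text \<open>Fed with the inputs of \<open>w\<close> from time L on, the register tracks the windows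
  of \<open>w\<close>; the shift by L accounts for the zero window with which both begin.\<close>

lemma (in io_sys) reach_windows:
  assumes lin: "linear cm"
    and comp: "\<And>w t. w \<in> beh \<Longrightarrow> cm (win L w t + in_slot m L (w (t + L))) = win (Suc L) w t"
    and w: "w \<in> beh" "win L w 0 = 0"
  shows "run (\<lambda>s. drop_first L (cm s)) (\<lambda>u. drop_first L (cm (in_slot m L u))) 0 (\<lambda>t. w (t + L)) t = win L w t"
proof (induct t)
  case 0
  show ?case by (simp add: w(2))
next
  case (Suc t)
  have "drop_first L (cm (win L w t)) + drop_first L (cm (in_slot m L (w (t + L)))) = drop_first L (win (Suc L) w t)"
    by (simp add: comp[OF w(1), symmetric] linear_add[OF lin] linear_add[OF linear_drop_first])
  also have "\<dots> = win L w (Suc t)"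
    by (auto simp: drop_first_def win_def fun_eq_iff)
  finally show ?case using Suc by simp
qed

text \<open>The two facts about a perturbed behavior \<open>P\<close> from which the contradiction
  is drawn: \<open>P\<close> still explains every stretch of a true trajectory on whose windows
  \<open>r\<close> vanishes, in particular the data, and every true window of length L + 1 has a
  copy in \<open>P\<close> that is displaced in one output at time L.\<close>

definition (in io_sys) perturbation ::
    "nat \<Rightarrow> ((nat \<Rightarrow> nat \<Rightarrow> real) \<Rightarrow> real) \<Rightarrow> real \<Rightarrow> (nat \<Rightarrow> nat \<Rightarrow> real) set \<Rightarrow> bool" where
  "perturbation L r \<theta> P \<longleftrightarrow>
     (\<forall>w\<in>beh. \<forall>T. (\<forall>t. t + L < T \<longrightarrow> r (win (Suc L) w t) = 0) \<longrightarrow> (\<exists>w'\<in>P. \<forall>t<T. w' t = w t)) \<and>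
     (\<forall>w\<in>beh. \<exists>w'\<in>P. win (Suc L) w' 0 = win (Suc L) w 0 + (\<theta> * r (win (Suc L) w 0)) *\<^sub>R unit_win L m)"

text \<open>The perturbed law adds to the next output in channel m a feedback that vanishes on
  every window annihilated by the functional r.\<close>

lemma (in io_sys) perturbed_systems:
  fixes r :: "(nat \<Rightarrow> nat \<Rightarrow> real) \<Rightarrow> real"
  assumes lag: "lag_le L E f h" and con: "sig_controllable beh" and mq: "m < q"
    and lin_r: "linear r" and w0: "w0 \<in> beh" "r (win (Suc L) w0 0) \<noteq> 0"
  obtains bad where "finite bad"
    "\<And>\<theta>. \<theta> \<notin> bad \<Longrightarrow> \<exists>(S :: (nat \<Rightarrow> nat \<Rightarrow> real) set) f' g' h' k' F. io_sys m q S f' g' h' k' \<and> finite F \<and>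
      S \<subseteq> span F \<and> lag_le L S f' h' \<and> sig_controllable (io_sys.beh S f' g' h' k') \<and>
      perturbation L r \<theta> (io_sys.beh S f' g' h' k')"
proof -
  obtain cm where cm: "linear cm"
    "\<And>x j i. j < L \<or> j = L \<and> i < m \<Longrightarrow> cm x j i = x j i"
    "\<And>x j i. L < j \<or> j = L \<and> q \<le> i \<Longrightarrow> cm x j i = 0"
    "\<And>w t. w \<in> beh \<Longrightarrow> cm (win L w t + in_slot m L (w (t + L))) = win (Suc L) w t"
    using completion_exists[OF lag] by blast
  define R where "R = (\<lambda>w. win L w 0) ` beh"
  have R_win: "win L w t \<in> R" if "w \<in> beh" for w t
    using beh_shift[OF that, of t] win_shift[of L w t 0] unfolding R_def by (auto intro!: image_eqI)
  define A where "A s = drop_first L (cm s)" for s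
  define B where "B u = drop_first L (cm (in_slot m L u))" for u
  define b1 where "b1 s = r (cm s)" for s
  define b2 where "b2 u = r (cm (in_slot m L u))" for u
  define g0 where "g0 = drop_first L (unit_win L m)"
  have lin_cs: "linear (\<lambda>u. cm (in_slot m L u))"
    using linear_compose[OF linear_in_slot cm(1)] by (simp add: o_def)
  have linA: "linear A"
    unfolding A_def[abs_def] using linear_compose[OF cm(1) linear_drop_first] by (simp add: o_def)
  have linB: "linear B"
    unfolding B_def[abs_def] using linear_compose[OF lin_cs linear_drop_first] by (simp add: o_def)
  have lin1: "linear b1"
    unfolding b1_def[abs_def] using linear_compose[OF cm(1) lin_r] by (simp add: o_def)
  have lin2: "linear b2"
    unfolding b2_def[abs_def] using linear_compose[OF lin_cs lin_r] by (simp add: o_def)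
  have subR: "subspace R"
    unfolding R_def by (rule linear_subspace_image[OF linear_win beh_subspace])
  have next_R: "A s + B u \<in> R" if "s \<in> R" for s u
  proof -
    obtain w where w: "w \<in> beh" "s = win L w 0" using \<open>s \<in> R\<close> by (auto simp: R_def)
    obtain w' where w': "w' \<in> beh" "\<And>t. t < L \<Longrightarrow> w' t = w t" "\<And>t i. L \<le> t \<Longrightarrow> i < m \<Longrightarrow> w' t i = u i"
      using beh_input[OF w(1), of L "\<lambda>_. u"] by metis
    have "s = win L w' 0" using w'(2) by (auto simp: w(2) win_eq_iff)
    moreover have "in_slot m L u = in_slot m L (w' (0 + L))"
      using w'(3)[of L] by (auto simp: in_slot_def fun_eq_iff)
    ultimately have "A s + B u = drop_first L (win (Suc L) w' 0)"
      using cm(4)[OF w'(1), of 0] by (simp add: A_def B_def linear_add[OF cm(1), symmetric]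
          linear_add[OF linear_drop_first, symmetric])
    also have "\<dots> = win L w' (Suc 0)" by (auto simp: drop_first_def win_def fun_eq_iff)
    finally show ?thesis using R_win[OF w'(1)] by metis
  qed
  have R0: "0 \<in> R" using subspace_0[OF subR] .
  have AR: "A ` R \<subseteq> R"
    using next_R[of _ 0] by (auto simp: linear_0[OF linB])
  have BR: "range B \<subseteq> R"
    using next_R[OF R0] by (auto simp: linear_0[OF linA])
  \<comment> \<open>The smallest \<open>A\<close>-invariant space that contains the true windows and
    the direction \<open>g0\<close> in which the perturbation acts on the register. The perturbed
    motion from rest stays in it, so only here can reachability be expected.\<close>
  define S where "S = span (R \<union> range (\<lambda>j. (A ^^ j) g0))"
  have R_S: "R \<subseteq> S" unfolding S_def by (auto intro: span_base)
  have g0_S: "g0 \<in> S"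
    unfolding S_def by (rule span_base) (auto intro: image_eqI[of _ _ 0])
  have A_win: "A x \<in> window_space L q" if "x \<in> window_space L q" for x
    unfolding window_space_def
  proof (intro CollectI allI impI)
    fix j i assume ji: "L \<le> j \<or> q \<le> i"
    show "A x j i = 0"
    proof (cases "j < L")
      case True
      then have "q \<le> i" using ji by simp
      then have "cm x (Suc j) i = 0"
        using cm(2)[of "Suc j" i x] cm(3)[of "Suc j" i x] True that
        by (cases "Suc j = L") (auto simp: window_space_def)
      then show ?thesis by (simp add: A_def drop_first_def)
    qed (simp add: A_def drop_first_def)
  qed
  have g0_win: "(A ^^ j) g0 \<in> window_space L q" for j
  proof (induct j)
    case 0
    show ?case using mq by (auto simp: g0_def drop_first_def unit_win_def window_space_def)
  next
    case (Suc j)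
    then show ?case using A_win by simp
  qed
  have "R \<subseteq> window_space L q"
    using beh_out by (auto simp: R_def win_def window_space_def)
  then have S_win: "S \<subseteq> window_space L q"
    unfolding S_def using g0_win by (intro span_minimal subspace_window_space) auto
  have AS: "A ` S \<subseteq> S"
  proof -
    have "A ` (R \<union> range (\<lambda>j. (A ^^ j) g0)) \<subseteq> R \<union> range (\<lambda>j. (A ^^ j) g0)"
    proof -
      have "A ((A ^^ j) g0) \<in> range (\<lambda>j. (A ^^ j) g0)" for j
        by (rule range_eqI[of _ _ "Suc j"]) simp
      then show ?thesis using AR by blast
    qed
    then have "span (A ` (R \<union> range (\<lambda>j. (A ^^ j) g0))) \<subseteq> S"
      unfolding S_def by (rule span_mono)
    then show ?thesis unfolding S_def linear_span_image[OF linA] .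
  qed
  obtain F where F: "finite F" "window_space L q \<subseteq> span F"
    using window_space_span by blast
  \<comment> \<open>Controllability continues a rest of L + 1 samples into the trajectory
    \<open>w\<close>; the register of the joined trajectory starts at 0 and arrives at the given
    window.\<close>
  have reachR: "\<exists>u N. run A B 0 u N = s" if "s \<in> R" for s
  proof -
    obtain w where w: "w \<in> beh" "s = win L w 0" using \<open>s \<in> R\<close> by (auto simp: R_def)
    obtain v t2 where v: "v \<in> beh" "\<And>t. t \<le> L \<Longrightarrow> v t = 0" "\<And>t. v (t + t2) = w t"
      using controllable_from_rest[OF con w(1), of L] by metis
    have "win L v 0 = 0" using v(2) by (auto simp: win_def fun_eq_iff)
    then have "run A B 0 (\<lambda>t. v (t + L)) t2 = win L v t2"
      unfolding A_def[abs_def] B_def[abs_def] using reach_windows[OF cm(1,4) v(1)] by blast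
    also have "\<dots> = s" using v(3) by (auto simp: w(2) win_eq_iff add.commute)
    finally show ?thesis by blast
  qed
  have nz: "b1 (win L w0 0) + b2 (w0 L) \<noteq> 0"
    using w0 cm(4)[OF w0(1), of 0] by (simp add: b1_def b2_def linear_add[OF lin_r, symmetric] linear_add[OF cm(1), symmetric])
  let ?A = "\<lambda>\<phi> \<theta> x. A x + (\<phi> x + \<theta> * b1 x) *\<^sub>R g0" and ?B = "\<lambda>\<theta> v. B v + (\<theta> * b2 v) *\<^sub>R g0"
  obtain \<phi> where \<phi>: "linear \<phi>" "\<And>r. r \<in> R \<Longrightarrow> \<phi> r = 0"
    "finite {\<theta>. \<not> (\<exists>N. \<forall>s\<in>S. \<exists>u. run (?A \<phi> \<theta>) (?B \<theta>) 0 u N = s)}"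
  proof (rule generic_feedback[OF linA linB lin1 lin2 subR AR BR S_def F(1)])
    show "S \<subseteq> span F" using S_win F(2) by blast
    show "\<exists>u N. run A B 0 u N = s" if "s \<in> R" for s by (rule reachR[OF that])
    show "win L w0 0 \<in> R" by (rule R_win[OF w0(1)])
    show "b1 (win L w0 0) + b2 (w0 L) \<noteq> 0" by (rule nz)
  qed (rule that)
  define bad where "bad = {\<theta>. \<not> (\<exists>N. \<forall>s\<in>S. \<exists>u. run (?A \<phi> \<theta>) (?B \<theta>) 0 u N = s)}"
  show ?thesis
  proof (rule that[of bad])
    show "finite bad" using \<phi>(3) by (simp add: bad_def)
    fix \<theta> assume \<theta>: "\<theta> \<notin> bad"
    \<comment> \<open>\<open>\<phi>\<close> looks only at the past window and vanishes on
      \<open>R\<close>, so a true past sees no change except the term with \<open>r\<close>. Outside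
      of \<open>R\<close> it supplies the poles that make \<open>S\<close> reachable.\<close>
    define c where "c x = cm x + (\<phi> (win L x 0) + \<theta> * r (cm x)) *\<^sub>R unit_win L m" for x
    have lin_c: "linear c"
      unfolding c_def[abs_def]
      by (rule linearI) (simp_all add: linear_add[OF cm(1)] linear_add[OF lin_r] linear_add[OF \<phi>(1)]
        linear_add[OF linear_win] linear_scale[OF cm(1)] linear_scale[OF lin_r] linear_scale[OF \<phi>(1)]
        linear_scale[OF linear_win] algebra_simps)
    have win_S: "win L s 0 = s" if "s \<in> S" for s
      using that S_win by (auto simp: win_def window_space_def fun_eq_iff)
    have win_slot: "win L (in_slot m L u) 0 = 0" for u
      by (auto simp: win_def in_slot_def fun_eq_iff)
    have drop_s: "drop_first L (c s) = A s + (\<phi> s + \<theta> * b1 s) *\<^sub>R g0" if "s \<in> S" for s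
      using win_S[OF that]
      by (simp add: c_def A_def b1_def g0_def linear_add[OF linear_drop_first] linear_scale[OF linear_drop_first])
    have drop_u: "drop_first L (c (in_slot m L u)) = B u + (\<theta> * b2 u) *\<^sub>R g0" for u
      by (simp add: c_def B_def b2_def g0_def win_slot linear_0[OF \<phi>(1)] linear_add[OF linear_drop_first]
          linear_scale[OF linear_drop_first])
    have subS: "subspace S" unfolding S_def by (rule subspace_span)
    have A'S: "A s + (\<phi> s + \<theta> * b1 s) *\<^sub>R g0 \<in> S" if "s \<in> S" for s
      using AS that g0_S by (intro subspace_add[OF subS] subspace_scale[OF subS]) auto
    have B'S: "B u + (\<theta> * b2 u) *\<^sub>R g0 \<in> S" for u
      using BR R_S g0_S by (intro subspace_add[OF subS] subspace_scale[OF subS]) auto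
    interpret P: window_law m q L S c
    proof (rule window_law.intro)
      show "c x j i = x j i" if "j < L \<or> j = L \<and> i < m" for x j i
        using cm(2)[OF that] that by (auto simp: c_def unit_win_def)
      show "c x j i = 0" if "L < j \<or> j = L \<and> q \<le> i" for x j i
        using cm(3)[OF that] that mq by (auto simp: c_def unit_win_def)
    qed (use mq lin_c subS S_win A'S B'S in \<open>simp_all add: drop_s drop_u\<close>)
    obtain N where N: "\<And>s. s \<in> S \<Longrightarrow> \<exists>u. run (?A \<phi> \<theta>) (?B \<theta>) 0 u N = s"
      using \<theta> by (auto simp: bad_def)
    have reach: "\<exists>u. run P.fW P.gW 0 u N = s" if s: "s \<in> S" for s
    proof -
      have "run P.fW P.gW 0 u N = run (?A \<phi> \<theta>) (?B \<theta>) 0 u N" for u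
        by (rule run_cong_on[of _ S]) (use subspace_0[OF subS] A'S B'S subS drop_s drop_u in auto)
      then show ?thesis using N[OF s] by simp
    qed
    have step: "win (Suc L) w' t = win (Suc L) w t + (\<theta> * r (win (Suc L) w t)) *\<^sub>R unit_win L m"
      if w: "w \<in> beh" and w': "w' \<in> P.beh" and eq: "win L w' t = win L w t" "\<And>i. i < m \<Longrightarrow> w' (t + L) i = w (t + L) i" for w w' t
    proof -
      have "in_slot m L (w' (t + L)) = in_slot m L (w (t + L))"
        using eq(2) by (auto simp: in_slot_def fun_eq_iff)
      then have "win (Suc L) w' t = c (win L w t + in_slot m L (w (t + L)))"
        using P.beh_window(2)[OF w', of t] eq(1) by simp
      moreover have "win L (win L w t + in_slot m L (w (t + L))) 0 = win L w t"
        by (auto simp: win_def in_slot_def fun_eq_iff)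
      ultimately show ?thesis
        using cm(4)[OF w, of t] \<phi>(2)[OF R_win[OF w, of t]] by (simp add: c_def)
    qed
    have start: "\<exists>w'\<in>P.beh. win L w' 0 = win L w 0 \<and> (\<forall>t i. L \<le> t \<longrightarrow> i < m \<longrightarrow> w' t i = w t i)"
      if w: "w \<in> beh" for w
    proof -
      have "win L w 0 \<in> S" using R_win[OF w] R_S by blast
      then show ?thesis using P.beh_start[of "win L w 0" w] reach by metis
    qed
    \<comment> \<open>The perturbed trajectory starts with the same register and receives the same
      inputs; as long as \<open>r\<close> vanishes on the current window, the completed sample is
      the same.\<close>
    have data: "\<exists>w'\<in>P.beh. \<forall>t<T. w' t = w t"
      if w: "w \<in> beh" and rz: "\<And>t. t + L < T \<Longrightarrow> r (win (Suc L) w t) = 0" for w T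
    proof -
      obtain w' where w': "w' \<in> P.beh" "win L w' 0 = win L w 0" "\<And>t i. L \<le> t \<Longrightarrow> i < m \<Longrightarrow> w' t i = w t i"
        using start[OF w] by blast
      have "w' t = w t" if "t < T" for t
        using that
      proof (induct t rule: less_induct)
        case (less t)
        show ?case
        proof (cases "t < L")
          case True
          then show ?thesis using w'(2) by (auto simp: win_eq_iff)
        next
          case False
          have eq: "win L w' (t - L) = win L w (t - L)"
            using less False by (auto simp: win_eq_iff)
          have "win (Suc L) w' (t - L) = win (Suc L) w (t - L)"
            using step[OF w w'(1) eq] w'(3) rz[of "t - L"] False less.prems by simp
          then have "w' (t - L + L) = w (t - L + L)" by (simp add: win_eq_iff)
          then show ?thesis using False by simp
        qed
      qed
      then show ?thesis using w'(1) by blast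
    qed
    have test: "\<exists>w'\<in>P.beh. win (Suc L) w' 0 = win (Suc L) w 0 + (\<theta> * r (win (Suc L) w 0)) *\<^sub>R unit_win L m"
      if w: "w \<in> beh" for w
    proof -
      obtain w' where w': "w' \<in> P.beh" "win L w' 0 = win L w 0" "\<And>t i. L \<le> t \<Longrightarrow> i < m \<Longrightarrow> w' t i = w t i"
        using start[OF w] by blast
      then show ?thesis using step[OF w w'(1,2)] by auto
    qed
    have pert: "perturbation L r \<theta> P.beh"
      unfolding perturbation_def using data test by blast
    show "\<exists>(S :: (nat \<Rightarrow> nat \<Rightarrow> real) set) f' g' h' k' F. io_sys m q S f' g' h' k' \<and> finite F \<and>
      S \<subseteq> span F \<and> lag_le L S f' h' \<and> sig_controllable (io_sys.beh S f' g' h' k') \<and>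
      perturbation L r \<theta> (io_sys.beh S f' g' h' k')"
      by (rule exI[of _ S], rule exI[of _ P.fW], rule exI[of _ P.gW], rule exI[of _ P.hW], rule exI[of _ P.kW],
          rule exI[of _ F])
        (use P.io_sys_axioms F S_win P.lag_window P.reach_imp_controllable[OF reach] pert in blast)
  qed
qed

section \<open>Translation from matrices\<close>

definition vec_fun :: "real vec \<Rightarrow> nat \<Rightarrow> real" where
  "vec_fun v = (\<lambda>i. if i < dim_vec v then v $ i else 0)"

definition mat_fun :: "real mat \<Rightarrow> (nat \<Rightarrow> real) \<Rightarrow> nat \<Rightarrow> real" where
  "mat_fun A x = (\<lambda>i. if i < dim_row A then (\<Sum>j<dim_col A. A $$ (i, j) * x j) else 0)"

definition std_state :: "nat \<Rightarrow> (nat \<Rightarrow> real) set" where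
  "std_state n = {x. \<forall>i\<ge>n. x i = 0}"

definition out_map :: "nat \<Rightarrow> real mat \<Rightarrow> (nat \<Rightarrow> real) \<Rightarrow> nat \<Rightarrow> real" where
  "out_map m C x = (\<lambda>i. if i < m then 0 else mat_fun C x (i - m))"

definition feed_map :: "nat \<Rightarrow> real mat \<Rightarrow> (nat \<Rightarrow> real) \<Rightarrow> nat \<Rightarrow> real" where
  "feed_map m D u = (\<lambda>i. if i < m then u i else mat_fun D u (i - m))"

definition signal :: "nat \<Rightarrow> (nat \<Rightarrow> real vec) \<Rightarrow> nat \<Rightarrow> nat \<Rightarrow> real" where
  "signal q w = (\<lambda>t i. if i < q then w t $ i else 0)"

text \<open>The link between behaviors of carrier vectors and systems on function spaces. The state
  type is left open, because states occur as tuples (from matrices), as output sequences (for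
  observability) and as windows (for the perturbed systems).\<close>

definition models :: "nat \<Rightarrow> nat \<Rightarrow> (nat \<Rightarrow> real vec) set \<Rightarrow> 'x::real_vector set \<Rightarrow> ('x \<Rightarrow> 'x) \<Rightarrow> ((nat \<Rightarrow> real) \<Rightarrow> 'x)
    \<Rightarrow> ('x \<Rightarrow> nat \<Rightarrow> real) \<Rightarrow> ((nat \<Rightarrow> real) \<Rightarrow> nat \<Rightarrow> real) \<Rightarrow> bool" where
  "models m p Bh E f g h k \<longleftrightarrow> io_sys m (m + p) E f g h k \<and>
     Bh = {w. (\<forall>t. w t \<in> carrier_vec (m + p)) \<and> signal (m + p) w \<in> io_sys.beh E f g h k}"

lemma linear_mat_fun: "linear (mat_fun A)"
  by (rule linearI) (auto simp: mat_fun_def fun_eq_iff algebra_simps sum.distrib sum_distrib_left)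

lemma mat_fun_cong: "(\<And>j. j < dim_col A \<Longrightarrow> x j = y j) \<Longrightarrow> mat_fun A x = mat_fun A y"
  by (auto simp: mat_fun_def fun_eq_iff)

lemma vec_fun_mult_mat_vec: "dim_vec v = dim_col A \<Longrightarrow> vec_fun (A *\<^sub>v v) = mat_fun A (vec_fun v)"
  by (auto simp: vec_fun_def mat_fun_def fun_eq_iff scalar_prod_def lessThan_atLeast0 intro!: sum.cong)

lemma vec_fun_add: "dim_vec v = dim_vec w \<Longrightarrow> vec_fun (v + w) = vec_fun v + vec_fun w"
  by (auto simp: vec_fun_def fun_eq_iff)

lemma vec_fun_inj: "dim_vec v = dim_vec w \<Longrightarrow> vec_fun v = vec_fun w \<Longrightarrow> v = w"
  by (rule eq_vecI) (auto simp: vec_fun_def dest!: fun_cong split: if_splits)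

lemma vec_fun_vec: "x \<in> std_state n \<Longrightarrow> vec_fun (vec n x) = x"
  by (auto simp: vec_fun_def std_state_def fun_eq_iff)

lemma subspace_std_state: "subspace (std_state n)"
  by (auto simp: std_state_def subspace_def)

lemma mat_fun_std_state: "mat_fun A x \<in> std_state (dim_row A)"
  by (auto simp: mat_fun_def std_state_def)

lemma io_sys_matrices:
  assumes "is_ss_rep m p n A B C D"
  shows "io_sys m (m + p) (std_state n) (mat_fun A) (mat_fun B) (out_map m C) (feed_map m D)"
proof (rule io_sys.intro)
  show "linear (out_map m C)"
    by (rule linearI) (auto simp: out_map_def fun_eq_iff linear_add[OF linear_mat_fun] linear_scale[OF linear_mat_fun])
  show "linear (feed_map m D)"
    by (rule linearI) (auto simp: feed_map_def fun_eq_iff linear_add[OF linear_mat_fun] linear_scale[OF linear_mat_fun])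
  show "mat_fun B u = mat_fun B v" if "\<And>i. i < m \<Longrightarrow> u i = v i" for u v
    by (rule mat_fun_cong) (use that assms in \<open>auto simp: is_ss_rep_def\<close>)
  show "feed_map m D u = feed_map m D v" if "\<And>i. i < m \<Longrightarrow> u i = v i" for u v
  proof -
    have "mat_fun D u = mat_fun D v"
      by (rule mat_fun_cong) (use that assms in \<open>auto simp: is_ss_rep_def\<close>)
    then show ?thesis using that by (auto simp: feed_map_def fun_eq_iff)
  qed
  show "mat_fun A ` std_state n \<subseteq> std_state n" "range (mat_fun B) \<subseteq> std_state n"
    using assms mat_fun_std_state[of A] mat_fun_std_state[of B] by (auto simp: is_ss_rep_def)
qed (use assms in \<open>auto simp: linear_mat_fun subspace_std_state is_ss_rep_def out_map_def feed_map_def mat_fun_def\<close>)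

lemma models_rep:
  assumes rep: "is_rep_of m p Bh n A B C D"
  shows "models m p Bh (std_state n) (mat_fun A) (mat_fun B) (out_map m C) (feed_map m D)"
proof -
  have ss: "is_ss_rep m p n A B C D" and Bh: "Bh = ss_behavior m p A B C D"
    using rep by (auto simp: is_rep_of_def)
  have dims: "A \<in> carrier_mat n n" "B \<in> carrier_mat n m" "C \<in> carrier_mat p n" "D \<in> carrier_mat p m"
    using ss by (auto simp: is_ss_rep_def)
  interpret io_sys m "m + p" "std_state n" "mat_fun A" "mat_fun B" "out_map m C" "feed_map m D"
    by (rule io_sys_matrices[OF ss])
  have u: "mat_fun M (vec_fun (sig_u m w t)) = mat_fun M (signal (m + p) w t)" if "dim_col M = m" for M w t
    by (rule mat_fun_cong) (use that in \<open>auto simp: vec_fun_def sig_u_def signal_def\<close>)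
  have fwd: "signal (m + p) w \<in> beh" if w: "w \<in> ss_behavior m p A B C D" for w
  proof -
    obtain x where x: "\<And>t. x t \<in> carrier_vec n" "\<And>t. x (Suc t) = A *\<^sub>v x t + B *\<^sub>v sig_u m w t"
      "\<And>t. sig_y m p w t = C *\<^sub>v x t + D *\<^sub>v sig_u m w t"
      using w dims by (auto simp: ss_behavior_def)
    have X: "vec_fun (x t) = run (mat_fun A) (mat_fun B) (vec_fun (x 0)) (signal (m + p) w) t" for t
    proof (induct t)
      case (Suc t)
      have "vec_fun (x (Suc t)) = mat_fun A (vec_fun (x t)) + mat_fun B (vec_fun (sig_u m w t))"
        unfolding x(2) using dims x(1)[of t]
        by (subst vec_fun_add) (auto simp: vec_fun_mult_mat_vec sig_u_def)
      moreover have "mat_fun B (vec_fun (sig_u m w t)) = mat_fun B (signal (m + p) w t)" using dims by (intro u) auto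
      ultimately show ?case using Suc by (simp only: run.simps)
    qed simp
    have "rsp (vec_fun (x 0)) (signal (m + p) w) t i = signal (m + p) w t i" for t i
    proof -
      have "vec_fun (sig_y m p w t) = mat_fun C (vec_fun (x t)) + mat_fun D (vec_fun (sig_u m w t))"
        unfolding x(3) using dims x(1)[of t]
        by (subst vec_fun_add) (auto simp: vec_fun_mult_mat_vec sig_u_def)
      then have Y: "vec_fun (sig_y m p w t) = mat_fun C (vec_fun (x t)) + mat_fun D (signal (m + p) w t)"
        using u[of D w t] dims by auto
      have "rsp (vec_fun (x 0)) (signal (m + p) w) t i = out_map m C (vec_fun (x t)) i + feed_map m D (signal (m + p) w t) i"
        by (simp add: resp_def X[symmetric])
      also have "\<dots> = (if i < m then signal (m + p) w t i else vec_fun (sig_y m p w t) (i - m))"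
        by (simp add: Y out_map_def feed_map_def)
      also have "\<dots> = signal (m + p) w t i"
        by (auto simp: vec_fun_def sig_y_def signal_def)
      finally show ?thesis .
    qed
    then have "rsp (vec_fun (x 0)) (signal (m + p) w) = signal (m + p) w" by (simp add: fun_eq_iff)
    moreover have "vec_fun (x 0) \<in> std_state n" using x(1)[of 0] by (auto simp: vec_fun_def std_state_def)
    ultimately show ?thesis unfolding beh_def by blast
  qed
  have bwd: "w \<in> ss_behavior m p A B C D" if w: "\<And>t. w t \<in> carrier_vec (m + p)" "signal (m + p) w \<in> beh" for w
  proof -
    obtain x where x: "x \<in> std_state n" "rsp x (signal (m + p) w) = signal (m + p) w"
      using w(2) by (auto simp: beh_def)
    define X where "X t = run (mat_fun A) (mat_fun B) x (signal (m + p) w) t" for t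
    have XE: "X t \<in> std_state n" for t unfolding X_def by (rule run_E[OF x(1)])
    have f1: "vec_fun (M *\<^sub>v vec n (X t) + N *\<^sub>v sig_u m w t) = mat_fun M (X t) + mat_fun N (signal (m + p) w t)"
      if "M \<in> carrier_mat r n" "N \<in> carrier_mat r m" for M N r t
      using that u[of N w t] vec_fun_vec[OF XE[of t]]
      by (subst vec_fun_add) (auto simp: vec_fun_mult_mat_vec sig_u_def)
    have "vec n (X (Suc t)) = A *\<^sub>v vec n (X t) + B *\<^sub>v sig_u m w t" for t
    proof (rule vec_fun_inj)
      have "X (Suc t) = mat_fun A (X t) + mat_fun B (signal (m + p) w t)" by (simp only: X_def run.simps)
      then show "vec_fun (vec n (X (Suc t))) = vec_fun (A *\<^sub>v vec n (X t) + B *\<^sub>v sig_u m w t)"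
        using dims f1[of A n B t] vec_fun_vec[OF XE, of "Suc t"] by simp
    qed (use dims in auto)
    moreover have "sig_y m p w t = C *\<^sub>v vec n (X t) + D *\<^sub>v sig_u m w t" for t
    proof (rule vec_fun_inj)
      show "dim_vec (sig_y m p w t) = dim_vec (C *\<^sub>v vec n (X t) + D *\<^sub>v sig_u m w t)"
        using dims by (simp add: sig_y_def)
      have "vec_fun (sig_y m p w t) i = (mat_fun C (X t) + mat_fun D (signal (m + p) w t)) i" for i
      proof (cases "i < p")
        case True
        have "signal (m + p) w t (m + i) = rsp x (signal (m + p) w) t (m + i)" by (simp add: x(2))
        also have "\<dots> = mat_fun C (X t) i + mat_fun D (signal (m + p) w t) i"
          by (simp add: resp_def X_def out_map_def feed_map_def)
        finally show ?thesis using True by (simp add: vec_fun_def sig_y_def signal_def)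
      next
        case False
        then show ?thesis using dims by (simp add: vec_fun_def sig_y_def mat_fun_def)
      qed
      then show "vec_fun (sig_y m p w t) = vec_fun (C *\<^sub>v vec n (X t) + D *\<^sub>v sig_u m w t)"
        using f1[of C p D t] dims by (simp add: fun_eq_iff)
    qed
    ultimately show ?thesis
      unfolding ss_behavior_def using w(1) dims by (auto intro!: exI[of _ "\<lambda>t. vec n (X t)"])
  qed
  have "Bh = {w. (\<forall>t. w t \<in> carrier_vec (m + p)) \<and> signal (m + p) w \<in> beh}"
  proof (intro equalityI subsetI)
    fix w assume "w \<in> Bh"
    then show "w \<in> {w. (\<forall>t. w t \<in> carrier_vec (m + p)) \<and> signal (m + p) w \<in> beh}"
      using fwd[of w] by (simp add: Bh) (simp add: ss_behavior_def)
  qed (use bwd Bh in auto)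
  then show ?thesis
    unfolding models_def using io_sys_axioms by blast
qed

text \<open>Coordinates with respect to \<open>Bs\<close> yield the four matrices, so the state
  dimension of any model is an upper bound for \<open>n_of\<close>.\<close>

lemma rep_models:
  fixes E :: "'x::real_vector set"
  assumes mo: "models m p Bh E f g h k" and Bs: "finite Bs" "independent Bs" "E = span Bs"
  shows "\<exists>A B C D. is_rep_of m p Bh (card Bs) A B C D"
proof -
  interpret io_sys m "m + p" E f g h k using mo by (simp add: models_def)
  obtain bs where bs: "set bs = Bs" "distinct bs"
    using finite_distinct_list[OF Bs(1)] by blast
  define n where "n = card Bs"
  have n: "length bs = n" using bs distinct_card n_def by metis
  have "\<exists>c::'x \<Rightarrow> real. linear c \<and> (\<forall>b\<in>Bs. c b = (if b = bs ! i then 1 else 0))" for i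
    using linear_independent_extend[OF Bs(2), of "\<lambda>b. if b = bs ! i then 1 else 0"] .
  then obtain co :: "nat \<Rightarrow> 'x \<Rightarrow> real" where co: "\<And>i. linear (co i)" "\<And>i b. b \<in> Bs \<Longrightarrow> co i b = (if b = bs ! i then 1 else 0)"
    by metis
  define emb where "emb x = (\<Sum>j<n. x j *\<^sub>R bs ! j)" for x :: "nat \<Rightarrow> real"
  have bsE: "bs ! j \<in> E" if "j < n" for j
    unfolding Bs(3) using that bs n by (auto intro: span_base)
  have embE: "emb x \<in> E" for x
    unfolding emb_def using bsE by (intro subspace_sum[OF E(1)] subspace_scale[OF E(1)]) auto
  have emb_co: "emb (\<lambda>i. if i < n then co i x else 0) = x" if x: "x \<in> E" for x
  proof -
    have lin_e: "linear (\<lambda>x. emb (\<lambda>i. if i < n then co i x else 0))"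
      unfolding emb_def
      by (rule linearI) (simp_all add: linear_add[OF co(1)] linear_scale[OF co(1)] scaleR_add_left sum.distrib scaleR_sum_right)
    show ?thesis
    proof (rule linear_eq_on_span[OF lin_e linear_ident])
      show "x \<in> span Bs" using x Bs(3) by simp
      fix b assume "b \<in> Bs"
      then obtain l where l: "l < n" "b = bs ! l" using bs(1) n by (metis in_set_conv_nth)
      have "co j b *\<^sub>R bs ! j = (if j = l then b else 0)" if "j < n" for j
        using co(2)[OF \<open>b \<in> Bs\<close>, of j] nth_eq_iff_index_eq[OF bs(2), of j l] that l n by auto
      then have "emb (\<lambda>i. if i < n then co i b else 0) = (\<Sum>j<n. if j = l then b else 0)"
        unfolding emb_def by (intro sum.cong) auto
      then show "emb (\<lambda>i. if i < n then co i b else 0) = b" using l by simp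
    qed
  qed
  define e :: "nat \<Rightarrow> nat \<Rightarrow> real" where "e j = (\<lambda>i. if i = j then 1 else 0)" for j
  have e_sum: "(\<Sum>j<m. u j *\<^sub>R e j) i = u i" if "i < m" for u :: "nat \<Rightarrow> real" and i
  proof -
    have "(\<Sum>j<m. u j *\<^sub>R e j) i = (\<Sum>j<m. if j = i then u j else 0)"
      unfolding sum_fun_apply by (rule sum.cong) (auto simp: e_def)
    then show ?thesis using that by simp
  qed
  define A where "A = mat n n (\<lambda>(i, j). co i (f (bs ! j)))"
  define B where "B = mat n m (\<lambda>(i, j). co i (g (e j)))"
  define C where "C = mat p n (\<lambda>(i, j). h (bs ! j) (m + i))"
  define D where "D = mat p m (\<lambda>(i, j). k (e j) (m + i))"
  have ss: "is_ss_rep m p n A B C D" by (simp add: is_ss_rep_def A_def B_def C_def D_def)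
  interpret M: io_sys m "m + p" "std_state n" "mat_fun A" "mat_fun B" "out_map m C" "feed_map m D"
    by (rule io_sys_matrices[OF ss])
  have A': "emb (mat_fun A x) = f (emb x)" for x
  proof -
    have "mat_fun A x = (\<lambda>i. if i < n then co i (f (emb x)) else 0)"
      by (auto simp: mat_fun_def A_def emb_def fun_eq_iff linear_sum[OF lin_f] linear_scale[OF lin_f]
          linear_sum[OF co(1)] linear_scale[OF co(1)] mult.commute intro!: sum.cong)
    then show ?thesis using emb_co[of "f (emb x)"] E(2) embE[of x] by auto
  qed
  have B': "emb (mat_fun B u) = g u" for u
  proof -
    have "g u = g (\<Sum>j<m. u j *\<^sub>R e j)" by (rule g_cong) (simp add: e_sum)
    then have "mat_fun B u = (\<lambda>i. if i < n then co i (g u) else 0)"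
      by (auto simp: mat_fun_def B_def fun_eq_iff linear_sum[OF lin_g] linear_scale[OF lin_g]
          linear_sum[OF co(1)] linear_scale[OF co(1)] mult.commute intro!: sum.cong)
    then show ?thesis using emb_co[of "g u"] E(3) by auto
  qed
  have C': "out_map m C x = h (emb x)" for x
  proof
    fix i
    consider "i < m" | "m \<le> i" "i < m + p" | "m + p \<le> i" by linarith
    then show "out_map m C x i = h (emb x) i"
    proof cases
      case 2
      then show ?thesis
        by (auto simp: out_map_def mat_fun_def C_def emb_def linear_sum[OF lin_h] linear_scale[OF lin_h] sum_fun_apply
            mult.commute intro!: sum.cong)
    qed (auto simp: out_map_def mat_fun_def C_def h_in[OF embE] h_out[OF embE])
  qed
  have D': "feed_map m D u = k u" for u
  proof
    fix i
    have "k u = k (\<Sum>j<m. u j *\<^sub>R e j)" by (rule k_cong) (simp add: e_sum)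
    consider "i < m" | "m \<le> i" "i < m + p" | "m + p \<le> i" by linarith
    then show "feed_map m D u i = k u i"
    proof cases
      case 2
      then show ?thesis
        unfolding \<open>k u = k (\<Sum>j<m. u j *\<^sub>R e j)\<close>
        by (auto simp: feed_map_def mat_fun_def D_def linear_sum[OF lin_k] linear_scale[OF lin_k] sum_fun_apply
            mult.commute intro!: sum.cong)
    qed (auto simp: feed_map_def mat_fun_def D_def k_in k_out)
  qed
  have "emb (run (mat_fun A) (mat_fun B) x u t) = run f g (emb x) u t" for x u t
  proof (induct t)
    case (Suc t)
    have "emb (x + y) = emb x + emb y" for x y
      by (simp add: emb_def scaleR_add_left sum.distrib)
    with Suc show ?case by (simp only: run.simps A' B')
  qed simp
  then have rsp_eq: "M.rsp x u = rsp (emb x) u" for x u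
    by (simp add: resp_def fun_eq_iff C' D')
  have "M.beh = beh"
  proof (intro equalityI subsetI)
    fix w assume "w \<in> M.beh"
    then show "w \<in> beh" unfolding M.beh_def beh_def using rsp_eq embE by fastforce
  next
    fix w assume "w \<in> beh"
    then obtain x where x: "x \<in> E" "rsp x w = w" by (auto simp: beh_def)
    then have "M.rsp (\<lambda>i. if i < n then co i x else 0) w = w"
      by (simp add: rsp_eq emb_co)
    moreover have "(\<lambda>i. if i < n then co i x else 0) \<in> std_state n" by (simp add: std_state_def)
    ultimately show "w \<in> M.beh" unfolding M.beh_def by blast
  qed
  then have "Bh = ss_behavior m p A B C D"
    using models_rep[of m p "ss_behavior m p A B C D" n A B C D] ss mo
    by (simp add: models_def is_rep_of_def)
  then show ?thesis using ss by (auto simp: is_rep_of_def n_def)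
qed

section \<open>Matrix rank as the dimension of a range\<close>

lemma lin_dep_iff_dependent:
  assumes T: "finite T" "T \<subseteq> carrier_vec N"
  shows "module.lin_dep class_ring (module_vec TYPE(real) N) T \<longleftrightarrow> dependent (vec_fun ` T)"
proof -
  interpret vec_space "TYPE(real)" N .
  have dT: "dim_vec v = N" if "v \<in> T" for v using that T(2) by auto
  have inj: "inj_on vec_fun T"
    by (intro inj_onI vec_fun_inj) (simp_all add: dT)
  have lc: "vec_fun (lincomb a T) = (\<Sum>v\<in>T. a v *\<^sub>R vec_fun v)" for a
  proof
    fix i
    have "dim_vec (lincomb a T) = N" by (rule lincomb_dim[OF T])
    moreover have "dim_vec v = N" if "v \<in> T" for v using that T(2) by auto
    ultimately show "vec_fun (lincomb a T) i = (\<Sum>v\<in>T. a v *\<^sub>R vec_fun v) i"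
      using lincomb_index[OF _ T(2), of i a] by (cases "i < N") (simp_all add: vec_fun_def sum_fun_apply)
  qed
  have z: "vec_fun (0\<^sub>v N) = 0" by (auto simp: vec_fun_def fun_eq_iff)
  show ?thesis
  proof
    assume "lin_dep T"
    then obtain a v where a: "lincomb a T = 0\<^sub>v N" "v \<in> T" "a v \<noteq> 0"
      using finite_lin_dep[OF T(1) _ T(2)[folded carrier_vec_def]] T(2) by (auto simp: module_vec_simps)
    let ?b = "\<lambda>x. a (the_inv_into T vec_fun x)"
    have "(\<Sum>x\<in>vec_fun ` T. ?b x *\<^sub>R x) = (\<Sum>v\<in>T. a v *\<^sub>R vec_fun v)"
      by (subst sum.reindex[OF inj]) (auto simp: the_inv_into_f_f[OF inj] intro!: sum.cong)
    also have "\<dots> = 0" using lc[of a] a(1) z by simp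
    finally show "dependent (vec_fun ` T)"
      using a(2,3) T(1) the_inv_into_f_f[OF inj a(2)]
      by (auto simp: dependent_finite intro!: exI[of _ ?b] bexI[of _ v])
  next
    assume "dependent (vec_fun ` T)"
    then obtain b x where b: "x \<in> vec_fun ` T" "b x \<noteq> 0" "(\<Sum>x\<in>vec_fun ` T. b x *\<^sub>R x) = 0"
      using T(1) by (auto simp: dependent_finite)
    then obtain v where v: "v \<in> T" "x = vec_fun v" by blast
    have "vec_fun (lincomb (b \<circ> vec_fun) T) = vec_fun (0\<^sub>v N)"
      using b(3) by (simp add: lc z sum.reindex[OF inj])
    then have "lincomb (b \<circ> vec_fun) T = 0\<^sub>v N"
      by (intro vec_fun_inj) (simp_all add: lincomb_dim[OF T])
    then show "lin_dep T"
      using lin_dep_crit[OF T(1) order_refl, where a = "b \<circ> vec_fun" and v = v] b(2) v by (auto simp: module_vec_simps)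
  qed
qed

lemma vec_fun_col: "j < dim_col A \<Longrightarrow> vec_fun (col A j) = mat_fun A (\<lambda>i. if i = j then 1 else 0)"
proof
  fix i assume j: "j < dim_col A"
  have "(\<Sum>l<dim_col A. A $$ (i, l) * (if l = j then 1 else 0)) = (\<Sum>l<dim_col A. if l = j then A $$ (i, l) else 0)"
    by (rule sum.cong) auto
  then show "vec_fun (col A j) i = mat_fun A (\<lambda>i. if i = j then 1 else 0) i"
    using j by (simp add: vec_fun_def mat_fun_def)
qed

lemma span_cols: "span (vec_fun ` set (cols A)) = range (mat_fun A)"
proof
  have "vec_fun ` set (cols A) \<subseteq> range (mat_fun A)"
    using vec_fun_col by (auto simp: cols_def)
  then show "span (vec_fun ` set (cols A)) \<subseteq> range (mat_fun A)"
    using linear_subspace_image[OF linear_mat_fun subspace_UNIV] by (rule span_minimal)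
  show "range (mat_fun A) \<subseteq> span (vec_fun ` set (cols A))"
  proof safe
    fix x
    have "mat_fun A x = (\<Sum>j<dim_col A. x j *\<^sub>R vec_fun (col A j))"
      by (auto simp: mat_fun_def sum_fun_apply vec_fun_def fun_eq_iff mult.commute intro!: sum.cong)
    also have "\<dots> \<in> span (vec_fun ` set (cols A))"
      by (intro span_sum span_scale span_base) (auto simp: cols_def)
    finally show "mat_fun A x \<in> span (vec_fun ` set (cols A))" .
  qed
qed

lemma dim_range_mat_fun: "dim (range (mat_fun A)) = dim (vec_fun ` set (cols A))"
  unfolding span_cols[symmetric] by (rule dim_span)

text \<open>Both numbers are the size of a maximal independent set of columns; independence is
  carried from carrier vectors to functions by \<open>lin_dep_iff_dependent\<close>.\<close>

lemma rk_eq_dim: "rk A = dim (range (mat_fun A))"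
proof -
  let ?N = "dim_row A"
  let ?X = "set (cols A)"
  interpret vec_space "TYPE(real)" ?N .
  have X: "?X \<subseteq> carrier_vec ?N" using cols_dim by blast
  obtain S where S: "maximal S (\<lambda>T. T \<subseteq> ?X \<and> lin_indpt T)"
    using maximal_exists_superset[of ?X "\<lambda>T. T \<subseteq> ?X \<and> lin_indpt T" "{}"] by (auto simp: lin_dep_def)
  then have SX: "S \<subseteq> ?X" "lin_indpt S" by (auto simp: maximal_def)
  have fin: "finite S" using SX(1) finite_subset by blast
  have rk: "rk A = card S" unfolding rk_def by (rule rank_card_indpt[OF carrier_matI[OF refl refl] S])
  have dep: "lin_dep T \<longleftrightarrow> dependent (vec_fun ` T)" if "T \<subseteq> ?X" for T
    by (rule lin_dep_iff_dependent) (use that X finite_subset[OF that] in blast)+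
  have ind: "independent (vec_fun ` S)" using dep[OF SX(1)] SX(2) by blast
  have "vec_fun ` ?X \<subseteq> Real_Vector_Spaces.span (vec_fun ` S)"
  proof safe
    fix c assume c: "c \<in> ?X"
    show "vec_fun c \<in> Real_Vector_Spaces.span (vec_fun ` S)"
    proof (cases "c \<in> S")
      case False
      then have "lin_dep (insert c S)"
        using S c SX(1) unfolding maximal_def by (metis insertI1 insert_subset subset_insertI)
      then have "dependent (insert (vec_fun c) (vec_fun ` S))" using dep[of "insert c S"] c SX(1) by simp
      then show ?thesis using ind by (metis independent_insertI)
    qed (auto intro: span_base)
  qed
  then have "Real_Vector_Spaces.dim (vec_fun ` ?X) = card (vec_fun ` S)"
    using basis_card_eq_dim[of "vec_fun ` S" "vec_fun ` ?X"] SX(1) ind by (simp add: image_mono)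
  moreover have "dim_vec v = ?N" if "v \<in> S" for v using that SX(1) X by (metis carrier_vecD subsetD)
  then have "card (vec_fun ` S) = card S"
    by (intro card_image inj_onI vec_fun_inj) simp_all
  ultimately show ?thesis
    using rk dim_range_mat_fun[of A] by simp
qed

lemma finite_range_mat_fun: "\<exists>F. finite F \<and> range (mat_fun A) \<subseteq> span F"
  using span_cols[of A] by (intro exI[of _ "vec_fun ` set (cols A)"]) auto

lemma dim_image_le:
  assumes "linear T" "subspace V" "finite F" "V \<subseteq> span F"
  shows "dim (T ` V) \<le> dim V"
proof -
  obtain Bs where Bs: "Bs \<subseteq> V" "independent Bs" "V \<subseteq> span Bs" "card Bs = dim V"
    using basis_exists by metis
  have fin: "finite Bs" using independent_span_bound[OF assms(3) Bs(2)] Bs(1) assms(4) by blast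
  have "T ` V \<subseteq> span (T ` Bs)" using Bs(3) linear_span_image[OF assms(1), of Bs] by auto
  then have "dim (T ` V) \<le> card (T ` Bs)" using fin by (intro dim_le_card) auto
  also have "\<dots> \<le> card Bs" by (rule card_image_le[OF fin])
  finally show ?thesis using Bs(4) by simp
qed

text \<open>A basis of \<open>V\<close> extending a nonzero kernel vector loses a member under
  \<open>T\<close>, so the dimension drops.\<close>

lemma dim_image_eq_iff:
  assumes T: "linear T" and V: "subspace V" "finite F" "V \<subseteq> span F"
  shows "dim (T ` V) = dim V \<longleftrightarrow> (\<forall>x\<in>V. T x = 0 \<longrightarrow> x = 0)"
proof
  assume eq: "dim (T ` V) = dim V"
  show "\<forall>x\<in>V. T x = 0 \<longrightarrow> x = 0"
  proof (intro ballI impI, rule ccontr)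
    fix x assume x: "x \<in> V" "T x = 0" "x \<noteq> 0"
    obtain Bs where Bs: "{x} \<subseteq> Bs" "Bs \<subseteq> V" "independent Bs" "V \<subseteq> span Bs"
      using maximal_independent_subset_extend[of "{x}" V] x by auto
    have fin: "finite Bs" using independent_span_bound[OF V(2) Bs(3)] Bs(2) V(3) by blast
    have "T ` V \<subseteq> span (T ` Bs)" using Bs(4) linear_span_image[OF T, of Bs] by auto
    also have "T ` Bs = insert 0 (T ` (Bs - {x}))" using x(2) Bs(1) by auto
    finally have "dim (T ` V) \<le> card (T ` (Bs - {x}))" using fin by (intro dim_le_card) auto
    also have "\<dots> \<le> card (Bs - {x})" using fin by (intro card_image_le) auto
    also have "\<dots> < card Bs" using fin Bs(1) by (intro psubset_card_mono) auto
    also have "card Bs = dim V" using Bs by (intro basis_card_eq_dim)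
    finally show False using eq by simp
  qed
next
  assume inj: "\<forall>x\<in>V. T x = 0 \<longrightarrow> x = 0"
  obtain Bs where Bs: "Bs \<subseteq> V" "independent Bs" "V \<subseteq> span Bs" "card Bs = dim V"
    using basis_exists by metis
  have fin: "finite Bs" using independent_span_bound[OF V(2) Bs(2)] Bs(1) V(3) by blast
  obtain Cs where Cs: "Cs \<subseteq> T ` V" "independent Cs" "T ` V \<subseteq> span Cs" "card Cs = dim (T ` V)"
    using basis_exists by metis
  have "T ` V \<subseteq> span (T ` Bs)" using Bs(3) linear_span_image[OF T, of Bs] by auto
  then have finC: "finite Cs" using independent_span_bound[of "T ` Bs" Cs] fin Cs(1,2) by blast
  have "card Bs \<le> card Cs"
  proof (rule family_card_le[OF fin finC, of T])
    show "T ` Bs \<subseteq> span Cs" using Bs(1) Cs(3) by blast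
    fix c assume "(\<Sum>i\<in>Bs. c i *\<^sub>R T i) = 0"
    then have "T (\<Sum>i\<in>Bs. c i *\<^sub>R i) = 0" by (simp add: linear_sum[OF T] linear_scale[OF T])
    moreover have "(\<Sum>i\<in>Bs. c i *\<^sub>R i) \<in> V"
      using Bs(1) by (intro subspace_sum[OF V(1)] subspace_scale[OF V(1)]) auto
    ultimately have "(\<Sum>i\<in>Bs. c i *\<^sub>R i) = 0" using inj by blast
    then show "\<forall>i\<in>Bs. c i = 0" using Bs(2) fin by (auto simp: dependent_finite)
  qed
  then show "dim (T ` V) = dim V" using dim_image_le[OF T V] Bs(4) Cs(4) by simp
qed

lemma mat_fun_mult: "dim_col A = dim_row B \<Longrightarrow> mat_fun (A * B) x = mat_fun A (mat_fun B x)"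
proof
  fix i assume d: "dim_col A = dim_row B"
  have "(\<Sum>j<dim_col B. (\<Sum>l<dim_row B. A $$ (i, l) * B $$ (l, j)) * x j) =
        (\<Sum>l<dim_row B. A $$ (i, l) * (\<Sum>j<dim_col B. B $$ (l, j) * x j))"
    unfolding sum_distrib_left sum_distrib_right by (subst sum.swap) (simp add: mult.assoc)
  then show "mat_fun (A * B) x i = mat_fun A (mat_fun B x) i"
    using d by (simp add: mat_fun_def scalar_prod_def lessThan_atLeast0)
qed

lemma mat_fun_one: "x \<in> std_state n \<Longrightarrow> mat_fun (1\<^sub>m n) x = x"
proof
  fix i assume x: "x \<in> std_state n"
  have "(\<Sum>j<n. 1\<^sub>m n $$ (i, j) * x j) = (\<Sum>j<n. if j = i then x j else 0)" if "i < n"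
    by (rule sum.cong) (use that in auto)
  then show "mat_fun (1\<^sub>m n) x i = x i" using x by (auto simp: mat_fun_def std_state_def)
qed

lemma mat_fun_pow: "A \<in> carrier_mat n n \<Longrightarrow> x \<in> std_state n \<Longrightarrow> mat_fun (A ^\<^sub>m l) x = (mat_fun A ^^ l) x"
proof (induct l arbitrary: x)
  case 0
  then show ?case by (simp add: mat_fun_one)
next
  case (Suc l)
  have "mat_fun A x \<in> std_state n" using mat_fun_std_state[of A x] Suc(2) by auto
  then show ?case
    using Suc by (simp add: mat_fun_mult funpow_swap1)
qed

section \<open>Observability matrices and the lag\<close>

context
  fixes m p n :: nat and A C :: "real mat"
  assumes A: "A \<in> carrier_mat n n" and C: "C \<in> carrier_mat p n"
begin

lemma mat_fun_obs_mat:
  assumes "x \<in> std_state n"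
  shows "mat_fun (obs_mat k C A) x i = (if i < k * p then mat_fun C ((mat_fun A ^^ (i div p)) x) (i mod p) else 0)"
proof (cases "i < k * p")
  case True
  then have "i mod p < p" by (cases "p = 0") auto
  then have "mat_fun (obs_mat k C A) x i = mat_fun (C * A ^\<^sub>m (i div p)) x (i mod p)"
    using True A C by (simp add: mat_fun_def obs_mat_def pow_carrier_mat)
  also have "\<dots> = mat_fun C ((mat_fun A ^^ (i div p)) x) (i mod p)"
    using A C assms pow_carrier_mat[OF A, of "i div p"] by (simp add: mat_fun_mult mat_fun_pow)
  finally show ?thesis using True by simp
qed (use C in \<open>simp add: mat_fun_def obs_mat_def\<close>)

lemma obs_mat_kernel:
  assumes x: "x \<in> std_state n"
  shows "mat_fun (obs_mat k C A) x = 0 \<longleftrightarrow> (\<forall>j<k. out_map m C ((mat_fun A ^^ j) x) = 0)"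
proof
  assume z: "mat_fun (obs_mat k C A) x = 0"
  show "\<forall>j<k. out_map m C ((mat_fun A ^^ j) x) = 0"
  proof (intro allI impI ext)
    fix j i assume j: "j < k"
    show "out_map m C ((mat_fun A ^^ j) x) i = 0 i"
    proof (cases "m \<le> i \<and> i - m < p")
      case True
      have "(a + j * p) div p = j" "(a + j * p) mod p = a" if "a < p" for a using that by simp_all
      then have "((i - m) + j * p) div p = j" "((i - m) + j * p) mod p = i - m" using True by blast+
      moreover have "(i - m) + j * p < k * p"
      proof -
        have "(i - m) + j * p < p + j * p" using True by (intro add_strict_right_mono) simp
        also have "\<dots> = (j + 1) * p" by simp
        also have "\<dots> \<le> k * p" using j by (intro mult_right_mono) auto
        finally show ?thesis .
      qed
      ultimately show ?thesis
        using mat_fun_obs_mat[OF x, of k "(i - m) + j * p"] z True by (simp add: out_map_def)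
    next
      case False
      then show ?thesis using C by (auto simp: out_map_def mat_fun_def)
    qed
  qed
next
  assume z: "\<forall>j<k. out_map m C ((mat_fun A ^^ j) x) = 0"
  show "mat_fun (obs_mat k C A) x = 0"
  proof
    fix i
    show "mat_fun (obs_mat k C A) x i = 0 i"
    proof (cases "i < k * p")
      case True
      then have "i div p < k" by (simp add: less_mult_imp_div_less)
      then have "out_map m C ((mat_fun A ^^ (i div p)) x) (m + i mod p) = 0" using z by simp
      then show ?thesis using mat_fun_obs_mat[OF x, of k i] True by (simp add: out_map_def)
    qed (simp add: mat_fun_obs_mat[OF x])
  qed
qed

text \<open>Deleting the last block row maps the range of the next observability matrix onto the
  range of the present one. The ranks agree iff this map is injective, that is, iff both matrices
  have the same kernel.\<close>

lemma rk_obs_mat: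
  "rk (obs_mat k C A) \<le> rk (obs_mat (Suc k) C A)"
  "rk (obs_mat k C A) = rk (obs_mat (Suc k) C A) \<longleftrightarrow> lag_le k (std_state n) (mat_fun A) (out_map m C)"
proof -
  define tr where "tr y = (\<lambda>i. if i < k * p then y i else 0)" for y :: "nat \<Rightarrow> real"
  have lin: "linear tr" by (rule linearI) (auto simp: tr_def fun_eq_iff)
  let ?V = "range (mat_fun (obs_mat (Suc k) C A))"
  have std: "\<exists>x'\<in>std_state n. mat_fun (obs_mat l C A) x = mat_fun (obs_mat l C A) x' \<and> mat_fun (obs_mat l' C A) x = mat_fun (obs_mat l' C A) x'" for x l l'
  proof -
    have "mat_fun (obs_mat l C A) x = mat_fun (obs_mat l C A) (\<lambda>i. if i < n then x i else 0)" for l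
      by (rule mat_fun_cong) (use A in \<open>auto simp: obs_mat_def\<close>)
    then show ?thesis by (intro bexI[of _ "\<lambda>i. if i < n then x i else 0"]) (auto simp: std_state_def)
  qed
  have tr: "tr (mat_fun (obs_mat (Suc k) C A) x) = mat_fun (obs_mat k C A) x" for x
  proof -
    obtain x' where x': "x' \<in> std_state n" "mat_fun (obs_mat (Suc k) C A) x = mat_fun (obs_mat (Suc k) C A) x'"
      "mat_fun (obs_mat k C A) x = mat_fun (obs_mat k C A) x'" using std by blast
    then show ?thesis by (auto simp: tr_def mat_fun_obs_mat fun_eq_iff)
  qed
  then have im: "range (mat_fun (obs_mat k C A)) = tr ` ?V" by (auto simp: image_image)
  obtain F where F: "finite F" "?V \<subseteq> span F" using finite_range_mat_fun by blast
  have sub: "subspace ?V" by (rule linear_subspace_image[OF linear_mat_fun subspace_UNIV])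
  show "rk (obs_mat k C A) \<le> rk (obs_mat (Suc k) C A)"
    unfolding rk_eq_dim im by (rule dim_image_le[OF lin sub F])
  have "rk (obs_mat k C A) = rk (obs_mat (Suc k) C A) \<longleftrightarrow> (\<forall>x\<in>?V. tr x = 0 \<longrightarrow> x = 0)"
    unfolding rk_eq_dim im by (rule dim_image_eq_iff[OF lin sub F])
  also have "\<dots> \<longleftrightarrow> (\<forall>x. mat_fun (obs_mat k C A) x = 0 \<longrightarrow> mat_fun (obs_mat (Suc k) C A) x = 0)"
    using tr by auto
  also have "\<dots> \<longleftrightarrow> (\<forall>x\<in>std_state n. mat_fun (obs_mat k C A) x = 0 \<longrightarrow> mat_fun (obs_mat (Suc k) C A) x = 0)"
    using std by metis
  also have "\<dots> \<longleftrightarrow> lag_le k (std_state n) (mat_fun A) (out_map m C)"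
    unfolding lag_le_def using obs_mat_kernel by (auto simp: less_Suc_eq)
  finally show "rk (obs_mat k C A) = rk (obs_mat (Suc k) C A) \<longleftrightarrow> lag_le k (std_state n) (mat_fun A) (out_map m C)" .
qed

lemma lag_CA_eq: "lag_CA C A = (LEAST k. lag_le k (std_state n) (mat_fun A) (out_map m C))"
  unfolding lag_CA_def rk_obs_mat(2) ..

text \<open>The ranks increase weakly and are at most n, so they cannot increase strictly forever;
  hence the \<open>LEAST\<close> in \<open>lag_CA\<close> is attained.\<close>

lemma lag_le_lag_CA: "lag_le (lag_CA C A) (std_state n) (mat_fun A) (out_map m C)"
proof -
  have "\<exists>k. rk (obs_mat k C A) = rk (obs_mat (Suc k) C A)"
  proof (rule ccontr)
    assume "\<nexists>k. rk (obs_mat k C A) = rk (obs_mat (Suc k) C A)"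
    then have lt: "rk (obs_mat k C A) < rk (obs_mat (Suc k) C A)" for k
      using rk_obs_mat(1)[of k] by (metis le_neq_implies_less)
    have "k \<le> rk (obs_mat k C A)" for k
    proof (induct k)
      case (Suc k)
      then show ?case using lt[of k] by simp
    qed simp
    moreover have "rk (obs_mat k C A) \<le> n" for k
    proof -
      have "rk (obs_mat k C A) \<le> card (vec_fun ` set (cols (obs_mat k C A)))"
        unfolding rk_eq_dim span_cols[symmetric] by (rule dim_le_card) auto
      also have "\<dots> \<le> card (set (cols (obs_mat k C A)))" by (rule card_image_le) simp
      also have "\<dots> \<le> n" using card_length[of "cols (obs_mat k C A)"] A by (simp add: obs_mat_def)
      finally show ?thesis .
    qed
    ultimately show False by (metis not_less_eq_eq order.trans order_refl)
  qed
  then have "\<exists>k. lag_le k (std_state n) (mat_fun A) (out_map m C)" using rk_obs_mat(2) by blast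
  then show ?thesis unfolding lag_CA_eq by (rule LeastI_ex)
qed

end

text \<open>The bound for l is applied to the state reached after \<open>L - l\<close> steps, whose
  first l free outputs are among the first L of \<open>x\<close>.\<close>

lemma lag_le_mono:
  assumes "f ` E \<subseteq> E" "lag_le l E f h" "l \<le> L"
  shows "lag_le L E f h"
  unfolding lag_le_def
proof (intro ballI impI)
  fix x assume x: "x \<in> E" "\<forall>j<L. h ((f ^^ j) x) = 0"
  have "(f ^^ j) x \<in> E" for j using x(1) assms(1) by (induct j) auto
  moreover have "(f ^^ j) ((f ^^ (L - l)) x) = (f ^^ (j + (L - l))) x" for j
    by (simp add: funpow_add)
  ultimately show "h ((f ^^ L) x) = 0"
    using assms(2,3) x(2) unfolding lag_le_def by (metis add_diff_inverse_nat add_less_cancel_right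
        le_add_diff_inverse nat_less_le not_less)
qed

lemma std_state_span:
  obtains F where "finite F" "card F \<le> n" "std_state n \<subseteq> span F"
proof -
  define e :: "nat \<Rightarrow> nat \<Rightarrow> real" where "e j = (\<lambda>i. if i = j then 1 else 0)" for j
  have "x \<in> span (e ` {..<n})" if x: "x \<in> std_state n" for x
  proof -
    have "(\<Sum>j<n. x j *\<^sub>R e j) i = x i" for i
    proof -
      have "(\<Sum>j<n. x j *\<^sub>R e j) i = (\<Sum>j<n. if j = i then x j else 0)"
        unfolding sum_fun_apply by (rule sum.cong) (auto simp: e_def)
      then show ?thesis using x by (auto simp: std_state_def)
    qed
    then have "x = (\<Sum>j<n. x j *\<^sub>R e j)" by (intro ext) simp
    also have "\<dots> \<in> span (e ` {..<n})" by (intro span_sum span_scale span_base) auto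
    finally show ?thesis .
  qed
  then show ?thesis using that[of "e ` {..<n}"] card_image_le[of "{..<n}" e] by auto
qed

lemma models_beh:
  assumes mo: "models m p Bh E f g h k"
  shows "io_sys.beh E f g h k = signal (m + p) ` Bh"
proof -
  interpret io_sys m "m + p" E f g h k using mo by (simp add: models_def)
  have "w \<in> signal (m + p) ` Bh" if "w \<in> beh" for w
  proof (rule image_eqI)
    show "w = signal (m + p) (\<lambda>t. vec (m + p) (w t))"
      using beh_out[OF that] by (auto simp: signal_def fun_eq_iff)
    then show "(\<lambda>t. vec (m + p) (w t)) \<in> Bh" using mo that by (simp add: models_def)
  qed
  then show ?thesis using mo by (auto simp: models_def)
qed

lemma lag_of_rep:
  assumes "Bh \<in> L_class m p"
  shows "\<exists>n A B C D. is_rep_of m p Bh n A B C D \<and> lag_of m p Bh = lag_CA C A"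
proof -
  have "\<exists>l n A B C D. is_rep_of m p Bh n A B C D \<and> l = lag_CA C A"
    using assms by (auto simp: L_class_def)
  then show ?thesis unfolding lag_of_def by (rule someI_ex)
qed

lemma L_class_lag:
  assumes "Bh \<in> L_class m p" "lag_of m p Bh \<le> L"
  obtains E :: "(nat \<Rightarrow> real) set" and f g h k and F where
    "models m p Bh E f g h k" "lag_le L E f h" "finite F" "E \<subseteq> span F"
proof -
  obtain n A B C D where rep: "is_rep_of m p Bh n A B C D" "lag_of m p Bh = lag_CA C A"
    using lag_of_rep[OF assms(1)] by metis
  then have AC: "A \<in> carrier_mat n n" "C \<in> carrier_mat p n"
    by (auto simp: is_rep_of_def is_ss_rep_def)
  have mo: "models m p Bh (std_state n) (mat_fun A) (mat_fun B) (out_map m C) (feed_map m D)"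
    by (rule models_rep[OF rep(1)])
  then have "mat_fun A ` std_state n \<subseteq> std_state n"
    by (auto simp: models_def dest!: io_sys.E(2))
  then have "lag_le L (std_state n) (mat_fun A) (out_map m C)"
    using lag_le_mono lag_le_lag_CA[OF AC, of m] assms(2) rep(2) by metis
  moreover obtain F where "finite F" "std_state n \<subseteq> span F" using std_state_span by blast
  ultimately show ?thesis using mo that by blast
qed

text \<open>The representation behind \<open>lag_of\<close> is selected by \<open>SOME\<close>, so
  the bound has to pass through the behavior: free responses of that representation are trajectories
  of the given model, to which \<open>lag_step\<close> applies.\<close>

lemma lag_of_le:
  assumes mo: "models m p Bh E f g h k" and lag: "lag_le L E f h" and Lc: "Bh \<in> L_class m p"
  shows "lag_of m p Bh \<le> L"
proof -
  obtain n A B C D where rep: "is_rep_of m p Bh n A B C D" "lag_of m p Bh = lag_CA C A"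
    using lag_of_rep[OF Lc] by metis
  then have AC: "A \<in> carrier_mat n n" "C \<in> carrier_mat p n"
    by (auto simp: is_rep_of_def is_ss_rep_def)
  note mo' = models_rep[OF rep(1)]
  interpret S: io_sys m "m + p" E f g h k using mo by (simp add: models_def)
  interpret M: io_sys m "m + p" "std_state n" "mat_fun A" "mat_fun B" "out_map m C" "feed_map m D"
    using mo' by (simp add: models_def)
  have "lag_le L (std_state n) (mat_fun A) (out_map m C)"
    unfolding lag_le_def
  proof (intro ballI impI)
    fix x assume x: "x \<in> std_state n" "\<forall>j<L. out_map m C ((mat_fun A ^^ j) x) = 0"
    have "M.rsp x (\<lambda>s. 0) L = 0"
    proof (rule S.lag_step[OF lag])
      show "M.rsp x (\<lambda>s. 0) \<in> S.beh" 
        using M.resp_beh[OF x(1)] unfolding models_beh[OF mo] models_beh[OF mo'] .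
      show "M.rsp x (\<lambda>s. 0) s = 0" if "s < L" for s using x(2) that by (simp add: M.resp_free)
      show "M.rsp x (\<lambda>s. 0) L i = 0" if "i < m" for i using M.resp_in[OF x(1) that] by simp
    qed
    then show "out_map m C ((mat_fun A ^^ L) x) = 0" by (simp add: M.resp_free)
  qed
  then show ?thesis unfolding rep(2) lag_CA_eq[OF AC, of m] by (rule Least_le)
qed

lemma signal_cong: "w t = w' t' \<Longrightarrow> signal q w t = signal q w' t'"
  by (simp only: signal_def)

lemma signal_inj:
  assumes "w t \<in> carrier_vec q" "w' t' \<in> carrier_vec q" "signal q w t = signal q w' t'"
  shows "w t = w' t'"
proof (rule eq_vecI)
  fix i assume "i < dim_vec (w' t')"
  then show "w t $ i = w' t' $ i"
    using assms(2) fun_cong[OF assms(3), of i] by (simp add: signal_def)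
qed (use assms in simp)

lemma models_controllable:
  assumes mo: "models m p Bh E f g h k"
  shows "controllable Bh \<longleftrightarrow> sig_controllable (io_sys.beh E f g h k)"
proof -
  have c: "w t \<in> carrier_vec (m + p)" if "w \<in> Bh" for w t
    using mo that by (simp add: models_def)
  have iff: "signal (m + p) v t = signal (m + p) w s \<longleftrightarrow> v t = w s" if "v \<in> Bh" "w \<in> Bh" for v w t s
    using signal_inj[of v t "m + p" w s, OF c[OF that(1)] c[OF that(2)]] signal_cong by blast
  show ?thesis
    unfolding controllable_def sig_controllable_def models_beh[OF mo]
    by (simp add: iff cong: ball_cong_simp bex_cong_simp)
qed

section \<open>Dimensions of window spaces\<close>

lemma dim_mono_finite:
  assumes "V \<subseteq> W" "finite F" "W \<subseteq> span F"
  shows "dim V \<le> dim W"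
proof -
  obtain Bs where Bs: "Bs \<subseteq> W" "independent Bs" "W \<subseteq> span Bs" "card Bs = dim W"
    using basis_exists by metis
  have "finite Bs" using independent_span_bound[OF assms(2) Bs(2)] Bs(1) assms(3) by blast
  then show ?thesis using dim_le_card[of V Bs] Bs(3,4) assms(1) by auto
qed

lemma subspace_eq_of_dim_le:
  assumes "subspace V" "V \<subseteq> W" "finite F" "W \<subseteq> span F" "dim W \<le> dim V"
  shows "V = W"
proof -
  obtain Bs where Bs: "Bs \<subseteq> V" "independent Bs" "V \<subseteq> span Bs" "card Bs = dim V"
    using basis_exists by metis
  obtain Cs where Cs: "Cs \<subseteq> W" "independent Cs" "W \<subseteq> span Cs" "card Cs = dim W"
    using basis_exists by metis
  have "finite Cs" using independent_span_bound[OF assms(3) Cs(2)] Cs(1) assms(4) by blast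
  then have "W \<subseteq> span Bs"
    by (rule spanning_independent[OF _ Cs(3) Bs(2)]) (use Bs Cs assms in auto)
  then show ?thesis using assms(1,2) Bs(1) span_minimal by blast
qed

context io_sys
begin

definition windows :: "nat \<Rightarrow> (nat \<Rightarrow> nat \<Rightarrow> real) set" where
  "windows K = (\<lambda>w. win K w 0) ` beh"

lemma win_in_windows:
  assumes "w \<in> beh" shows "win K w t \<in> windows K"
proof -
  have "win K w t = win K (\<lambda>s. w (s + t)) 0" by (simp add: win_shift)
  then show ?thesis unfolding windows_def using beh_shift[OF assms] by blast
qed

lemma subspace_windows: "subspace (windows K)"
  unfolding windows_def by (rule linear_subspace_image[OF linear_win beh_subspace])

lemma windows_subset: "windows K \<subseteq> window_space K q"
  using beh_out by (auto simp: windows_def win_def window_space_def)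

lemma resp_lin: "rsp (a *\<^sub>R x + b *\<^sub>R y) (a *\<^sub>R u + b *\<^sub>R v) = a *\<^sub>R rsp x u + b *\<^sub>R rsp y v"
proof -
  have "a *\<^sub>R u + b *\<^sub>R v = (\<lambda>s. a *\<^sub>R u s + b *\<^sub>R v s)" by (simp add: fun_eq_iff)
  then show ?thesis by (intro ext) (simp add: resp_comb)
qed

lemma linear_win_state: "linear (\<lambda>x. win K (rsp x 0) 0)"
proof -
  have "linear (\<lambda>x. rsp x 0)"
    using resp_lin[of 1 _ 1 _ 0 0] resp_lin[of _ _ 0 0 0 0] by (intro linearI) simp_all
  then show ?thesis using linear_compose[OF _ linear_win[of K 0]] by (auto simp: o_def)
qed

lemma linear_win_input: "linear (\<lambda>u. win K (rsp 0 u) 0)"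
proof -
  have "linear (rsp 0)"
    using resp_lin[of 1 0 1 0] resp_lin[of _ 0 0 0 _ 0] by (intro linearI) simp_all
  then show ?thesis using linear_compose[OF _ linear_win[of K 0]] by (auto simp: o_def)
qed

lemma resp_decomp: "rsp x u = rsp x 0 + rsp 0 u"
  using resp_lin[of 1 x 1 0 0 u] by simp

text \<open>Every window is the free response of a state plus a combination of \<open>m * K\<close>
  impulse responses.\<close>

lemma windows_dim_le:
  assumes Bs: "finite Bs" "E \<subseteq> span Bs"
  shows "dim (windows K) \<le> card Bs + m * K"
proof -
  let ?F1 = "(\<lambda>x. win K (rsp x 0) 0) ` Bs"
  let ?F2 = "(\<lambda>(l, j). win K (rsp 0 (unit_win l j)) 0) ` ({..<K} \<times> {..<m})"
  note lin1 = linear_win_state[of K] and lin2 = linear_win_input[of K]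
  have "win K w 0 \<in> span (?F1 \<union> ?F2)" if w: "w \<in> beh" for w
  proof -
    obtain x where x: "x \<in> E" "rsp x w = w" using w by (auto simp: beh_def)
    define u where "u = (\<Sum>l<K. \<Sum>j<m. w l j *\<^sub>R unit_win l j)"
    have "rsp x u t = rsp x w t" if "t < K" for t
      by (rule resp_cong) (use that in \<open>simp add: u_def unit_win_sum\<close>)
    then have "win K w 0 = win K (rsp x u) 0" using x(2) by (auto simp: win_eq_iff)
    also have "\<dots> = win K (rsp x 0) 0 + win K (rsp 0 u) 0"
      by (subst resp_decomp) (rule linear_add[OF linear_win])
    also have "win K (rsp 0 u) 0 = (\<Sum>l<K. \<Sum>j<m. w l j *\<^sub>R win K (rsp 0 (unit_win l j)) 0)"
      by (simp add: u_def linear_sum[OF lin2] linear_scale[OF lin2])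
    also have "win K (rsp x 0) 0 + \<dots> \<in> span (?F1 \<union> ?F2)"
    proof (intro span_add span_sum span_scale)
      have "win K (rsp x 0) 0 \<in> span ?F1"
        using linear_span_image[OF lin1, of Bs] x(1) Bs(2) by auto
      then show "win K (rsp x 0) 0 \<in> span (?F1 \<union> ?F2)"
        using span_mono[of ?F1 "?F1 \<union> ?F2"] by blast
    qed (auto intro!: span_base)
    finally show ?thesis .
  qed
  then have "dim (windows K) \<le> card (?F1 \<union> ?F2)"
    using Bs(1) by (intro dim_le_card) (auto simp: windows_def)
  also have "\<dots> \<le> card ?F1 + card ?F2" by (rule card_Un_le)
  also have "\<dots> \<le> card Bs + card ({..<K} \<times> {..<m})"
    using Bs(1) by (intro add_mono card_image_le) auto
  finally show ?thesis by (simp add: mult.commute)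
qed

text \<open>In a vanishing combination of free and impulse responses the input channels show that
  the impulse coefficients are 0; what remains is a free response, from which K steps recover the
  state.\<close>

lemma windows_dim_ge:
  assumes Bs: "finite Bs" "independent Bs" "Bs \<subseteq> E"
    and obs: "\<And>x. x \<in> E \<Longrightarrow> (\<And>j. j < K \<Longrightarrow> h ((f ^^ j) x) = 0) \<Longrightarrow> x = 0"
  shows "card Bs + m * K \<le> dim (windows K)"
proof -
  obtain Cs where Cs: "Cs \<subseteq> windows K" "independent Cs" "windows K \<subseteq> span Cs" "card Cs = dim (windows K)"
    using basis_exists by metis
  obtain F where "finite F" "window_space K q \<subseteq> span F" using window_space_span by blast
  then have finC: "finite Cs" using independent_span_bound[of F Cs] Cs(1,2) windows_subset by blast
  let ?I = "Bs <+> ({..<K} \<times> {..<m})"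
  define X where "X = case_sum (\<lambda>b. win K (rsp b 0) 0) (\<lambda>(l, j). win K (rsp 0 (unit_win l j)) 0)"
  note lin1 = linear_win_state[of K] and lin2 = linear_win_input[of K]
  have "card ?I \<le> card Cs"
  proof (rule family_card_le[where x = X])
    have "win K (rsp x u) 0 \<in> windows K" if "x \<in> E" for x u
      using win_in_windows[OF resp_beh[OF that]] .
    then show "X ` ?I \<subseteq> span Cs"
      using Cs(3) Bs(3) subspace_0[OF E(1)] by (fastforce simp: X_def)
    fix c assume c: "(\<Sum>i\<in>?I. c i *\<^sub>R X i) = 0"
    define x where "x = (\<Sum>b\<in>Bs. c (Inl b) *\<^sub>R b)"
    define d where "d l j = c (Inr (l, j))" for l j
    define u where "u = (\<Sum>l<K. \<Sum>j<m. d l j *\<^sub>R unit_win l j)"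
    have xE: "x \<in> E" unfolding x_def using Bs(3) by (intro subspace_sum[OF E(1)] subspace_scale[OF E(1)]) auto
    have "(\<Sum>i\<in>?I. c i *\<^sub>R X i) = (\<Sum>b\<in>Bs. c (Inl b) *\<^sub>R win K (rsp b 0) 0) +
        (\<Sum>(l, j)\<in>{..<K} \<times> {..<m}. d l j *\<^sub>R win K (rsp 0 (unit_win l j)) 0)"
      using Bs(1) by (subst sum.Plus) (auto simp: X_def d_def case_prod_beta intro!: arg_cong2[where f = "(+)"] sum.cong)
    also have "\<dots> = win K (rsp x 0) 0 + win K (rsp 0 u) 0"
    proof -
      have "win K (rsp 0 u) 0 = (\<Sum>l<K. \<Sum>j<m. d l j *\<^sub>R win K (rsp 0 (unit_win l j)) 0)"
        by (simp add: u_def linear_sum[OF lin2] linear_scale[OF lin2])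
      then show ?thesis
        by (simp add: x_def linear_sum[OF lin1] linear_scale[OF lin1] sum.cartesian_product)
    qed
    also have "\<dots> = win K (rsp x u) 0"
      by (subst (3) resp_decomp) (rule linear_add[OF linear_win, symmetric])
    finally have z: "win K (rsp x u) 0 = 0" using c by simp
    have zt: "rsp x u t i = 0" if "t < K" for t i
      using fun_cong[OF fun_cong[OF z, of t], of i] that by (simp add: win_def)
    have d0: "d l j = 0" if "l < K" "j < m" for l j
      using zt[OF that(1), of j] resp_in[OF xE that(2), of u l] that by (simp add: u_def unit_win_sum)
    then have u0: "u = (\<lambda>s. 0)" by (simp add: u_def fun_eq_iff)
    have "h ((f ^^ j) x) = 0" if "j < K" for j
    proof
      fix i show "h ((f ^^ j) x) i = 0 i"
        using zt[OF that, of i] unfolding u0 resp_free by simp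
    qed
    then have "x = 0" using obs[OF xE] by blast
    then have "c (Inl b) = 0" if "b \<in> Bs" for b
      using Bs(2) that independentD[OF Bs(2,1) order_refl, of "\<lambda>b. c (Inl b)" b] by (simp add: x_def)
    then show "\<forall>i\<in>?I. c i = 0" using d0 by (auto simp: d_def)
  qed (use Bs finC in auto)
  also have "card ?I = card Bs + m * K" using Bs(1) by (simp add: card_Plus mult.commute)
  finally show ?thesis using Cs(4) by simp
qed

end

text \<open>Taking the free output sequences as states, with the shift as state map, makes any model observable.\<close>

lemma observable_model:
  assumes mo: "models m p Bh E f g h k" and F: "finite F" "E \<subseteq> span F" and lag: "lag_le L E f h"
  obtains E' :: "(nat \<Rightarrow> nat \<Rightarrow> real) set" and f' g' h' F' where
    "models m p Bh E' f' g' h' k" "finite F'" "E' \<subseteq> span F'"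
    "\<And>x. x \<in> E' \<Longrightarrow> (\<And>j. j < L \<Longrightarrow> h' ((f' ^^ j) x) = 0) \<Longrightarrow> x = 0"
proof -
  interpret S: io_sys m "m + p" E f g h k using mo by (simp add: models_def)
  define Ob where "Ob x = (\<lambda>t. h ((f ^^ t) x))" for x
  have linO: "linear Ob"
    by (rule linearI) (auto simp: Ob_def fun_eq_iff linear_add[OF linear_funpow[OF S.lin_f]]
        linear_scale[OF linear_funpow[OF S.lin_f]] linear_add[OF S.lin_h] linear_scale[OF S.lin_h])
  define f' where "f' X = (\<lambda>t. X (Suc t))" for X :: "nat \<Rightarrow> nat \<Rightarrow> real"
  define g' where "g' u = Ob (g u)" for u
  define h' where "h' X = X 0" for X :: "nat \<Rightarrow> nat \<Rightarrow> real"
  have fO: "f' (Ob x) = Ob (f x)" for x by (simp add: f'_def Ob_def funpow_swap1)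
  have hO: "h' (Ob x) = h x" for x by (simp add: h'_def Ob_def)
  interpret O: io_sys m "m + p" "Ob ` E" f' g' h' k
  proof (rule io_sys.intro)
    show "linear f'" by (rule linearI) (auto simp: f'_def fun_eq_iff)
    show "linear g'" unfolding g'_def[abs_def] using linear_compose[OF S.lin_g linO] by (simp add: o_def)
    show "linear h'" by (rule linearI) (auto simp: h'_def)
    show "subspace (Ob ` E)" by (rule linear_subspace_image[OF linO S.E(1)])
    show "f' ` Ob ` E \<subseteq> Ob ` E" using S.E(2) by (auto simp: fO)
    show "range g' \<subseteq> Ob ` E" using S.E(3) by (auto simp: g'_def)
    show "h' x i = 0" if "x \<in> Ob ` E" "i < m" for x i using that S.h_in by (auto simp: hO)
    show "h' x i = 0" if "x \<in> Ob ` E" "m + p \<le> i" for x i using that S.h_out by (auto simp: hO)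
    show "g' u = g' v" if "\<And>i. i < m \<Longrightarrow> u i = v i" for u v using S.g_cong[OF that] by (simp add: g'_def)
    show "k u = k v" if "\<And>i. i < m \<Longrightarrow> u i = v i" for u v by (rule S.k_cong[OF that])
  qed (use S.lin_k S.k_in S.k_out in auto)
  have run_Ob: "run f' g' (Ob x) u t = Ob (run f g x u t)" for x u t
    by (induct t) (simp_all add: fO g'_def linear_add[OF linO])
  have r: "O.rsp (Ob x) u = S.rsp x u" for x u
    by (rule ext) (simp only: resp_def run_Ob hO)
  have "O.beh = S.beh" unfolding O.beh_def S.beh_def by (auto simp: r)
  then have "models m p Bh (Ob ` E) f' g' h' k"
    using mo O.io_sys_axioms by (simp add: models_def)
  moreover have "finite (Ob ` F)" "Ob ` E \<subseteq> span (Ob ` F)"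
    using F linear_span_image[OF linO, of F] by auto
  moreover have "X = 0" if X: "X \<in> Ob ` E" and z: "\<And>j. j < L \<Longrightarrow> h' ((f' ^^ j) X) = 0" for X
  proof -
    obtain x where x: "x \<in> E" "X = Ob x" using X by blast
    have sh: "(f' ^^ j) (Ob x) = Ob ((f ^^ j) x)" for j by (induct j) (simp_all add: fO)
    \<comment> \<open>By the lag bound, L vanishing outputs propagate to all times; the output
      sequence is the new state, so this state is 0.\<close>
    have "h ((f ^^ j) x) = 0" for j
    proof (induct j rule: less_induct)
      case (less j)
      show ?case
      proof (cases "j < L")
        case True
        then show ?thesis using z[OF True] by (simp add: x(2) sh hO)
      next
        case False
        then have "lag_le j E f h" using lag_le_mono[OF S.E(2) lag, of j] by simp
        moreover have "\<forall>i<j. h ((f ^^ i) x) = 0" using less by blast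
        ultimately show ?thesis using x(1) unfolding lag_le_def by blast
      qed
    qed
    then show ?thesis by (auto simp: x(2) Ob_def fun_eq_iff)
  qed
  ultimately show ?thesis by (rule that)
qed

section \<open>Quadratic forms and Hankel matrices\<close>

definition quad :: "real mat \<Rightarrow> real vec \<Rightarrow> real" where
  "quad M v = v \<bullet> (M *\<^sub>v v)"

definition unflat :: "nat \<Rightarrow> nat \<Rightarrow> (nat \<Rightarrow> real) \<Rightarrow> nat \<Rightarrow> nat \<Rightarrow> real" where
  "unflat q K x = (\<lambda>j i. if j < K \<and> i < q then x (j * q + i) else 0)"

lemma linear_unflat: "linear (unflat q K)"
  by (rule linearI) (auto simp: unflat_def fun_eq_iff)

lemma flat_index: "i < K * q \<Longrightarrow> i div q < K \<and> i mod q < q \<and> (i div q) * q + i mod q = (i::nat)"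
  by (cases "q = 0") (auto simp: less_mult_imp_div_less)

lemma flat_index_less:
  assumes "j < K" "i < q" shows "j * q + i < K * (q::nat)"
proof -
  have "j * q + i < (j + 1) * q" using assms(2) by simp
  also have "\<dots> \<le> K * q" using assms(1) by (intro mult_right_mono) auto
  finally show ?thesis .
qed

lemma flat_div_mod:
  assumes "i < q" shows "(j * q + i) div q = j" "(j * q + i) mod q = (i::nat)"
  using assms by (simp_all add: div_mult_self1)

lemma unflat_inj:
  assumes "x \<in> std_state (K * q)" "y \<in> std_state (K * q)" "unflat q K x = unflat q K y"
  shows "x = y"
proof
  fix i
  show "x i = y i"
  proof (cases "i < K * q")
    case True
    then show ?thesis
      using flat_index[OF True] fun_cong[OF fun_cong[OF assms(3), of "i div q"], of "i mod q"]
      by (simp add: unflat_def)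
  qed (use assms in \<open>simp add: std_state_def\<close>)
qed

lemma stack_carrier [simp]: "stack q w t k \<in> carrier_vec (k * q)" "dim_vec (stack q w t k) = k * q"
  by (simp_all add: stack_def)

lemma stack_one_carrier [simp]: "stack q w t (Suc 0) \<in> carrier_vec q"
  using stack_carrier(1)[of q w t "Suc 0"] by simp

lemma unflat_stack: "unflat q K (vec_fun (stack q w t K)) = win K (signal q w) t"
proof (intro ext)
  fix j i
  show "unflat q K (vec_fun (stack q w t K)) j i = win K (signal q w) t j i"
    using flat_index_less[of j K i q] flat_div_mod[of i q j]
    by (auto simp: unflat_def vec_fun_def stack_def win_def signal_def)
qed

lemma vec_fun_std_state: "vec_fun v \<in> std_state (dim_vec v)"
  by (auto simp: vec_fun_def std_state_def)

lemma stack_eqI: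
  assumes "v \<in> carrier_vec (K * q)" "unflat q K (vec_fun v) = win K (signal q w) t"
  shows "v = stack q w t K"
proof (rule vec_fun_inj)
  show "vec_fun v = vec_fun (stack q w t K)"
    using assms vec_fun_std_state[of v] vec_fun_std_state[of "stack q w t K"]
    by (intro unflat_inj[of _ K q]) (auto simp: unflat_stack)
qed (use assms in auto)

lemma stack_cong: "win K (signal q w) t = win K (signal q w') t' \<Longrightarrow> stack q w t K = stack q w' t' K"
  by (rule stack_eqI) (simp_all add: unflat_stack)

lemma stack_append: "stack q w t (a + b) = stack q w t a @\<^sub>v stack q w (t + a) b"
proof (rule eq_vecI)
  fix i assume i: "i < dim_vec (stack q w t a @\<^sub>v stack q w (t + a) b)"
  then have q: "q > 0" by (cases q) auto
  show "stack q w t (a + b) $ i = (stack q w t a @\<^sub>v stack q w (t + a) b) $ i"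
  proof (cases "i < a * q")
    case True
    then show ?thesis using i by (simp add: stack_def add_mult_distrib)
  next
    case False
    then obtain l where l: "i = a * q + l" by (metis le_add_diff_inverse not_less)
    then have "i div q = a + l div q" "i mod q = l mod q" using q by simp_all
    then show ?thesis using i l by (simp add: stack_def add_mult_distrib add.assoc)
  qed
qed (simp add: add_mult_distrib)

lemma qdf_quad: "q > 0 \<Longrightarrow> dim_row Psi = k * q \<Longrightarrow> qdf q Psi w t = quad Psi (stack q w t k)"
  by (simp add: qdf_def quad_def Let_def)

lemma quad_block1:
  assumes "M \<in> carrier_mat a a" "v \<in> carrier_vec a" "u \<in> carrier_vec b"
  shows "quad (four_block_mat M (0\<^sub>m a b) (0\<^sub>m b a) (0\<^sub>m b b)) (v @\<^sub>v u) = quad M v"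
proof -
  have "four_block_mat M (0\<^sub>m a b) (0\<^sub>m b a) (0\<^sub>m b b) *\<^sub>v (v @\<^sub>v u) = (M *\<^sub>v v) @\<^sub>v 0\<^sub>v b"
    using assms by (subst four_block_mat_mult_vec[of _ a a _ b _ b]) auto
  then show ?thesis
    unfolding quad_def using assms by (simp add: scalar_prod_append[of _ a _ b])
qed

lemma quad_block2:
  assumes "M \<in> carrier_mat a a" "v \<in> carrier_vec a" "u \<in> carrier_vec b"
  shows "quad (four_block_mat (0\<^sub>m b b) (0\<^sub>m b a) (0\<^sub>m a b) M) (u @\<^sub>v v) = quad M v"
proof -
  have "four_block_mat (0\<^sub>m b b) (0\<^sub>m b a) (0\<^sub>m a b) M *\<^sub>v (u @\<^sub>v v) = 0\<^sub>v b @\<^sub>v (M *\<^sub>v v)"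
    using assms by (subst four_block_mat_mult_vec[of _ b b _ a _ a]) auto
  then show ?thesis
    unfolding quad_def using assms by (simp add: scalar_prod_append[of _ b _ a])
qed

lemma quad_minus:
  assumes "A \<in> carrier_mat n n" "B \<in> carrier_mat n n" "v \<in> carrier_vec n"
  shows "quad (A - B) v = quad A v - quad B v"
  using assms unfolding quad_def
  by (subst minus_mult_distrib_mat_vec[of _ n n]) (auto intro!: scalar_prod_minus_distrib[of _ n])

lemma quad_plus:
  assumes "A \<in> carrier_mat n n" "B \<in> carrier_mat n n" "v \<in> carrier_vec n"
  shows "quad (A + B) v = quad A v + quad B v"
  using assms unfolding quad_def
  by (subst add_mult_distrib_mat_vec[of _ n n]) (auto intro!: scalar_prod_add_distrib[of _ n])

lemma psd_quad: "psd A \<Longrightarrow> v \<in> carrier_vec (dim_row A) \<Longrightarrow> 0 \<le> quad A v"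
  by (simp add: psd_def quad_def)

context
  fixes q d :: nat and Psi :: "real mat"
  assumes q: "q > 0" and Psi: "sym_mat (q * d) Psi"
begin

lemma Psi_carrier: "Psi \<in> carrier_mat (d * q) (d * q)"
  using Psi by (simp add: sym_mat_def mult.commute)

definition "blk_now = four_block_mat Psi (0\<^sub>m (dim_row Psi) q) (0\<^sub>m q (dim_col Psi)) (0\<^sub>m q q)"
definition "blk_next = four_block_mat (0\<^sub>m q q) (0\<^sub>m q (dim_col Psi)) (0\<^sub>m (dim_row Psi) q) Psi"

lemma blk_carrier: "blk_now \<in> carrier_mat ((d + 1) * q) ((d + 1) * q)" "blk_next \<in> carrier_mat ((d + 1) * q) ((d + 1) * q)"
  using Psi_carrier by (auto simp: blk_now_def blk_next_def algebra_simps)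

lemma blk_sym: "transpose_mat blk_now = blk_now" "transpose_mat blk_next = blk_next"
proof -
  have t: "transpose_mat Psi = Psi" using Psi by (simp add: sym_mat_def)
  show "transpose_mat blk_now = blk_now" "transpose_mat blk_next = blk_next"
    unfolding blk_now_def blk_next_def using Psi_carrier t
    by (subst transpose_four_block_mat[of _ "d * q" "d * q" _ q _ q], auto)
      (subst transpose_four_block_mat[of _ q q _ "d * q" _ "d * q"], auto)
qed

lemma qdf_Psi: "qdf q Psi w t = quad Psi (stack q w t d)"
  by (rule qdf_quad[OF q]) (use Psi_carrier in auto)

lemma quad_blk_now: "quad blk_now (stack q w t (d + 1)) = qdf q Psi w t"
  unfolding blk_now_def stack_append qdf_Psi
  using Psi_carrier quad_block1[of Psi "d * q" "stack q w t d" "stack q w (t + d) 1" q] by simp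

lemma quad_blk_next: "quad blk_next (stack q w t (d + 1)) = qdf q Psi w (t + 1)"
  unfolding blk_next_def add.commute[of d 1] stack_append qdf_Psi
  using Psi_carrier quad_block2[of Psi "d * q" "stack q w (t + 1) d" "stack q w t 1" q] by simp

lemma qdf_nabla: "qdf q (nabla q Psi) w t = qdf q Psi w (t + 1) - qdf q Psi w t"
proof -
  have "nabla q Psi = blk_next - blk_now" by (simp add: nabla_def blk_now_def blk_next_def)
  moreover have "dim_row (nabla q Psi) = (d + 1) * q" using Psi_carrier by (simp add: nabla_def)
  ultimately show ?thesis
    using quad_minus[OF blk_carrier(2,1), of "stack q w t (d + 1)"] quad_blk_now quad_blk_next
    by (simp only: qdf_quad[OF q, where k = "d + 1"] stack_carrier)
qed

context
  fixes Phi :: "real mat" and e :: nat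
  assumes Phi: "sym_mat (e * q) Phi" and e: "e \<le> d + 1"
begin

lemma pad_eq: "pad_mat ((d + 1) * q) Phi = four_block_mat Phi (0\<^sub>m (e * q) ((d + 1 - e) * q)) (0\<^sub>m ((d + 1 - e) * q) (e * q))
    (0\<^sub>m ((d + 1 - e) * q) ((d + 1 - e) * q))"
proof -
  have "(d + 1) * q - e * q = (d + 1 - e) * q" by (simp add: diff_mult_distrib)
  moreover have "Phi \<in> carrier_mat (e * q) (e * q)" using Phi by (simp add: sym_mat_def)
  ultimately show ?thesis by (auto simp: pad_mat_def simp del: add_mult_distrib)
qed

lemma pad_carrier: "pad_mat ((d + 1) * q) Phi \<in> carrier_mat ((d + 1) * q) ((d + 1) * q)"
proof -
  have "e * q + (d + 1 - e) * q = (d + 1) * q" using e by (simp flip: add_mult_distrib)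
  moreover have "Phi \<in> carrier_mat (e * q) (e * q)" using Phi by (simp add: sym_mat_def)
  ultimately show ?thesis unfolding pad_eq by (metis four_block_carrier_mat zero_carrier_mat)
qed

lemma pad_sym: "transpose_mat (pad_mat ((d + 1) * q) Phi) = pad_mat ((d + 1) * q) Phi"
  unfolding pad_eq using Phi
  by (subst transpose_four_block_mat[of _ "e * q" "e * q" _ "(d + 1 - e) * q" _ "(d + 1 - e) * q"])
    (auto simp: sym_mat_def)

lemma quad_pad: "quad (pad_mat ((d + 1) * q) Phi) (stack q w t (d + 1)) = qdf q Phi w t"
proof -
  have "d + 1 = e + (d + 1 - e)" using e by simp
  then have "stack q w t (d + 1) = stack q w t e @\<^sub>v stack q w (t + e) (d + 1 - e)"
    using stack_append by metis
  moreover have "qdf q Phi w t = quad Phi (stack q w t e)"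
    by (rule qdf_quad[OF q]) (use Phi in \<open>auto simp: sym_mat_def\<close>)
  ultimately show ?thesis
    unfolding pad_eq using quad_block1[of Phi "e * q" "stack q w t e" "stack q w (t + e) (d + 1 - e)"] Phi
    by (simp add: sym_mat_def)
qed

definition "lmi_mat = blk_now - blk_next + pad_mat ((d + 1) * q) Phi"

lemma lmi_mat_carrier: "lmi_mat \<in> carrier_mat ((d + 1) * q) ((d + 1) * q)"
  unfolding lmi_mat_def using blk_carrier pad_carrier by simp

lemma lmi_mat_sym: "transpose_mat lmi_mat = lmi_mat"
  unfolding lmi_mat_def
  by (simp only: transpose_add[OF minus_carrier_mat[OF blk_carrier(2)] pad_carrier]
      transpose_minus[OF blk_carrier] blk_sym pad_sym)

lemma quad_lmi_mat:
  "quad lmi_mat (stack q w t (d + 1)) = qdf q Phi w t - qdf q (nabla q Psi) w t"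
  unfolding lmi_mat_def quad_plus[OF minus_carrier_mat[OF blk_carrier(2)] pad_carrier stack_carrier(1)]
    quad_minus[OF blk_carrier stack_carrier(1)] quad_blk_now quad_blk_next quad_pad qdf_nabla
  by simp

text \<open>The matrix inequality is a congruence with \<open>H\<close>, so it tests the form of
  \<open>lmi_mat\<close> on the column space of \<open>H\<close>; the product inherits its symmetry
  from \<open>lmi_mat\<close>.\<close>

lemma lmi_cond_iff:
  assumes H: "H \<in> carrier_mat ((d + 1) * q) c"
  shows "lmi_cond q d Phi Psi H \<longleftrightarrow> (\<forall>\<xi>\<in>carrier_vec c. 0 \<le> quad lmi_mat (H *\<^sub>v \<xi>))"
proof -
  let ?M = "transpose_mat H * lmi_mat * H"
  have eq: "lmi_cond q d Phi Psi H \<longleftrightarrow> psd ?M"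
    by (simp add: lmi_cond_def lmi_mat_def blk_now_def blk_next_def)
  have HT: "transpose_mat H \<in> carrier_mat c ((d + 1) * q)" using H by simp
  have M: "?M \<in> carrier_mat c c" using H lmi_mat_carrier by simp
  have "transpose_mat ?M = transpose_mat H * transpose_mat (transpose_mat H * lmi_mat)"
    using transpose_mult[of "transpose_mat H * lmi_mat" c "(d + 1) * q" H c] HT H lmi_mat_carrier by simp
  also have "transpose_mat (transpose_mat H * lmi_mat) = lmi_mat * H"
    using transpose_mult[OF HT lmi_mat_carrier] by (simp add: lmi_mat_sym)
  finally have sym: "transpose_mat ?M = ?M"
    using assoc_mult_mat[OF HT lmi_mat_carrier H] by simp
  have "\<xi> \<bullet> (?M *\<^sub>v \<xi>) = quad lmi_mat (H *\<^sub>v \<xi>)" if \<xi>: "\<xi> \<in> carrier_vec c" for \<xi>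
  proof -
    have H\<xi>: "H *\<^sub>v \<xi> \<in> carrier_vec ((d + 1) * q)" using H \<xi> by simp
    then have MH: "lmi_mat *\<^sub>v (H *\<^sub>v \<xi>) \<in> carrier_vec ((d + 1) * q)" using lmi_mat_carrier by (rule mult_mat_vec_carrier[rotated])
    have "?M *\<^sub>v \<xi> = transpose_mat H *\<^sub>v (lmi_mat *\<^sub>v (H *\<^sub>v \<xi>))"
      by (simp only: assoc_mult_mat_vec[OF mult_carrier_mat[OF HT lmi_mat_carrier] H \<xi>]
          assoc_mult_mat_vec[OF HT lmi_mat_carrier H\<xi>])
    then have "\<xi> \<bullet> (?M *\<^sub>v \<xi>) = (transpose_mat H *\<^sub>v (lmi_mat *\<^sub>v (H *\<^sub>v \<xi>))) \<bullet> \<xi>"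
      using HT MH \<xi> by (simp add: comm_scalar_prod[of _ c])
    also have "\<dots> = (lmi_mat *\<^sub>v (H *\<^sub>v \<xi>)) \<bullet> (H *\<^sub>v \<xi>)"
      by (rule transpose_vec_mult_scalar[OF H \<xi> MH])
    also have "\<dots> = quad lmi_mat (H *\<^sub>v \<xi>)"
      unfolding quad_def by (rule comm_scalar_prod[OF MH H\<xi>])
    finally show ?thesis .
  qed
  then show ?thesis
    unfolding eq psd_def sym_mat_def using M sym by auto
qed

end
end

section \<open>The column space of the Hankel matrix as a space of windows\<close>

lemma hankel_carrier: "hankel q k wd \<in> carrier_mat (k * q) (length wd - k + 1)"
  by (simp add: hankel_def)

lemma unflat_hankel_col:
  assumes wd: "wd = map w [0..<T]" and t: "t + d < T"
  shows "unflat q (d + 1) (vec_fun (col (hankel q (d + 1) wd) t)) = win (d + 1) (signal q w) t"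
proof (intro ext)
  fix j i
  have "T - (d + 1) + 1 = T - d" using t by simp
  then show "unflat q (d + 1) (vec_fun (col (hankel q (d + 1) wd) t)) j i = win (d + 1) (signal q w) t j i"
    using flat_index_less[of j "d + 1" i q] flat_div_mod[of i q j] t
    by (auto simp: unflat_def vec_fun_def hankel_def wd win_def signal_def add.commute simp del: mult_Suc)
qed

definition hankel_space :: "nat \<Rightarrow> nat \<Rightarrow> real vec list \<Rightarrow> (nat \<Rightarrow> nat \<Rightarrow> real) set" where
  "hankel_space q d wd = unflat q (d + 1) ` range (mat_fun (hankel q (d + 1) wd))"

lemma subspace_hankel_space: "subspace (hankel_space q d wd)"
  unfolding hankel_space_def
  by (intro linear_subspace_image[OF linear_unflat] linear_subspace_image[OF linear_mat_fun] subspace_UNIV)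

lemma dim_hankel_space: "dim (hankel_space q d wd) = rk (hankel q (d + 1) wd)"
proof -
  let ?H = "hankel q (d + 1) wd"
  obtain F where F: "finite F" "range (mat_fun ?H) \<subseteq> span F" using finite_range_mat_fun by blast
  have "dim (unflat q (d + 1) ` range (mat_fun ?H)) = dim (range (mat_fun ?H))"
  proof (subst dim_image_eq_iff[OF linear_unflat linear_subspace_image[OF linear_mat_fun subspace_UNIV] F], intro ballI impI)
    fix x assume x: "x \<in> range (mat_fun ?H)" "unflat q (d + 1) x = 0"
    then have "x \<in> std_state ((d + 1) * q)" using mat_fun_std_state[of ?H] hankel_carrier[of q "d + 1" wd] by auto
    then show "x = 0"
      using unflat_inj[of x "d + 1" q 0] x(2) subspace_0[OF subspace_std_state] linear_0[OF linear_unflat] by metis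
  qed
  then show ?thesis by (simp add: hankel_space_def rk_eq_dim)
qed

lemma hankel_space_eq_span:
  assumes wd: "wd = map w [0..<T]" and T: "d < T"
  shows "hankel_space q d wd = span ((\<lambda>t. win (d + 1) (signal q w) t) ` {t. t + d < T})"
proof -
  let ?H = "hankel q (d + 1) wd"
  have "set (cols ?H) = col ?H ` {t. t + d < T}"
  proof -
    have "length wd - (d + 1) + 1 = T - d" using wd T by simp
    then have "set (cols ?H) = col ?H ` {0..<T - d}" using hankel_carrier[of q "d + 1" wd] by (auto simp: cols_def)
    also have "{0..<T - d} = {t. t + d < T}" by auto
    finally show ?thesis .
  qed
  then have "unflat q (d + 1) ` vec_fun ` set (cols ?H) = (\<lambda>t. win (d + 1) (signal q w) t) ` {t. t + d < T}"
    using unflat_hankel_col[OF wd] by (auto simp: image_image)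
  then show ?thesis
    unfolding hankel_space_def span_cols[symmetric] linear_span_image[OF linear_unflat, symmetric] by simp
qed

lemma hankel_space_stack:
  assumes "win (d + 1) (signal q w) t \<in> hankel_space q d wd"
  obtains \<xi> where "\<xi> \<in> carrier_vec (dim_col (hankel q (d + 1) wd))" "stack q w t (d + 1) = hankel q (d + 1) wd *\<^sub>v \<xi>"
proof -
  let ?H = "hankel q (d + 1) wd"
  obtain x where x: "win (d + 1) (signal q w) t = unflat q (d + 1) (mat_fun ?H x)"
    using assms by (auto simp: hankel_space_def)
  define \<xi> where "\<xi> = vec (dim_col ?H) x"
  have "vec_fun (?H *\<^sub>v \<xi>) = mat_fun ?H (vec_fun \<xi>)" by (rule vec_fun_mult_mat_vec) (simp add: \<xi>_def)
  also have "\<dots> = mat_fun ?H x" by (rule mat_fun_cong) (simp add: \<xi>_def vec_fun_def)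
  finally have e: "vec_fun (?H *\<^sub>v \<xi>) = mat_fun ?H x" .
  have "?H *\<^sub>v \<xi> = stack q w t (d + 1)"
  proof (rule stack_eqI)
    show "?H *\<^sub>v \<xi> \<in> carrier_vec ((d + 1) * q)"
      by (rule mult_mat_vec_carrier[OF hankel_carrier]) (simp add: \<xi>_def hankel_def)
    show "unflat q (d + 1) (vec_fun (?H *\<^sub>v \<xi>)) = win (d + 1) (signal q w) t"
      by (simp only: e x)
  qed
  then show ?thesis
    by (intro that[of \<xi>]) (simp_all only: \<xi>_def vec_carrier)
qed

lemma hankel_space_mult:
  assumes "\<xi> \<in> carrier_vec (dim_col (hankel q (d + 1) wd))"
  shows "unflat q (d + 1) (vec_fun (hankel q (d + 1) wd *\<^sub>v \<xi>)) \<in> hankel_space q d wd"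
  using assms by (auto simp: hankel_space_def vec_fun_mult_mat_vec)

section \<open>Informativity\<close>

lemma sigma_hankel_space:
  assumes S: "Bh \<in> Sigma_data m p wd" and d: "d < length wd" and mo: "models m p Bh E f g h k"
  shows "hankel_space (m + p) d wd \<subseteq> io_sys.windows E f g h k (d + 1)"
proof -
  interpret io_sys m "m + p" E f g h k using mo by (simp add: models_def)
  obtain w where w: "w \<in> Bh" "wd = map w [0..<Suc (length wd - 1)]"
    using S by (auto simp: Sigma_data_def restr_def)
  have "Suc (length wd - 1) = length wd" using d by simp
  then have wd: "wd = map w [0..<length wd]" using w(2) by simp
  have "signal (m + p) w \<in> beh" using w(1) mo by (simp add: models_def)
  then show ?thesis
    unfolding hankel_space_eq_span[OF wd d]
    by (intro span_minimal subspace_windows) (auto intro: win_in_windows)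
qed

lemma minimal_model:
  assumes "Sigma_data m p wd \<noteq> {}"
  obtains Bh and E :: "(nat \<Rightarrow> real) set" and f g h k where
    "Bh \<in> Sigma_data m p wd" "models m p Bh E f g h k"
    "\<And>K. dim (io_sys.windows E f g h k K) \<le> n_min m p wd + m * K"
proof -
  have "\<exists>Bh\<in>Sigma_data m p wd. n_min m p wd = n_of m p Bh"
    unfolding n_min_def by (rule LeastI_ex) (use assms in blast)
  then obtain Bh where Bh: "Bh \<in> Sigma_data m p wd" "n_min m p wd = n_of m p Bh" by blast
  have "\<exists>A B C D. is_rep_of m p Bh (n_of m p Bh) A B C D"
    unfolding n_of_def by (rule LeastI_ex) (use Bh(1) in \<open>auto simp: Sigma_data_def L_class_def\<close>)
  then obtain A B C D where rep: "is_rep_of m p Bh (n_min m p wd) A B C D" using Bh(2) by auto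
  note mo = models_rep[OF rep]
  interpret io_sys m "m + p" "std_state (n_min m p wd)" "mat_fun A" "mat_fun B" "out_map m C" "feed_map m D"
    using mo by (simp add: models_def)
  obtain F where F: "finite F" "card F \<le> n_min m p wd" "std_state (n_min m p wd) \<subseteq> span F"
    using std_state_span by blast
  have "dim (windows K) \<le> n_min m p wd + m * K" for K
    using windows_dim_le[OF F(1,3), of K] F(2) by simp
  with Bh(1) mo show ?thesis by (rule that)
qed

text \<open>All columns are windows of an explanation of least state dimension. The rank condition
  therefore asks for the largest rank that the data can have.\<close>

lemma rk_hankel_le:
  assumes "Sigma_data m p wd \<noteq> {}" "d < length wd"
  shows "rk (hankel (m + p) (d + 1) wd) \<le> n_min m p wd + m * (d + 1)"
proof -
  obtain Bh and E :: "(nat \<Rightarrow> real) set" and f g h k where M: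
    "Bh \<in> Sigma_data m p wd" "models m p Bh E f g h k"
    "\<And>K. dim (io_sys.windows E f g h k K) \<le> n_min m p wd + m * K"
    using minimal_model[OF assms(1)] by blast
  interpret io_sys m "m + p" E f g h k using M(2) by (simp add: models_def)
  obtain F where "finite F" "window_space (d + 1) (m + p) \<subseteq> span F" using window_space_span by blast
  then have "dim (hankel_space (m + p) d wd) \<le> dim (windows (d + 1))"
    using sigma_hankel_space[OF M(1) assms(2) M(2)] windows_subset by (intro dim_mono_finite[of _ _ F]) auto
  then show ?thesis using M(3)[of "d + 1"] by (simp add: dim_hankel_space)
qed

text \<open>The rank condition makes the column space of the Hankel matrix equal to the windows of a
  minimal explanation of the data, whose behavior is then contained in every competitor of small lag;
  controllability forces equality.\<close>

lemma rank_condition_windows: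
  assumes rank: "rk (hankel (m + p) (d + 1) wd) = n_min m p wd + m * (d + 1)"
    and Bh: "Bh \<in> Sigma_data m p wd" "Bh \<in> L_cont m p L" and L: "L \<le> d" "d < length wd" and w: "w \<in> Bh"
  shows "win (d + 1) (signal (m + p) w) t \<in> hankel_space (m + p) d wd"
proof -
  have ne: "Sigma_data m p wd \<noteq> {}" using Bh(1) by blast
  obtain Bm and Em :: "(nat \<Rightarrow> real) set" and fm gm hm km where M:
    "Bm \<in> Sigma_data m p wd" "models m p Bm Em fm gm hm km"
    "\<And>K. dim (io_sys.windows Em fm gm hm km K) \<le> n_min m p wd + m * K"
    using minimal_model[OF ne] by blast
  interpret M: io_sys m "m + p" Em fm gm hm km using M(2) by (simp add: models_def)
  have Lc: "Bh \<in> L_class m p" "lag_of m p Bh \<le> L" using Bh(2) by (simp_all add: L_cont_def)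
  obtain E :: "(nat \<Rightarrow> real) set" and f g h k where mo: "models m p Bh E f g h k" and lagL: "lag_le L E f h"
    using L_class_lag[OF Lc] by metis
  interpret S: io_sys m "m + p" E f g h k using mo by (simp add: models_def)
  have lag: "lag_le d E f h" by (rule lag_le_mono[OF S.E(2) lagL L(1)])
  obtain F where F: "finite F" "window_space (d + 1) (m + p) \<subseteq> span F" using window_space_span by blast
  \<comment> \<open>One inclusion holds for all data; the rank condition makes the dimension meet
    the upper bound for the windows of the minimal explanation.\<close>
  have eq: "hankel_space (m + p) d wd = M.windows (d + 1)"
    using sigma_hankel_space[OF M(1) L(2) M(2)] M.windows_subset F M(3)[of "d + 1"] rank
    by (intro subspace_eq_of_dim_le[of _ _ F] subspace_hankel_space) (auto simp: dim_hankel_space)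
  then have sub: "M.windows (d + 1) \<subseteq> S.windows (d + 1)"
    using sigma_hankel_space[OF Bh(1) L(2) mo] by simp
  \<comment> \<open>Membership in a behavior of lag at most d is decided by windows of length d + 1,
    which is exactly the depth of the Hankel matrix.\<close>
  have "M.beh \<subseteq> S.beh"
  proof
    fix v assume v: "v \<in> M.beh"
    show "v \<in> S.beh"
    proof (rule S.beh_complete[OF lag])
      fix t
      have "win (Suc d) v t \<in> S.windows (Suc d)"
        using sub M.win_in_windows[OF v, of "Suc d" t] by auto
      then show "\<exists>v'\<in>S.beh. win (Suc d) v t = win (Suc d) v' 0" by (auto simp: S.windows_def)
    qed
  qed
  moreover have "sig_controllable S.beh"
    using Bh(2) models_controllable[OF mo] by (simp add: L_cont_def)
  ultimately have "S.beh = M.beh"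
    using controllable_subbehavior_eq[OF S.io_sys_axioms M.io_sys_axioms _ lag] by blast
  then have "signal (m + p) w \<in> M.beh" using w mo by (simp add: models_def)
  then show ?thesis unfolding eq by (rule M.win_in_windows)
qed

section \<open>Comparison of coefficients and its consequences for the supply matrix\<close>

lemma quadratic_nonneg_cofinite:
  fixes a b c :: real
  assumes bad: "finite bad" and nn: "\<And>x. x \<notin> bad \<Longrightarrow> 0 \<le> a + b * x + c * x\<^sup>2" and c: "c \<le> 0"
  shows "c = 0" "b = 0"
proof -
  obtain M where M: "\<And>x. x \<in> bad \<Longrightarrow> \<bar>x\<bar> < M"
  proof (cases "bad = {}")
    case False
    have "\<bar>x\<bar> < Max (abs ` bad) + 1" if "x \<in> bad" for x
    proof -
      have "\<bar>x\<bar> \<le> Max (abs ` bad)" by (rule Max_ge) (use bad that in auto)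
      then show ?thesis by linarith
    qed
    then show ?thesis using that by blast
  qed (use that in blast)
  \<comment> \<open>Beyond all exceptional points both signs of \<open>x\<close> are available:
    adding the two inequalities isolates c, and once c = 0 the two signs force b = 0.\<close>
  have both: "0 \<le> a + b * x + c * x\<^sup>2 \<and> 0 \<le> a - b * x + c * x\<^sup>2" if "M \<le> x" for x
    using nn[of x] nn[of "- x"] M[of x] M[of "- x"] that by fastforce
  show c0: "c = 0"
  proof (rule ccontr)
    assume "c \<noteq> 0"
    then have neg: "c < 0" using c by simp
    define x where "x = max (max M 1) (\<bar>a\<bar> / (- c) + 1)"
    have x: "M \<le> x" "1 \<le> x" "\<bar>a\<bar> / (- c) < x" by (simp_all add: x_def less_max_iff_disj)
    have "0 \<le> a + c * x\<^sup>2" using both[OF x(1)] by simp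
    moreover have "\<bar>a\<bar> < x * (- c)" using pos_divide_less_eq[of "- c" "\<bar>a\<bar>" x] x(3) neg by simp
    moreover have "x * (- c) \<le> x\<^sup>2 * (- c)"
      using x(2) neg by (intro mult_right_mono) (simp_all add: power2_eq_square)
    then have "x * (- c) \<le> - (c * x\<^sup>2)" by (simp add: mult.commute)
    ultimately show False by linarith
  qed
  show "b = 0"
  proof (rule ccontr)
    assume b: "b \<noteq> 0"
    define x where "x = max M (\<bar>a\<bar> / \<bar>b\<bar> + 1)"
    have x: "M \<le> x" "\<bar>a\<bar> / \<bar>b\<bar> < x" by (simp_all add: x_def less_max_iff_disj)
    then have "\<bar>a\<bar> < x * \<bar>b\<bar>" using b by (simp add: divide_less_eq)
    then show False using both[OF x(1)] c0 by (cases "b > 0") (auto simp: mult.commute)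
  qed
qed

lemma quad_add:
  assumes Q: "sym_mat n Q" and x: "x \<in> carrier_vec n" and i: "i < n"
  shows "quad Q (x + c \<cdot>\<^sub>v unit_vec n i) = quad Q x + 2 * c * (\<Sum>j<n. Q $$ (i, j) * x $ j) + c\<^sup>2 * Q $$ (i, i)"
proof -
  have Qc: "Q \<in> carrier_mat n n" "transpose_mat Q = Q" using Q by (simp_all add: sym_mat_def)
  let ?e = "unit_vec n i"
  have Qe: "Q *\<^sub>v ?e = col Q i" using Qc i by (intro eq_vecI) (auto simp: scalar_prod_right_unit)
  have row: "row Q i = col Q i" using Qc i by (metis carrier_matD row_transpose)
  have "?e \<bullet> (Q *\<^sub>v x) = (Q *\<^sub>v x) $ i"
    by (rule scalar_prod_left_unit) (use Qc i x in auto)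
  then have ex: "?e \<bullet> (Q *\<^sub>v x) = (\<Sum>j<n. Q $$ (i, j) * x $ j)"
    using Qc i x by (simp add: scalar_prod_def lessThan_atLeast0)
  have xe: "x \<bullet> (Q *\<^sub>v ?e) = (\<Sum>j<n. Q $$ (i, j) * x $ j)"
    unfolding Qe row[symmetric] using Qc i x
    by (simp add: scalar_prod_def lessThan_atLeast0 mult.commute)
  have ee: "?e \<bullet> (Q *\<^sub>v ?e) = Q $$ (i, i)"
    unfolding Qe using Qc i by (simp add: scalar_prod_left_unit[of _ n])
  have c1: "Q *\<^sub>v x \<in> carrier_vec n" "Q *\<^sub>v ?e \<in> carrier_vec n" using Qc x by auto
  have "Q *\<^sub>v (x + c \<cdot>\<^sub>v ?e) = Q *\<^sub>v x + c \<cdot>\<^sub>v (Q *\<^sub>v ?e)"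
    using Qc x by (simp add: mult_add_distrib_mat_vec[of _ n n] mult_mat_vec[of _ n n])
  then have "quad Q (x + c \<cdot>\<^sub>v ?e) = (x + c \<cdot>\<^sub>v ?e) \<bullet> (Q *\<^sub>v x + c \<cdot>\<^sub>v (Q *\<^sub>v ?e))"
    by (simp add: quad_def)
  also have "\<dots> = (x \<bullet> (Q *\<^sub>v x) + x \<bullet> (c \<cdot>\<^sub>v (Q *\<^sub>v ?e))) + ((c \<cdot>\<^sub>v ?e) \<bullet> (Q *\<^sub>v x) + (c \<cdot>\<^sub>v ?e) \<bullet> (c \<cdot>\<^sub>v (Q *\<^sub>v ?e)))"
    using c1 x by (simp add: add_scalar_prod_distrib[of _ n] scalar_prod_add_distrib[of _ n])
  also have "\<dots> = quad Q x + c * (x \<bullet> (Q *\<^sub>v ?e)) + (c * (?e \<bullet> (Q *\<^sub>v x)) + c * (c * (?e \<bullet> (Q *\<^sub>v ?e))))"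
    using c1 x by (simp add: quad_def smult_scalar_prod_distrib[of _ n] scalar_prod_smult_distrib[of _ n])
  finally show ?thesis unfolding ex xe ee by (simp add: power2_eq_square algebra_simps)
qed

text \<open>Moving from \<open>unit_vec n j\<close> in the direction \<open>unit_vec n i\<close>,
  the form is affine in the step length, because its quadratic coefficient is the diagonal entry.
  Nonnegativity leaves only slope 0, and the slope is \<open>2 * Q $$ (i, j)\<close>.\<close>

lemma psd_zero_diagonal:
  assumes psd: "psd Q" and Q: "sym_mat n Q" and ij: "i < n" "j < n" and z: "Q $$ (i, i) = 0"
  shows "Q $$ (i, j) = 0"
proof -
  have dim: "dim_row Q = n" using Q by (auto simp: sym_mat_def)
  have e: "unit_vec n j \<in> carrier_vec n" by simp
  have s: "(\<Sum>l<n. Q $$ (i, l) * unit_vec n j $ l) = Q $$ (i, j)"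
  proof -
    have "(\<Sum>l<n. Q $$ (i, l) * unit_vec n j $ l) = (\<Sum>l<n. if l = j then Q $$ (i, l) else 0)"
      by (rule sum.cong) (auto simp: unit_vec_def)
    then show ?thesis using ij by simp
  qed
  have "0 \<le> quad Q (unit_vec n j + x \<cdot>\<^sub>v unit_vec n i)" for x
    using psd_quad[OF psd] dim by simp
  then have "0 \<le> quad Q (unit_vec n j) + (2 * Q $$ (i, j)) * x + 0 * x\<^sup>2" for x
    unfolding quad_add[OF Q e ij(1)] s z by (simp add: algebra_simps)
  then have "2 * Q $$ (i, j) = 0" by (rule quadratic_nonneg_cofinite(2)[where bad = "{}", rotated]) auto
  then show ?thesis by simp
qed

lemma finite_basis:
  assumes "subspace S" "finite F" "S \<subseteq> span F"
  obtains Bs where "finite Bs" "independent Bs" "S = span Bs"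
proof -
  obtain Bs where Bs: "Bs \<subseteq> S" "independent Bs" "S \<subseteq> span Bs"
    using basis_exists by metis
  have "finite Bs" using independent_span_bound[OF assms(2) Bs(2)] Bs(1) assms(3) by blast
  with Bs(2) show ?thesis using span_subspace[OF Bs(1,3) assms(1)] that by simp
qed

text \<open>The order of the root 0 is the middle entry of \<open>inertia\<close>, so an inertia
  with middle entry 0 excludes nonzero kernel vectors.\<close>

lemma char_poly_order_zero:
  fixes A :: "real mat"
  assumes A: "A \<in> carrier_mat n n" and v: "v \<in> carrier_vec n" "v \<noteq> 0\<^sub>v n" "A *\<^sub>v v = 0\<^sub>v n"
  shows "order 0 (char_poly A) \<noteq> 0"
proof -
  have "eigenvalue A 0"
    unfolding eigenvalue_def eigenvector_def using A v by (intro exI[of _ v]) auto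
  then have "poly (char_poly A) 0 = 0" using eigenvalue_root_char_poly[OF A] by simp
  moreover have "char_poly A \<noteq> 0" using degree_monic_char_poly[OF A] by auto
  ultimately show ?thesis by (simp add: order_root)
qed

text \<open>If some window of the true behavior is missed by the data, a family of compatible systems whose
  output in channel m is perturbed with arbitrarily large gain must dissipate a common storage; comparing
  coefficients shows that row m of the supply matrix vanishes.\<close>

lemma informative_imp_hankel_space:
  fixes m p L :: nat and Phi Psi :: "real mat"
  defines "q \<equiv> m + p"
  assumes p: "p \<ge> 1" and Bstar: "Bstar \<in> Sigma_data m p wd" "Bstar \<in> L_cont m p L" and T: "L < length wd"
    and mo: "models m p Bstar E f g h k" and lag: "lag_le L E f h"
    and Phi: "sym_mat q Phi" "psd (- block22 m p Phi)" "order 0 (char_poly Phi) = 0"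
    and Psi: "sym_mat (q * L) Psi" "psd Psi"
    and diss: "\<And>Bh. Bh \<in> Sigma_data m p wd \<Longrightarrow> Bh \<in> L_cont m p L \<Longrightarrow> qdf_le_on q Bh (nabla q Psi) Phi"
  shows "hankel_space q L wd = io_sys.windows E f g h k (L + 1)"
proof (rule ccontr)
  assume neq: "hankel_space q L wd \<noteq> io_sys.windows E f g h k (L + 1)"
  interpret B: io_sys m q E f g h k using mo by (simp add: models_def q_def)
  have q: "q > 0" "m < q" using p by (simp_all add: q_def)
  let ?V = "hankel_space q L wd"
  have "?V \<subseteq> B.windows (L + 1)"
    unfolding q_def by (rule sigma_hankel_space[OF Bstar(1) T mo])
  then obtain w0 where w0: "w0 \<in> B.beh" "win (Suc L) w0 0 \<notin> ?V"
    using neq by (auto simp: B.windows_def)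
  obtain r :: "(nat \<Rightarrow> nat \<Rightarrow> real) \<Rightarrow> real" where r: "linear r" "\<And>v. v \<in> ?V \<Longrightarrow> r v = 0" "r (win (Suc L) w0 0) = 1"
    using separating_functional[OF subspace_hankel_space w0(2)] by blast
  have con: "sig_controllable B.beh"
    using Bstar(2) models_controllable[OF mo] by (simp add: L_cont_def)
  have "r (win (Suc L) w0 0) \<noteq> 0" using r(3) by simp
  then obtain bad where bad: "finite bad"
    "\<And>\<theta>. \<theta> \<notin> bad \<Longrightarrow> \<exists>(S :: (nat \<Rightarrow> nat \<Rightarrow> real) set) f' g' h' k' F. io_sys m q S f' g' h' k' \<and> finite F \<and>
      S \<subseteq> span F \<and> lag_le L S f' h' \<and> sig_controllable (io_sys.beh S f' g' h' k') \<and>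
      B.perturbation L r \<theta> (io_sys.beh S f' g' h' k')"
    using B.perturbed_systems[OF lag con q(2) r(1) w0(1)] by blast
  obtain ws where ws: "ws \<in> Bstar" "wd = map ws [0..<length wd]"
  proof -
    obtain w where "w \<in> Bstar" "wd = map w [0..<Suc (length wd - 1)]"
      using Bstar(1) by (auto simp: Sigma_data_def restr_def)
    moreover have "Suc (length wd - 1) = length wd" using T by simp
    ultimately have "wd = map w [0..<length wd]" by (simp only:)
    then show ?thesis using \<open>w \<in> Bstar\<close> by (rule that[rotated])
  qed
  have ws_beh: "signal q ws \<in> B.beh" using ws(1) mo by (simp add: models_def q_def)
  have r_data: "r (win (Suc L) (signal q ws) t) = 0" if "t + L < length wd" for t
  proof -
    have "win (L + 1) (signal q ws) t \<in> ?V"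
      unfolding hankel_space_eq_span[OF ws(2) T] by (rule span_base) (use that in auto)
    then show ?thesis using r(2) by simp
  qed
  define dec where "dec w = (\<lambda>t. vec q (w t))" for w :: "nat \<Rightarrow> nat \<Rightarrow> real"
  \<comment> \<open>\<open>\<beta> w\<close> is the size of the perturbation on the first window of
    \<open>w\<close>, \<open>l w\<close> is half the derivative of the supply in channel m at the
    sample \<open>w L\<close>, and \<open>c0 w\<close> collects the terms free of \<theta>.\<close>
  define \<beta> where "\<beta> w = r (win (Suc L) w 0)" for w
  define l where "l w = (\<Sum>j<q. Phi $$ (m, j) * w L j)" for w :: "nat \<Rightarrow> nat \<Rightarrow> real"
  define c0 where "c0 w = (\<Sum>t<L. qdf q Phi (dec w) t) + qdf q Psi (dec w) 0 + quad Phi (vec q (w L))" for w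
  have Psi_dim: "dim_row Psi = L * q" using Psi(1) by (auto simp: sym_mat_def mult.commute)
  have Phi_dim: "dim_row Phi = 1 * q" using Phi(1) by (auto simp: sym_mat_def)
  have nonneg: "0 \<le> c0 w + (2 * \<beta> w * l w) * \<theta> + ((\<beta> w)\<^sup>2 * Phi $$ (m, m)) * \<theta>\<^sup>2"
    if w: "w \<in> B.beh" and \<theta>: "\<theta> \<notin> bad" for w \<theta>
  proof -
    obtain S :: "(nat \<Rightarrow> nat \<Rightarrow> real) set" and f' g' h' k' F where P: "io_sys m q S f' g' h' k'"
      "finite F" "S \<subseteq> span F" "lag_le L S f' h'" "sig_controllable (io_sys.beh S f' g' h' k')"
      and pert: "B.perturbation L r \<theta> (io_sys.beh S f' g' h' k')"
      using bad(2)[OF \<theta>] by blast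
    interpret P: io_sys m q S f' g' h' k' by (rule P(1))
    define Bt where "Bt = {w. (\<forall>t. w t \<in> carrier_vec q) \<and> signal q w \<in> P.beh}"
    have mt: "models m p Bt S f' g' h' k'"
      using P(1) by (simp add: models_def Bt_def q_def)
    obtain Bs where "finite Bs" "independent Bs" "S = span Bs"
      using finite_basis[OF P.E(1) P(2,3)] by blast
    then have Lc: "Bt \<in> L_class m p"
      using rep_models[OF mt] unfolding L_class_def by blast
    then have Bt_cont: "Bt \<in> L_cont m p L"
      using lag_of_le[OF mt P(4)] models_controllable[OF mt] P(5) by (simp add: L_cont_def)
    have signal_dec: "signal q (dec v) = v" if "v \<in> P.beh" for v
      using P.beh_out[OF that] by (auto simp: signal_def dec_def fun_eq_iff)
    have dec_Bt: "dec v \<in> Bt" if "v \<in> P.beh" for v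
      using signal_dec[OF that] that by (simp add: Bt_def dec_def)
    obtain v where v: "v \<in> P.beh" "\<And>t. t < length wd \<Longrightarrow> v t = signal q ws t"
      using pert ws_beh r_data unfolding B.perturbation_def by blast
    have "dec v t = ws t" if "t < length wd" for t
    proof -
      have "ws t \<in> carrier_vec q" using ws(1) mo by (simp add: models_def q_def)
      then show ?thesis using v(2)[OF that] by (intro eq_vecI) (auto simp: dec_def signal_def)
    qed
    then have eq: "map ws [0..<length wd] = map (dec v) [0..<length wd]" by simp
    have "Suc (length wd - 1) = length wd" using T by simp
    then have "wd = map (dec v) [0..<Suc (length wd - 1)]" using trans[OF ws(2) eq] by (simp only:)
    then have "wd \<in> restr Bt 0 (length wd - 1)"
      using dec_Bt[OF v(1)] by (auto simp: restr_def)
    then have "Bt \<in> Sigma_data m p wd" using Lc by (simp add: Sigma_data_def)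
    then have le: "qdf_le_on q Bt (nabla q Psi) Phi" using diss Bt_cont by blast
    obtain w' where w': "w' \<in> P.beh" "win (Suc L) w' 0 = win (Suc L) w 0 + (\<theta> * \<beta> w) *\<^sub>R unit_win L m"
      using pert w unfolding B.perturbation_def \<beta>_def by blast
    have w'j: "w' j i = w j i + (\<theta> * \<beta> w) * unit_win L m j i" if "j \<le> L" for j i
      using fun_cong[OF fun_cong[OF w'(2), of j], of i] that by (simp add: win_def)
    let ?Q = "qdf q Psi (dec w')"
    have leQ: "qdf q (nabla q Psi) (dec w') t \<le> qdf q Phi (dec w') t" for t
      using le dec_Bt[OF w'(1)] unfolding qdf_le_on_def by blast
    have "?Q (Suc t) - ?Q t \<le> qdf q Phi (dec w') t" for t
      using leQ[of t] qdf_nabla[OF q(1) Psi(1), of "dec w'" t] by simp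
    then have "(\<Sum>t<Suc L. ?Q (Suc t) - ?Q t) \<le> (\<Sum>t<Suc L. qdf q Phi (dec w') t)"
      by (intro sum_mono)
    then have "?Q (Suc L) - ?Q 0 \<le> (\<Sum>t<L. qdf q Phi (dec w') t) + qdf q Phi (dec w') L"
      unfolding sum_lessThan_telescope by simp
    moreover have "0 \<le> ?Q (Suc L)"
      unfolding qdf_quad[OF q(1) Psi_dim] by (rule psd_quad[OF Psi(2)]) (simp add: Psi_dim)
    moreover have sw: "signal q (dec w') = w'" "signal q (dec w) = w"
      using signal_dec[OF w'(1)] B.beh_out[OF w] by (auto simp: signal_def dec_def fun_eq_iff)
    have early: "w' t = w t" if "t < L" for t
      using w'j[of t] that by (auto simp: unit_win_def fun_eq_iff)
    have "?Q 0 = qdf q Psi (dec w) 0"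
      unfolding qdf_quad[OF q(1) Psi_dim]
      by (subst stack_cong[of L q "dec w'" 0 "dec w" 0]) (use early in \<open>auto simp: sw win_eq_iff\<close>)
    moreover have "qdf q Phi (dec w') t = qdf q Phi (dec w) t" if "t < L" for t
      unfolding qdf_quad[OF q(1) Phi_dim]
      by (subst stack_cong[of 1 q "dec w'" t "dec w" t]) (use early that in \<open>auto simp: sw win_eq_iff\<close>)
    moreover have "qdf q Phi (dec w') L = quad Phi (vec q (w L)) + 2 * (\<theta> * \<beta> w) * l w + (\<theta> * \<beta> w)\<^sup>2 * Phi $$ (m, m)"
    proof -
      have "stack q (dec w') L 1 = vec q (w L) + (\<theta> * \<beta> w) \<cdot>\<^sub>v unit_vec q m"
        using w'j[of L] q(2) by (intro eq_vecI) (auto simp: stack_def dec_def unit_win_def)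
      then have "qdf q Phi (dec w') L = quad Phi (vec q (w L) + (\<theta> * \<beta> w) \<cdot>\<^sub>v unit_vec q m)"
        unfolding qdf_quad[OF q(1) Phi_dim] by simp
      then show ?thesis
        using quad_add[OF Phi(1) _ q(2), of "vec q (w L)" "\<theta> * \<beta> w"] by (simp add: l_def)
    qed
    ultimately have "0 \<le> c0 w + 2 * (\<theta> * \<beta> w) * l w + (\<theta> * \<beta> w)\<^sup>2 * Phi $$ (m, m)"
      by (simp add: c0_def)
    then show ?thesis by (simp add: power_mult_distrib algebra_simps)
  qed
  let ?N = "- block22 m p Phi"
  have N: "sym_mat p ?N"
    using Phi(2) by (auto simp: psd_def block22_def)
  have N_entry: "?N $$ (0, i) = - Phi $$ (m, m + i)" if "i < p" for i
    using that p by (simp add: block22_def)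
  have "0 \<le> quad ?N (0\<^sub>v p + 1 \<cdot>\<^sub>v unit_vec p 0)"
    by (rule psd_quad[OF Phi(2)]) (simp add: block22_def)
  moreover have "?N *\<^sub>v 0\<^sub>v p \<in> carrier_vec p"
    by (rule mult_mat_vec_carrier[of _ p p]) (simp_all add: block22_def)
  then have "quad ?N (0\<^sub>v p) = 0"
    unfolding quad_def by (rule scalar_prod_left_zero)
  ultimately have Phi_mm: "Phi $$ (m, m) \<le> 0"
    using quad_add[OF N zero_carrier_vec, of 0 1] N_entry[of 0] p by simp
  \<comment> \<open>The quadratic coefficient is nonpositive because the output block is; a
    quadratic that stays nonnegative for large \<theta> of both signs is then constant.\<close>
  have lin: "Phi $$ (m, m) = 0 \<and> l w = 0" if w: "w \<in> B.beh" "\<beta> w \<noteq> 0" for w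
  proof -
    have le: "(\<beta> w)\<^sup>2 * Phi $$ (m, m) \<le> 0" using Phi_mm by (simp add: mult_nonneg_nonpos)
    show ?thesis
      using quadratic_nonneg_cofinite[OF bad(1) nonneg[OF w(1)] le] w(2) by simp
  qed
  have \<beta>0: "\<beta> w0 = 1" using r(3) by (simp add: \<beta>_def)
  have Phi_y: "Phi $$ (m, m + i) = 0" if "i < p" for i
    using psd_zero_diagonal[OF Phi(2) N, of 0 i] N_entry[of 0] N_entry[OF that] lin[OF w0(1)] \<beta>0 p that by simp
  have l_add: "l (v + w) = l v + l w" for v w
    by (simp add: l_def sum.distrib algebra_simps)
  have \<beta>_add: "\<beta> (v + w) = \<beta> v + \<beta> w" for v w
    by (simp add: \<beta>_def linear_add[OF linear_win] linear_add[OF r(1)])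
  \<comment> \<open>A trajectory with \<open>\<beta> w = 0\<close> is not moved by the perturbation.
    Adding \<open>w0\<close> makes it moved, and \<open>l\<close> is additive.\<close>
  have l_zero: "l w = 0" if w: "w \<in> B.beh" for w
  proof (cases "\<beta> w = 0")
    case True
    then have "l (w + w0) = 0"
      using lin[OF subspace_add[OF B.beh_subspace w w0(1)]] \<beta>_add \<beta>0 by simp
    then show ?thesis using l_add lin[OF w0(1)] \<beta>0 by simp
  qed (use lin w in blast)
  \<comment> \<open>Inputs at time L are free, so some trajectory has the j-th unit vector as its
    input there. The output entries of row m are already known to vanish, and \<open>l\<close> picks
    out the entry in column j.\<close>
  have Phi_u: "Phi $$ (m, j) = 0" if j: "j < m" for j
  proof -
    obtain w where w: "w \<in> B.beh" "\<And>i. i < m \<Longrightarrow> w L i = (if i = j then 1 else 0)"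
      using B.beh_input[OF w0(1), of L "\<lambda>_ i. if i = j then 1 else 0"] by (metis order_refl)
    have "Phi $$ (m, i) * w L i = (if i = j then Phi $$ (m, j) else 0)" if "i < q" for i
    proof (cases "i < m")
      case True
      then show ?thesis using w(2)[OF True] by simp
    next
      case False
      then have "Phi $$ (m, i) = 0" using Phi_y[of "i - m"] that by (simp add: q_def)
      then show ?thesis using False j by auto
    qed
    then have "l w = (\<Sum>i<q. if i = j then Phi $$ (m, j) else 0)"
      unfolding l_def by (intro sum.cong) auto
    then show ?thesis using l_zero[OF w(1)] j by (simp add: q_def)
  qed
  have row: "Phi $$ (m, i) = 0" if "i < q" for i
    using Phi_u[of i] Phi_y[of "i - m"] that by (cases "i < m") (auto simp: q_def)
  have Phi_c: "Phi \<in> carrier_mat q q" "transpose_mat Phi = Phi" using Phi(1) by (simp_all add: sym_mat_def)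
  have "Phi $$ (i, m) = Phi $$ (m, i)" if "i < q" for i
    using arg_cong[OF Phi_c(2), of "\<lambda>A. A $$ (i, m)"] that q(2) Phi_c(1) by simp
  then have "Phi *\<^sub>v unit_vec q m = 0\<^sub>v q"
    using row Phi_c(1) q(2) by (intro eq_vecI) (auto simp: scalar_prod_right_unit)
  then show False
    using char_poly_order_zero[OF Phi_c(1), of "unit_vec q m"] Phi(3) q(2) by simp
qed

lemma n_min_le:
  assumes Bh: "Bh \<in> Sigma_data m p wd" and mo: "models m p Bh E f g h k"
    and Bs: "finite Bs" "independent Bs" "E = span Bs"
  shows "n_min m p wd \<le> card Bs"
proof -
  have "n_of m p Bh \<le> card Bs"
    unfolding n_of_def by (rule Least_le) (rule rep_models[OF mo Bs])
  moreover have "n_min m p wd \<le> n_of m p Bh"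
    unfolding n_min_def by (rule Least_le) (use Bh in blast)
  ultimately show ?thesis by simp
qed

text \<open>The upper bound holds for all data. Conversely, an observable model of dimension n has a
  window space of dimension at least \<open>n + m * (L + 1)\<close>, and n is at least
  \<open>n_min\<close> because the model explains the data.\<close>

lemma rk_hankel_eq:
  assumes Bh: "Bh \<in> Sigma_data m p wd" and T: "L < length wd"
    and mo: "models m p Bh E f g h k" and lag: "lag_le L E f h" and F: "finite F" "E \<subseteq> span F"
    and V: "hankel_space (m + p) L wd = io_sys.windows E f g h k (L + 1)"
  shows "rk (hankel (m + p) (L + 1) wd) = n_min m p wd + m * (L + 1)"
proof (rule antisym)
  show "rk (hankel (m + p) (L + 1) wd) \<le> n_min m p wd + m * (L + 1)"
    using rk_hankel_le[of m p wd L] Bh T by blast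
  interpret B: io_sys m "m + p" E f g h k using mo by (simp add: models_def)
  obtain E' :: "(nat \<Rightarrow> nat \<Rightarrow> real) set" and f' g' h' F' where O:
    "models m p Bh E' f' g' h' k" "finite F'" "E' \<subseteq> span F'"
    "\<And>x. x \<in> E' \<Longrightarrow> (\<And>j. j < L \<Longrightarrow> h' ((f' ^^ j) x) = 0) \<Longrightarrow> x = 0"
    using observable_model[OF mo F lag] by blast
  interpret O: io_sys m "m + p" E' f' g' h' k using O(1) by (simp add: models_def)
  obtain Bs where Bs: "finite Bs" "independent Bs" "E' = span Bs"
    using finite_basis[OF O.E(1) O(2,3)] by blast
  have "card Bs + m * (L + 1) \<le> dim (O.windows (L + 1))"
    using Bs O(4) by (intro O.windows_dim_ge) (auto intro: span_base)
  also have "O.windows (L + 1) = B.windows (L + 1)"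
    unfolding O.windows_def B.windows_def models_beh[OF mo] models_beh[OF O(1)] ..
  also have "dim \<dots> = rk (hankel (m + p) (L + 1) wd)"
    unfolding V[symmetric] by (rule dim_hankel_space)
  finally show "n_min m p wd + m * (L + 1) \<le> rk (hankel (m + p) (L + 1) wd)"
    using n_min_le[OF Bh O(1) Bs] by simp
qed

theorem theorem3:
  fixes m p L T :: nat and Phi :: "real mat" and Bstar :: "(nat \<Rightarrow> real vec) set"
    and wd :: "real vec list"
  defines "q \<equiv> m + p"
  defines "d \<equiv> nat (max (qdf_deg q Phi) (int L))"
  defines "H \<equiv> hankel q (d + 1) wd"
  assumes m_pos: "m \<ge> 1" and p_pos: "p \<ge> 1"
    and Phi_min: "sym_mat (nat (qdf_deg q Phi + 1) * q) Phi"
    and Bstar: "Bstar \<in> L_cont m p L"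
    and data: "wd \<in> restr Bstar 0 (T - 1)"
    and T_ge: "T \<ge> d + 1"
  shows
    "(\<forall>Psi. rk H = n_min m p wd + m * (d + 1) \<and> sym_mat (q * d) Psi \<and> psd Psi \<and>
            lmi_cond q d Phi Psi H \<longrightarrow>
          informative_diss m p L wd Phi \<and> storage_function q Bstar Phi Psi)
     \<and>
     (qdf_deg q Phi = 0 \<and> inertia Phi = (p, 0, m) \<and> psd (- block22 m p Phi) \<longrightarrow>
        (informative_diss m p L wd Phi \<longleftrightarrow>
           rk H = n_min m p wd + m * (L + 1) \<and>
           (\<exists>Psi. sym_mat (q * L) Psi \<and> psd Psi \<and> lmi_cond q d Phi Psi H)))"
proof -
  have q: "q > 0" using m_pos by (simp add: q_def)
  have L_d: "L \<le> d" by (simp add: d_def)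
  \<comment> \<open>For the void matrix the degree is -1 and the number of blocks 0; in every case
    the minimal \<open>Phi\<close> fits into a window of length d + 1.\<close>
  have e: "nat (qdf_deg q Phi + 1) \<le> d + 1" by (simp add: d_def)
  \<comment> \<open>A member of the restriction to [0, T - 1] has length \<open>Suc (T - 1)\<close>,
    which is T because T is positive.\<close>
  have T: "d < length wd" "length wd - 1 = T - 1"
    using data T_ge by (auto simp: restr_def)
  have Lc: "Bstar \<in> L_class m p" "lag_of m p Bstar \<le> L" "controllable Bstar"
    using Bstar by (simp_all add: L_cont_def)
  have Sig: "Bstar \<in> Sigma_data m p wd"
    using Lc(1) data T(2) by (simp add: Sigma_data_def)
  have H: "H \<in> carrier_mat ((d + 1) * q) (dim_col H)"
    using hankel_carrier[of q "d + 1" wd] by (auto simp: H_def)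
  have inf_def: "informative_diss m p L wd Phi \<longleftrightarrow> (\<exists>Psi. sym_mat (q * d) Psi \<and> psd Psi \<and>
      (\<forall>Bh \<in> Sigma_data m p wd \<inter> L_cont m p L. qdf_le_on q Bh (nabla q Psi) Phi))"
    by (simp add: informative_diss_def Let_def q_def d_def)
  have part1: "informative_diss m p L wd Phi \<and> storage_function q Bstar Phi Psi"
    if rank: "rk H = n_min m p wd + m * (d + 1)" and Psi: "sym_mat (q * d) Psi" "psd Psi"
      and lmi: "lmi_cond q d Phi Psi H" for Psi
  proof -
    have le: "qdf_le_on q Bh (nabla q Psi) Phi" if Bh: "Bh \<in> Sigma_data m p wd" "Bh \<in> L_cont m p L" for Bh
      unfolding qdf_le_on_def
    proof (intro ballI allI)
      fix w t assume w: "w \<in> Bh"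
      \<comment> \<open>The rank condition puts every window of every competing system into the
        column space of \<open>H\<close>, where the matrix inequality tests the form.\<close>
      have "win (d + 1) (signal q w) t \<in> hankel_space q d wd"
        unfolding q_def
        by (rule rank_condition_windows[OF _ Bh L_d T(1) w]) (use rank in \<open>simp add: H_def q_def\<close>)
      then obtain \<xi> where "\<xi> \<in> carrier_vec (dim_col H)" "stack q w t (d + 1) = H *\<^sub>v \<xi>"
        unfolding H_def by (rule hankel_space_stack)
      then have "0 \<le> quad (lmi_mat q d Psi Phi) (stack q w t (d + 1))"
        using lmi lmi_cond_iff[OF q Psi(1) Phi_min e H] by metis
      then show "qdf q (nabla q Psi) w t \<le> qdf q Phi w t"
        using quad_lmi_mat[OF q Psi(1) Phi_min e, of w t] by simp
    qed
    have dim: "dim_row Psi = d * q" using Psi(1) by (auto simp: sym_mat_def mult.commute)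
    have "0 \<le> qdf q Psi w t" for w t
      unfolding qdf_quad[OF q dim] by (rule psd_quad[OF Psi(2)]) (simp add: dim)
    then have "storage_function q Bstar Phi Psi"
      using le[OF Sig Bstar] by (simp add: storage_function_def)
    moreover have "informative_diss m p L wd Phi"
      unfolding inf_def using le Psi by blast
    ultimately show ?thesis by blast
  qed
  have part2: "rk H = n_min m p wd + m * (L + 1) \<and> (\<exists>Psi. sym_mat (q * L) Psi \<and> psd Psi \<and> lmi_cond q d Phi Psi H)"
    if deg: "qdf_deg q Phi = 0" and inertia: "inertia Phi = (p, 0, m)" and neg: "psd (- block22 m p Phi)"
      and inf: "informative_diss m p L wd Phi"
  proof -
    have dL: "d = L" using deg by (simp add: d_def)
    have Phi: "sym_mat q Phi" using Phi_min deg by simp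
    obtain Psi where Psi: "sym_mat (q * L) Psi" "psd Psi"
      and le: "\<And>Bh. Bh \<in> Sigma_data m p wd \<Longrightarrow> Bh \<in> L_cont m p L \<Longrightarrow> qdf_le_on q Bh (nabla q Psi) Phi"
      using inf unfolding inf_def dL by blast
    obtain E :: "(nat \<Rightarrow> real) set" and f g h k F where mo: "models m p Bstar E f g h k" and lag: "lag_le L E f h"
      and F: "finite F" "E \<subseteq> span F"
      using L_class_lag[OF Lc(1,2)] by metis
    interpret B: io_sys m q E f g h k using mo by (simp add: models_def q_def)
    have "order 0 (char_poly Phi) = 0" using inertia by (simp add: inertia_def)
    then have V: "hankel_space q L wd = B.windows (L + 1)"
      unfolding q_def using informative_imp_hankel_space[OF p_pos Sig Bstar _ mo lag _ neg _ _ Psi(2)]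
        Phi Psi(1) le T(1) dL by (simp add: q_def)
    have "rk H = n_min m p wd + m * (L + 1)"
      using rk_hankel_eq[OF Sig _ mo lag F] V T(1) dL by (simp add: q_def H_def)
    moreover have "lmi_cond q d Phi Psi H"
      unfolding lmi_cond_iff[OF q Psi(1)[folded dL] Phi_min e H]
    proof
      fix \<xi> :: "real vec" assume \<xi>: "\<xi> \<in> carrier_vec (dim_col H)"
      have "unflat q (d + 1) (vec_fun (H *\<^sub>v \<xi>)) \<in> B.windows (d + 1)"
        using hankel_space_mult[of \<xi> q d wd] \<xi> V by (simp add: H_def dL)
      then obtain v where v: "v \<in> B.beh" "unflat q (d + 1) (vec_fun (H *\<^sub>v \<xi>)) = win (d + 1) v 0"
        by (auto simp: B.windows_def)
      obtain w where w: "w \<in> Bstar" "v = signal q w" using v(1) models_beh[OF mo] by (auto simp: q_def)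
      \<comment> \<open>In this direction every vector of the column space is the window at time 0
        of a true trajectory, so the matrix inequality is the dissipation inequality for that
        trajectory.\<close>
      have "H *\<^sub>v \<xi> = stack q w 0 (d + 1)"
        by (rule stack_eqI) (use mult_mat_vec_carrier[OF H \<xi>] v(2) w(2) in simp_all)
      moreover have "qdf q (nabla q Psi) w 0 \<le> qdf q Phi w 0"
        using le[OF Sig Bstar] w(1) by (simp add: qdf_le_on_def)
      ultimately show "0 \<le> quad (lmi_mat q d Psi Phi) (H *\<^sub>v \<xi>)"
        using quad_lmi_mat[OF q Psi(1)[folded dL] Phi_min e, of w 0] by simp
    qed
    ultimately show ?thesis using Psi by blast
  qed
  have "informative_diss m p L wd Phi"
    if "qdf_deg q Phi = 0" "rk H = n_min m p wd + m * (L + 1)" "sym_mat (q * L) Psi" "psd Psi" "lmi_cond q d Phi Psi H" for Psi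
  proof -
    have "d = L" using that(1) by (simp add: d_def)
    then show ?thesis using part1[of Psi] that by simp
  qed
  then show ?thesis using part1 part2 by blast
qed

end
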